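(* Let $k$ be a field, let $E=k\langle e_1,\ldots,e_n\rangle$ be an exterior algebra over $k$ (where $n\ge 1$), and let $h\in E$ be a homogeneous form. Then $E/(h)$ is Koszul if and only if $h$ is a reducible quadratic form, namely $h$ is a product of two linear forms.
   Context: $k\langle e_1,\ldots,e_n\rangle$ denotes the exterior algebra $\bigwedge V$ of a $k$-vector space $V$ of dimension $n$ with fixed basis $e_1,\ldots,e_n$, graded by $\deg e_i=1$ for $1\le i\le n$; the product $a\wedge b$ is written $ab$. Thus $ab=(-1)^{(\deg a)(\deg b)}ba$ for all homogeneous $a,b\in E$, and $aa=0$ if $\deg a$ is odd. $(h)$ is the ideal of $E$ generated by $h$. A linear form is a homogeneous element of degree $1$, and a quadratic form is a homogeneous element of degree $2$. A standard graded $k$-algebra $R$ that is a quotient of a polynomial or exterior algebra (with the standard grading) is called a Koszul algebra if the residue field $k$ has a linear free resolution over $R$, i.e. $\operatorname{Tor}^R_i(k,k)_j=0$ whenever $i\ne j$, where $j$ denotes the internal degree.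
   Formalization: The form h is assumed not to be a nonzero linear form: for such h, E/(h) is an exterior algebra in n−1 variables, hence Koszul, although h is not a quadratic form, so the statement fails exactly there. *)

theory Defs
  imports "HOL-Algebra.QuotRing" "HOL-Algebra.Generated_Rings"
begin

section \<open>The exterior algebra on a fixed basis\<close>

text \<open>An element of the exterior algebra on \<open>e\<^sub>1, \<dots>, e\<^sub>n\<close> is given by its coefficients on
  the monomials \<open>e\<^sub>S = e\<^bsub>s1\<^esub> \<cdots> e\<^bsub>sm\<^esub>\<close> where \<open>S = {s1 < \<dots> < sm} \<subseteq> {1..n}\<close>.\<close>

type_synonym 'k ext = "nat set \<Rightarrow> 'k"

text \<open>For disjoint \<open>S\<close>, \<open>T\<close>, sorting the word \<open>e\<^sub>S e\<^sub>T\<close> takes one transposition for each pair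
  \<open>t < s\<close>, so \<open>e\<^sub>S e\<^sub>T = ext_sign S T e\<^bsub>S \<union> T\<^esub>\<close>; for non-disjoint ones \<open>e\<^sub>S e\<^sub>T = 0\<close>.
  Hence the coefficient of \<open>e\<^sub>U\<close> in a product is a sum over \<open>S \<subseteq> U\<close> with \<open>T = U - S\<close>.\<close>

definition ext_sign :: "nat set \<Rightarrow> nat set \<Rightarrow> 'k::field" where
  "ext_sign S T = (- 1) ^ card {(s, t). s \<in> S \<and> t \<in> T \<and> t < s}"

definition ext_mult :: "'k::field ext \<Rightarrow> 'k ext \<Rightarrow> 'k ext" where
  "ext_mult a b = (\<lambda>U. \<Sum>S\<in>Pow U. ext_sign S (U - S) * a S * b (U - S))"

definition exterior_algebra :: "nat \<Rightarrow> 'k::field ext ring" where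
  "exterior_algebra n =
    \<lparr>carrier = {a. \<forall>S. a S \<noteq> 0 \<longrightarrow> S \<subseteq> {1..n}},
     mult = ext_mult,
     one = (\<lambda>S. if S = {} then 1 else 0),
     zero = (\<lambda>S. 0),
     add = (\<lambda>a b S. a S + b S)\<rparr>"

definition ext_deg :: "nat \<Rightarrow> nat \<Rightarrow> 'k::field ext set" where
  "ext_deg n d = {a \<in> carrier (exterior_algebra n). \<forall>S. a S \<noteq> 0 \<longrightarrow> card S = d}"

definition ext_gen :: "nat \<Rightarrow> 'k::field ext" where
  "ext_gen i = (\<lambda>S. if S = {i} then 1 else 0)"

lemma ext_sign_empty: "ext_sign {} T = 1" "ext_sign S {} = 1"
  by (simp_all add: ext_sign_def)

lemma ext_sign_Un_left:
  assumes "finite A" "finite B" "finite C" "A \<inter> B = {}"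
  shows "(ext_sign (A \<union> B) C :: 'k::field) = ext_sign A C * ext_sign B C"
proof -
  have eq: "{(s, t). s \<in> A \<union> B \<and> t \<in> C \<and> t < s}
      = {(s, t). s \<in> A \<and> t \<in> C \<and> t < s} \<union> {(s, t). s \<in> B \<and> t \<in> C \<and> t < s}"
    by auto
  have "finite {(s, t). s \<in> A \<and> t \<in> C \<and> t < s}"
    by (rule finite_subset[of _ "A \<times> C"]) (use assms in auto)
  moreover have "finite {(s, t). s \<in> B \<and> t \<in> C \<and> t < s}"
    by (rule finite_subset[of _ "B \<times> C"]) (use assms in auto)
  ultimately show ?thesis
    unfolding ext_sign_def eq using assms(4)
    by (subst card_Un_disjoint) (auto simp: power_add)
qed

lemma ext_sign_Un_right:
  assumes "finite A" "finite B" "finite C" "B \<inter> C = {}"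
  shows "(ext_sign A (B \<union> C) :: 'k::field) = ext_sign A B * ext_sign A C"
proof -
  have eq: "{(s, t). s \<in> A \<and> t \<in> B \<union> C \<and> t < s}
      = {(s, t). s \<in> A \<and> t \<in> B \<and> t < s} \<union> {(s, t). s \<in> A \<and> t \<in> C \<and> t < s}"
    by auto
  have "finite {(s, t). s \<in> A \<and> t \<in> B \<and> t < s}"
    by (rule finite_subset[of _ "A \<times> B"]) (use assms in auto)
  moreover have "finite {(s, t). s \<in> A \<and> t \<in> C \<and> t < s}"
    by (rule finite_subset[of _ "A \<times> C"]) (use assms in auto)
  ultimately show ?thesis
    unfolding ext_sign_def eq using assms(4)
    by (subst card_Un_disjoint) (auto simp: power_add)
qed

lemma ext_mult_assoc: "ext_mult (ext_mult a b) c = ext_mult a (ext_mult b c)"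
proof
  fix U :: "nat set"
  show "ext_mult (ext_mult a b) c U = ext_mult a (ext_mult b c) U"
  proof (cases "finite U")
    case False
    then show ?thesis by (simp add: ext_mult_def)
  next
    case True
    let ?L = "\<lambda>X S. ext_sign X (U - X) * (ext_sign S (X - S) * a S * b (X - S)) * c (U - X)"
    let ?R = "\<lambda>S T. ext_sign S (U - S) * a S *
      (ext_sign T (U - S - T) * b T * c (U - S - T))"
    have "ext_mult (ext_mult a b) c U = (\<Sum>X\<in>Pow U. \<Sum>S\<in>Pow X. ?L X S)"
      by (simp add: ext_mult_def sum_distrib_left sum_distrib_right)
    also have "\<dots> = (\<Sum>(X, S)\<in>Sigma (Pow U) Pow. ?L X S)"
      using True by (subst sum.Sigma) (auto intro: finite_subset)
    also have "\<dots> = (\<Sum>(S, T)\<in>Sigma (Pow U) (\<lambda>S. Pow (U - S)). ?R S T)"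
    proof (rule sum.reindex_bij_witness[where i = "\<lambda>(S, T). (S \<union> T, S)"
          and j = "\<lambda>(X, S). (S, X - S)"], goal_cases)
      case (5 p)
      then obtain X S where p: "p = (X, S)" "X \<subseteq> U" "S \<subseteq> X" by auto
      have fin: "finite S" "finite (X - S)" "finite (U - X)"
        using p True by (auto intro: finite_subset)
      have X: "X = S \<union> (X - S)" and US: "U - S = (X - S) \<union> (U - X)"
        and UX: "U - S - (X - S) = U - X" using p by auto
      have "(ext_sign X (U - X) :: 'a) = ext_sign S (U - X) * ext_sign (X - S) (U - X)"
        using ext_sign_Un_left[OF fin(1,2,3)] X by auto
      moreover have "(ext_sign S (U - S) :: 'a) = ext_sign S (X - S) * ext_sign S (U - X)"
        using ext_sign_Un_right[OF fin(1,2,3)] US by auto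
      ultimately show ?case by (simp add: p(1) UX)
    qed auto
    also have "\<dots> = (\<Sum>S\<in>Pow U. \<Sum>T\<in>Pow (U - S). ?R S T)"
      using True by (subst sum.Sigma) auto
    also have "\<dots> = ext_mult a (ext_mult b c) U"
      by (simp add: ext_mult_def sum_distrib_left)
    finally show ?thesis .
  qed
qed

lemma ext_mult_closed:
  assumes "a \<in> carrier (exterior_algebra n)" "b \<in> carrier (exterior_algebra n)"
  shows "ext_mult a b \<in> carrier (exterior_algebra n)"
proof -
  { fix U assume "ext_mult a b U \<noteq> 0"
    then obtain S where "S \<in> Pow U" "ext_sign S (U - S) * a S * b (U - S) \<noteq> 0"
      unfolding ext_mult_def by (rule sum.not_neutral_contains_not_neutral)
    then have "S \<subseteq> {1..n}" "U - S \<subseteq> {1..n}"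
      using assms by (auto simp: exterior_algebra_def)
    then have "U \<subseteq> {1..n}" by blast }
  then show ?thesis by (simp add: exterior_algebra_def)
qed

lemma ext_one_mult:
  assumes "a \<in> carrier (exterior_algebra n)"
  shows "ext_mult (\<lambda>S. if S = {} then 1 else 0) a = a"
    and "ext_mult a (\<lambda>S. if S = {} then 1 else 0) = a"
proof -
  have inf: "a U = 0" if "infinite U" for U
    using assms that finite_subset[of U "{1..n}"] by (auto simp: exterior_algebra_def)
  show "ext_mult (\<lambda>S. if S = {} then 1 else 0) a = a"
  proof
    fix U show "ext_mult (\<lambda>S. if S = {} then 1 else 0) a U = a U"
    proof (cases "finite U")
      case True
      have "ext_mult (\<lambda>S. if S = {} then 1 else 0) a U = (\<Sum>S\<in>Pow U. if S = {} then a U else 0)"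
        unfolding ext_mult_def by (rule sum.cong) (auto simp: ext_sign_empty)
      then show ?thesis using True by (simp add: sum.delta)
    qed (simp add: ext_mult_def inf)
  qed
  show "ext_mult a (\<lambda>S. if S = {} then 1 else 0) = a"
  proof
    fix U show "ext_mult a (\<lambda>S. if S = {} then 1 else 0) U = a U"
    proof (cases "finite U")
      case True
      have "ext_mult a (\<lambda>S. if S = {} then 1 else 0) U = (\<Sum>S\<in>Pow U. if S = U then a U else 0)"
        unfolding ext_mult_def by (rule sum.cong) (auto simp: ext_sign_empty)
      then show ?thesis using True by (simp add: sum.delta)
    qed (simp add: ext_mult_def inf)
  qed
qed

lemma exterior_algebra_ring: "ring (exterior_algebra n :: 'k::field ext ring)"
proof (rule ringI)
  show "abelian_group (exterior_algebra n :: 'k ext ring)"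
  proof (rule abelian_groupI)
    fix x :: "'k ext" assume "x \<in> carrier (exterior_algebra n)"
    then show "\<exists>y\<in>carrier (exterior_algebra n). y \<oplus>\<^bsub>exterior_algebra n\<^esub> x = \<zero>\<^bsub>exterior_algebra n\<^esub>"
      by (intro bexI[of _ "\<lambda>S. - x S"]) (auto simp: exterior_algebra_def)
  next
    fix x y :: "'k ext"
    assume "x \<in> carrier (exterior_algebra n)" "y \<in> carrier (exterior_algebra n)"
    then show "x \<oplus>\<^bsub>exterior_algebra n\<^esub> y \<in> carrier (exterior_algebra n)"
      by (auto simp: exterior_algebra_def) (metis add_0 subsetD atLeastAtMost_iff)+
  qed (auto simp: exterior_algebra_def algebra_simps)
  show "Group.monoid (exterior_algebra n :: 'k ext ring)"
  proof (rule monoidI)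
    fix x y :: "'k ext"
    assume "x \<in> carrier (exterior_algebra n)" "y \<in> carrier (exterior_algebra n)"
    then show "x \<otimes>\<^bsub>exterior_algebra n\<^esub> y \<in> carrier (exterior_algebra n)"
      using ext_mult_closed by (simp add: exterior_algebra_def)
  next
    fix x :: "'k ext" assume "x \<in> carrier (exterior_algebra n)"
    then show "\<one>\<^bsub>exterior_algebra n\<^esub> \<otimes>\<^bsub>exterior_algebra n\<^esub> x = x"
      "x \<otimes>\<^bsub>exterior_algebra n\<^esub> \<one>\<^bsub>exterior_algebra n\<^esub> = x"
      using ext_one_mult[of x n] by (simp_all add: exterior_algebra_def)
  qed (auto simp: exterior_algebra_def ext_mult_assoc)
qed (auto simp: exterior_algebra_def ext_mult_def fun_eq_iff algebra_simps sum.distrib)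

lemma ext_gen_mult:
  "ext_mult (ext_gen i) (ext_gen j) U =
    (if i \<noteq> j \<and> U = {i, j} then (if i < j then 1 else - 1) else 0 :: 'k::field)"
proof (cases "finite U \<and> i \<in> U")
  case True
  then have "ext_mult (ext_gen i) (ext_gen j) U
      = (\<Sum>S\<in>Pow U. if S = {i} then ext_sign {i} (U - {i}) * ext_gen j (U - {i}) else 0 :: 'k)"
    unfolding ext_mult_def by (intro sum.cong) (auto simp: ext_gen_def)
  also have "\<dots> = ext_sign {i} (U - {i}) * ext_gen j (U - {i})"
    using True by (simp add: sum.delta)
  also have "\<dots> = (if i \<noteq> j \<and> U = {i, j} then ext_sign {i} {j} else 0)"
    using True by (auto simp: ext_gen_def)
  also have "ext_sign {i} {j} = (if j < i then - 1 else 1 :: 'k)"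
  proof -
    have "{(s, t). s \<in> {i} \<and> t \<in> {j} \<and> t < s} = (if j < i then {(i, j)} else {})"
      by auto
    then show ?thesis by (simp add: ext_sign_def)
  qed
  finally show ?thesis by auto
next
  case False
  then have "ext_mult (ext_gen i) (ext_gen j) U = (0 :: 'k)"
    unfolding ext_mult_def by (cases "finite U") (auto intro!: sum.neutral simp: ext_gen_def)
  then show ?thesis using False by auto
qed

section \<open>Standard graded algebras and Koszulness\<close>

text \<open>The ground field of the \<open>k\<close>-algebra \<open>R\<close> is the central subfield \<open>gr 0\<close>. In particular the
  zero ring is not standard graded.\<close>

locale standard_graded = ring R for R (structure) +
  fixes gr :: "nat \<Rightarrow> 'a set"
  assumes gr_subgroup: "additive_subgroup (gr d) R"
    and gr_decomp: "x \<in> carrier R \<Longrightarrow>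
      \<exists>!c. (\<forall>d. c d \<in> gr d) \<and> finite {d. c d \<noteq> \<zero>} \<and> x = (\<Oplus>d\<in>{d. c d \<noteq> \<zero>}. c d)"
    and gr_mult: "x \<in> gr d \<Longrightarrow> y \<in> gr e \<Longrightarrow> x \<otimes> y \<in> gr (d + e)"
    and gr_0_field: "field (R\<lparr>carrier := gr 0\<rparr>)"
    and gr_0_central: "x \<in> gr 0 \<Longrightarrow> y \<in> carrier R \<Longrightarrow> x \<otimes> y = y \<otimes> x"
    and generated_in_degree_1: "\<exists>B. finite B \<and> B \<subseteq> gr 1 \<and> generate_ring R (gr 0 \<union> B) = carrier R"

definition irrelevant_ideal :: "('a, 'm) ring_scheme \<Rightarrow> (nat \<Rightarrow> 'a set) \<Rightarrow> 'a set" where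
  "irrelevant_ideal R gr = Idl\<^bsub>R\<^esub> (\<Union>d\<in>{1..}. gr d)"

text \<open>The free left module of rank \<open>p\<close> consists of row vectors, on which matrices act \<open>R\<close>-linearly
  by multiplication from the right.\<close>

definition free_mod :: "('a, 'm) ring_scheme \<Rightarrow> nat \<Rightarrow> (nat \<Rightarrow> 'a) set" where
  "free_mod R p = {..<p} \<rightarrow>\<^sub>E carrier R"

definition row_map ::
  "('a, 'm) ring_scheme \<Rightarrow> nat \<Rightarrow> nat \<Rightarrow> (nat \<Rightarrow> nat \<Rightarrow> 'a) \<Rightarrow> (nat \<Rightarrow> 'a) \<Rightarrow> (nat \<Rightarrow> 'a)" where
  "row_map R p q A x = (\<lambda>c\<in>{..<q}. \<Oplus>\<^bsub>R\<^esub>r\<in>{..<p}. x r \<otimes>\<^bsub>R\<^esub> A r c)"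

text \<open>A graded free resolution \<open>\<cdots> \<rightarrow> F\<^sub>2 \<rightarrow> F\<^sub>1 \<rightarrow> F\<^sub>0 = R \<rightarrow> R/R\<^sub>+ = k \<rightarrow> 0\<close> by free modules of finite
  rank. The list \<open>s i\<close> consists of the degrees of the basis elements of \<open>F\<^sub>i\<close>, i.e. \<open>F\<^sub>i\<close> is the
  direct sum of the \<open>R(-m)\<close> with \<open>m\<close> in \<open>s i\<close>, and \<open>A i\<close> is the matrix of \<open>F\<^bsub>i+1\<^esub> \<rightarrow> F\<^sub>i\<close>. The differentials
  are homogeneous of degree \<open>0\<close>, which determines the degrees of the matrix entries.\<close>

definition graded_free_resolution ::
  "('a, 'm) ring_scheme \<Rightarrow> (nat \<Rightarrow> 'a set) \<Rightarrow> (nat \<Rightarrow> nat list) \<Rightarrow> (nat \<Rightarrow> nat \<Rightarrow> nat \<Rightarrow> 'a) \<Rightarrow> bool" where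
  "graded_free_resolution R gr s A \<longleftrightarrow>
    (let F = (\<lambda>i. free_mod R (length (s i)));
         D = (\<lambda>i. row_map R (length (s (Suc i))) (length (s i)) (A i))
     in s 0 = [0] \<and>
        (\<forall>i. \<forall>r<length (s (Suc i)). \<forall>c<length (s i).
          if s i ! c \<le> s (Suc i) ! r then A i r c \<in> gr (s (Suc i) ! r - s i ! c)
          else A i r c = \<zero>\<^bsub>R\<^esub>) \<and>
        D 0 ` F 1 = {x \<in> F 0. x 0 \<in> irrelevant_ideal R gr} \<and>
        (\<forall>i. D (Suc i) ` F (Suc (Suc i)) =
          {x \<in> F (Suc i). \<forall>c<length (s i). D i x c = \<zero>\<^bsub>R\<^esub>}))"

definition has_linear_resolution :: "('a, 'm) ring_scheme \<Rightarrow> (nat \<Rightarrow> 'a set) \<Rightarrow> bool" where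
  "has_linear_resolution R gr \<longleftrightarrow>
    (\<exists>s A. graded_free_resolution R gr s A \<and> (\<forall>i. set (s i) \<subseteq> {i}))"

definition koszul :: "('a, 'm) ring_scheme \<Rightarrow> (nat \<Rightarrow> 'a set) \<Rightarrow> bool" where
  "koszul R gr \<longleftrightarrow> standard_graded R gr \<and> has_linear_resolution R gr"

section \<open>Quotients by a form\<close>

definition ext_quot :: "nat \<Rightarrow> 'k::field ext \<Rightarrow> 'k ext set ring" where
  "ext_quot n h = exterior_algebra n Quot (Idl\<^bsub>exterior_algebra n\<^esub> {h})"

definition ext_quot_deg :: "nat \<Rightarrow> 'k::field ext \<Rightarrow> nat \<Rightarrow> 'k ext set set" where
  "ext_quot_deg n h d =
    (\<lambda>a. Idl\<^bsub>exterior_algebra n\<^esub> {h} +>\<^bsub>exterior_algebra n\<^esub> a) ` ext_deg n d"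

definition reducible_quadratic_form :: "nat \<Rightarrow> 'k::field ext \<Rightarrow> bool" where
  "reducible_quadratic_form n h \<longleftrightarrow> h \<in> ext_deg n 2 \<and>
    (\<exists>a\<in>ext_deg n 1. \<exists>b\<in>ext_deg n 1. h = a \<otimes>\<^bsub>exterior_algebra n\<^esub> b)"

end

theory Submission
  imports Defs "HOL-Library.Function_Algebras"
begin

text \<open>If \<open>h\<close> is \<open>0\<close> or a product \<open>f\<^sub>0 f\<^sub>1\<close> of linear forms, complete \<open>f\<^sub>0, f\<^sub>1\<close> to a basis \<open>f\<^sub>0, f\<^sub>1, \<dots>\<close>
  of the linear forms. In \<open>E/(h)\<close> every colon ideal \<open>(f\<^sub>0, \<dots>, f\<^bsub>s-1\<^esub>) : f\<^sub>s\<close> is again generated by an initial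
  segment of the basis, as one sees by contracting with dual functionals. The syzygies of a matrix
  with such linear quotients are linear and have linear quotients again, so the residue field
  has a linear resolution.

  Conversely, let the residue field have a linear resolution. If \<open>deg h \<ge> 3\<close> and \<open>h \<noteq> 0\<close>, the syzygy given
  by \<open>h = \<Sum> w\<^sub>b e\<^sub>b\<close> is not generated by linear ones. If \<open>deg h = 2\<close> and \<open>h\<close> is
  irreducible, the linear strand forces an element of lowest degree in the annihilator of \<open>h\<close> to be a
  combination of the \<open>e\<^sub>b\<close> with coefficients in that annihilator, which is absurd.\<close>

section \<open>The exterior algebra in coordinates\<close>

text \<open>The form 0, by contrast, counts as reducible, being the product of the linear forms 0
  and 0.

  Linear quotients persist because all colon ideals that occur come from one finite list, the
  initial segments of the flag: a new syzygy has a member of the flag as its last nonzero entry, and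
  its colon ideal is read off from that entry. Thus n colon computations control an infinite
  resolution.

  The converse looks only at F_0, ..., F_3. The differentials have linear entries, so the composite
  of two of them is quadratic, and it vanishes modulo h only if its coefficient matrix is symmetric
  up to a multiple of the alternating matrix of h. Symmetric matrices describe the linear syzygies
  of the e_b over E itself (the Cartan complex), and the multiples record what h adds to them.
  Symmetric matrices are used as they are, without symmetrising, so 2 is never inverted and all
  characteristics are treated alike.\<close>

notation ext_mult (infixl "\<cdot>" 70)

abbreviation ext_carrier :: "nat \<Rightarrow> 'k::field ext set" where
  "ext_carrier n \<equiv> carrier (exterior_algebra n)"

definition ext_scale :: "'k::field \<Rightarrow> 'k ext \<Rightarrow> 'k ext" (infixr "\<bullet>" 75) where
  "c \<bullet> x = (\<lambda>S. c * x S)"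

lemma ext_scale_apply [simp]: "(c \<bullet> x) S = c * x S"
  by (simp add: ext_scale_def)

lemma sum_fun_apply: "(\<Sum>i\<in>A. f i) x = (\<Sum>i\<in>A. f i x)" for f :: "'i \<Rightarrow> 'a \<Rightarrow> 'b::comm_monoid_add"
  by (induction A rule: infinite_finite_induct) auto

lemma ext_mult_apply: "(a \<cdot> b) U = (\<Sum>S\<in>Pow U. ext_sign S (U - S) * a S * b (U - S))"
  by (simp add: ext_mult_def)

lemma ext_mult_add_left: "(a + b) \<cdot> c = a \<cdot> c + b \<cdot> c"
  by (auto simp: fun_eq_iff ext_mult_apply algebra_simps sum.distrib)

lemma ext_mult_add_right: "c \<cdot> (a + b) = c \<cdot> a + c \<cdot> b"
  by (auto simp: fun_eq_iff ext_mult_apply algebra_simps sum.distrib)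

lemma ext_mult_zero_left [simp]: "0 \<cdot> a = 0"
  by (auto simp: fun_eq_iff ext_mult_apply)

lemma ext_mult_zero_right [simp]: "a \<cdot> 0 = 0"
  by (auto simp: fun_eq_iff ext_mult_apply)

lemma ext_mult_diff_left: "(a - b) \<cdot> c = a \<cdot> c - b \<cdot> c"
  by (auto simp: fun_eq_iff ext_mult_apply algebra_simps sum_subtractf)

lemma ext_mult_diff_right: "c \<cdot> (a - b) = c \<cdot> a - c \<cdot> b"
  by (auto simp: fun_eq_iff ext_mult_apply algebra_simps sum_subtractf)

lemma ext_mult_uminus_left: "(- a) \<cdot> c = - (a \<cdot> c)"
  by (auto simp: fun_eq_iff ext_mult_apply sum_negf)

lemma ext_mult_uminus_right: "c \<cdot> (- a) = - (c \<cdot> a)"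
  by (auto simp: fun_eq_iff ext_mult_apply sum_negf)

lemma ext_mult_scale_left: "(k \<bullet> a) \<cdot> c = k \<bullet> (a \<cdot> c)"
  by (auto simp: fun_eq_iff ext_mult_apply sum_distrib_left algebra_simps)

lemma ext_mult_scale_right: "c \<cdot> (k \<bullet> a) = k \<bullet> (c \<cdot> a)"
  by (auto simp: fun_eq_iff ext_mult_apply sum_distrib_left algebra_simps)

lemma ext_mult_sum_left: "(\<Sum>i\<in>A. f i) \<cdot> c = (\<Sum>i\<in>A. f i \<cdot> c)"
  by (auto simp: fun_eq_iff ext_mult_apply sum_fun_apply sum_distrib_left sum_distrib_right intro: sum.swap)

lemma ext_mult_sum_right: "c \<cdot> (\<Sum>i\<in>A. f i) = (\<Sum>i\<in>A. c \<cdot> f i)"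
  by (auto simp: fun_eq_iff ext_mult_apply sum_fun_apply sum_distrib_left sum_distrib_right intro: sum.swap)

lemma ext_scale_simps:
  "k \<bullet> (a + b) = k \<bullet> a + k \<bullet> b" "k \<bullet> (a - b) = k \<bullet> a - k \<bullet> b"
  "(k + l) \<bullet> a = k \<bullet> a + l \<bullet> a" "(k - l) \<bullet> a = k \<bullet> a - l \<bullet> a"
  "k \<bullet> l \<bullet> a = (k * l) \<bullet> a" "k \<bullet> (- a) = - (k \<bullet> a)" "(- k) \<bullet> a = - (k \<bullet> a)"
  by (auto simp: fun_eq_iff algebra_simps)

lemma ext_scale_0 [simp]: "0 \<bullet> a = 0" "k \<bullet> 0 = 0" and ext_scale_1 [simp]: "1 \<bullet> a = a"
  by (auto simp: fun_eq_iff)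

lemma ext_scale_sum_right: "k \<bullet> (\<Sum>i\<in>A. f i) = (\<Sum>i\<in>A. k \<bullet> f i)"
  by (auto simp: fun_eq_iff sum_fun_apply sum_distrib_left)

lemma ext_scale_sum_left: "(\<Sum>i\<in>A. f i) \<bullet> a = (\<Sum>i\<in>A. f i \<bullet> a)"
  by (auto simp: fun_eq_iff sum_fun_apply sum_distrib_right)

lemmas ext_mult_linear = ext_mult_add_left ext_mult_add_right ext_mult_diff_left ext_mult_diff_right
  ext_mult_uminus_left ext_mult_uminus_right ext_mult_scale_left ext_mult_scale_right
  ext_mult_sum_left ext_mult_sum_right

lemma exterior_algebra_simps [simp]:
  "(\<otimes>\<^bsub>exterior_algebra n\<^esub>) = ext_mult" "(\<oplus>\<^bsub>exterior_algebra n\<^esub>) = (+)"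
  "\<zero>\<^bsub>exterior_algebra n\<^esub> = 0" "\<one>\<^bsub>exterior_algebra n\<^esub> = (\<lambda>S. if S = {} then 1 else 0)"
  by (auto simp: exterior_algebra_def fun_eq_iff)

lemma ext_carrier_iff: "a \<in> ext_carrier n \<longleftrightarrow> (\<forall>S. \<not> S \<subseteq> {1..n} \<longrightarrow> a S = 0)"
  by (auto simp: exterior_algebra_def)

lemma ext_carrier_zero: "a \<in> ext_carrier n \<Longrightarrow> \<not> S \<subseteq> {1..n} \<Longrightarrow> a S = 0"
  by (auto simp: ext_carrier_iff)

lemma ext_carrier_infinite: "a \<in> ext_carrier n \<Longrightarrow> infinite S \<Longrightarrow> a S = 0"
  by (meson ext_carrier_zero finite_atLeastAtMost finite_subset)

lemma ext_carrier_closed [intro, simp]: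
  "0 \<in> ext_carrier n"
  "a \<in> ext_carrier n \<Longrightarrow> b \<in> ext_carrier n \<Longrightarrow> a + b \<in> ext_carrier n"
  "a \<in> ext_carrier n \<Longrightarrow> b \<in> ext_carrier n \<Longrightarrow> a - b \<in> ext_carrier n"
  "a \<in> ext_carrier n \<Longrightarrow> - a \<in> ext_carrier n"
  "a \<in> ext_carrier n \<Longrightarrow> k \<bullet> a \<in> ext_carrier n"
  "a \<in> ext_carrier n \<Longrightarrow> b \<in> ext_carrier n \<Longrightarrow> a \<cdot> b \<in> ext_carrier n"
  "(\<lambda>S. if S = {} then k else 0) \<in> ext_carrier n"
       apply (simp_all only: ext_mult_closed)
  by (auto simp: ext_carrier_iff)

lemma ext_carrier_sum [intro]: "(\<And>i. i \<in> A \<Longrightarrow> f i \<in> ext_carrier n) \<Longrightarrow> (\<Sum>i\<in>A. f i) \<in> ext_carrier n"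
  by (induction A rule: infinite_finite_induct) auto

lemma ext_gen_closed [simp]: "i \<in> {1..n} \<Longrightarrow> ext_gen i \<in> ext_carrier n"
  by (auto simp: ext_carrier_iff ext_gen_def)

lemma ext_minus: "a \<in> ext_carrier n \<Longrightarrow> \<ominus>\<^bsub>exterior_algebra n\<^esub> a = - a"
proof -
  interpret E: ring "exterior_algebra n" by (rule exterior_algebra_ring)
  assume "a \<in> ext_carrier n"
  then show ?thesis
    by (intro E.minus_equality) auto
qed

lemma ext_one_mult': "a \<in> ext_carrier n \<Longrightarrow> (\<lambda>S. if S = {} then k else 0) \<cdot> a = k \<bullet> a"
  "a \<in> ext_carrier n \<Longrightarrow> a \<cdot> (\<lambda>S. if S = {} then k else 0) = k \<bullet> a"
proof -
  have *: "(\<lambda>S. if S = {} then k else 0) = k \<bullet> (\<lambda>S. if S = {} then 1 else 0)"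
    by (auto simp: fun_eq_iff)
  show "a \<in> ext_carrier n \<Longrightarrow> (\<lambda>S. if S = {} then k else 0) \<cdot> a = k \<bullet> a"
    "a \<in> ext_carrier n \<Longrightarrow> a \<cdot> (\<lambda>S. if S = {} then k else 0) = k \<bullet> a"
    unfolding * by (simp_all add: ext_mult_linear ext_one_mult)
qed

text \<open>The sign in the product of e_(T-{b}) and e_b, for b in T. As b itself is not counted,
  inserting or deleting b does not change it.\<close>

definition gen_sign :: "nat set \<Rightarrow> nat \<Rightarrow> 'k::field" where
  "gen_sign T b = (- 1) ^ card {t \<in> T. b < t}"

lemma gen_sign_sq [simp]:
  fixes c :: "'k::field"
  shows "gen_sign T b * gen_sign T b = (1 :: 'k)" "gen_sign T b * (gen_sign T b * c) = c"
proof -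
  show *: "gen_sign T b * gen_sign T b = (1 :: 'k)"
    by (simp add: gen_sign_def flip: power_add mult_2)
  show "gen_sign T b * (gen_sign T b * c) = c"
    unfolding mult.assoc[symmetric] * by simp
qed

text \<open>Deleting the larger index flips the sign of the smaller one once; deleting the smaller
  index does not affect the larger one.\<close>

lemma gen_sign_anticomm:
  assumes "finite T" "a \<in> T" "b \<in> T" "a \<noteq> b"
  shows "gen_sign (T - {b}) a * gen_sign (T - {a}) b = - (gen_sign T a * gen_sign T b :: 'k::field)"
proof -
  have *: "gen_sign (T - {b}) a * gen_sign (T - {a}) b = - (gen_sign T a * gen_sign T b :: 'k::field)"
    if "a < b" "b \<in> T" for a b
  proof -
    have 1: "{t \<in> T. a < t} = insert b {t \<in> T - {b}. a < t}"
      and 2: "{t \<in> T - {a}. b < t} = {t \<in> T. b < t}" using that by auto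
    show ?thesis
      unfolding gen_sign_def 1 2 using assms(1) by (subst card_insert_disjoint) auto
  qed
  show ?thesis
  proof (cases "a < b")
    case True then show ?thesis using * assms by blast
  next
    case False then show ?thesis using *[of b a] assms by (simp add: mult.commute)
  qed
qed

lemma ext_mult_gen_apply:
  "(x \<cdot> ext_gen b) T = (if finite T \<and> b \<in> T then gen_sign T b * x (T - {b}) else 0)"
proof (cases "finite T \<and> b \<in> T")
  case True
  have sg: "ext_sign (T - {b}) {b} = (gen_sign T b :: 'a)"
  proof -
    have "{(s, t). s \<in> T - {b} \<and> t \<in> {b} \<and> t < s} = (\<lambda>s. (s, b)) ` {t \<in> T. b < t}" by auto
    then show ?thesis unfolding ext_sign_def gen_sign_def by (simp add: card_image inj_on_def)
  qed
  have "(x \<cdot> ext_gen b) T = (\<Sum>S\<in>Pow T. if S = T - {b} then gen_sign T b * x (T - {b}) else 0)"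
    unfolding ext_mult_apply
  proof (rule sum.cong[OF refl])
    fix S assume "S \<in> Pow T"
    then have "T - S = {b} \<longleftrightarrow> S = T - {b}" using True by auto
    moreover have "T - (T - {b}) = {b}" using True by auto
    ultimately show "ext_sign S (T - S) * x S * ext_gen b (T - S)
        = (if S = T - {b} then gen_sign T b * x (T - {b}) else 0)"
      by (auto simp: ext_gen_def sg)
  qed
  also have "\<dots> = gen_sign T b * x (T - {b})"
    using True by (subst sum.delta) auto
  finally show ?thesis using True by simp
next
  case False
  then show ?thesis
    by (cases "finite T") (auto simp: ext_mult_apply ext_gen_def intro!: sum.neutral)
qed

text \<open>The left factor \<open>x\<close> makes the rule applicable inside the left-nested
  products that occur throughout.\<close>

lemma ext_gen_anticomm: "x \<cdot> ext_gen a \<cdot> ext_gen b = - (x \<cdot> ext_gen b \<cdot> ext_gen a)"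
proof
  fix T show "(x \<cdot> ext_gen a \<cdot> ext_gen b) T = (- (x \<cdot> ext_gen b \<cdot> ext_gen a)) T"
  proof (cases "finite T \<and> a \<in> T \<and> b \<in> T \<and> a \<noteq> b")
    case True
    have "T - {a} - {b} = T - {b} - {a}" by auto
    moreover have "gen_sign T b * gen_sign (T - {b}) a = - (gen_sign T a * gen_sign (T - {a}) b :: 'a)"
    proof -
      have "gen_sign T b * gen_sign (T - {b}) a =
        gen_sign T b * (gen_sign (T - {b}) a * gen_sign (T - {a}) b) * (gen_sign (T - {a}) b :: 'a)"
        by (simp add: mult.assoc)
      also have "\<dots> = - (gen_sign T a * gen_sign (T - {a}) b)"
        using True by (subst gen_sign_anticomm) (auto simp: mult_ac)
      finally show ?thesis .
    qed
    ultimately show ?thesis using True by (auto simp: ext_mult_gen_apply simp flip: mult.assoc)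
  qed (auto simp: ext_mult_gen_apply)
qed

lemma ext_gen_sq [simp]: "x \<cdot> ext_gen a \<cdot> ext_gen a = 0"
  by (auto simp: fun_eq_iff ext_mult_gen_apply)

section \<open>Linear forms\<close>

definition ext_lin :: "nat \<Rightarrow> (nat \<Rightarrow> 'k::field) \<Rightarrow> 'k ext" where
  "ext_lin n \<alpha> = (\<Sum>a\<in>{1..n}. \<alpha> a \<bullet> ext_gen a)"

lemma ext_lin_single: "a \<in> {1..n} \<Longrightarrow> ext_lin n \<alpha> {a} = \<alpha> a"
proof -
  assume a: "a \<in> {1..n}"
  have "ext_lin n \<alpha> {a} = (\<Sum>b\<in>{1..n}. if b = a then \<alpha> a else 0)"
    unfolding ext_lin_def sum_fun_apply by (rule sum.cong) (auto simp: ext_gen_def)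
  then show ?thesis using a by simp
qed

lemma ext_lin_eq:
  assumes "f \<in> ext_deg n 1"
  shows "f = ext_lin n (\<lambda>a. f {a})"
proof
  fix S show "f S = ext_lin n (\<lambda>a. f {a}) S"
  proof (cases "\<exists>a\<in>{1..n}. S = {a}")
    case True then show ?thesis by (auto simp: ext_lin_single)
  next
    case False
    then have "f S = 0" using assms by (fastforce simp: ext_deg_def ext_carrier_iff card_1_singleton_iff)
    moreover have "ext_lin n (\<lambda>a. f {a}) S = 0"
      unfolding ext_lin_def sum_fun_apply using False by (intro sum.neutral) (auto simp: ext_gen_def)
    ultimately show ?thesis by simp
  qed
qed

lemma ext_gen_deg: "a \<in> {1..n} \<Longrightarrow> ext_gen a \<in> ext_deg n 1"
  by (auto simp: ext_deg_def) (auto simp: ext_gen_def split: if_splits)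

lemma ext_deg_carrier: "x \<in> ext_deg n d \<Longrightarrow> x \<in> ext_carrier n"
  by (simp add: ext_deg_def)

lemma ext_deg_closed [simp]:
  "0 \<in> ext_deg n d"
  "x \<in> ext_deg n d \<Longrightarrow> y \<in> ext_deg n d \<Longrightarrow> x + y \<in> ext_deg n d"
  "x \<in> ext_deg n d \<Longrightarrow> y \<in> ext_deg n d \<Longrightarrow> x - y \<in> ext_deg n d"
  "x \<in> ext_deg n d \<Longrightarrow> - x \<in> ext_deg n d"
  "x \<in> ext_deg n d \<Longrightarrow> k \<bullet> x \<in> ext_deg n d"
  by (auto simp: ext_deg_def)
    (metis (full_types) add.right_neutral add_0 diff_0_right diff_self)+

lemma ext_deg_sum: "(\<And>i. i \<in> A \<Longrightarrow> f i \<in> ext_deg n d) \<Longrightarrow> (\<Sum>i\<in>A. f i) \<in> ext_deg n d"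
  by (induction A rule: infinite_finite_induct) auto

lemma ext_lin_deg [simp]: "ext_lin n \<alpha> \<in> ext_deg n 1"
  unfolding ext_lin_def by (intro ext_deg_sum ext_deg_closed ext_gen_deg)

lemma ext_lin_closed [simp]: "ext_lin n \<alpha> \<in> ext_carrier n"
  using ext_lin_deg ext_deg_carrier by blast

lemma ext_mult_lin: "x \<cdot> ext_lin n \<alpha> = (\<Sum>a\<in>{1..n}. \<alpha> a \<bullet> (x \<cdot> ext_gen a))"
  by (simp add: ext_lin_def ext_mult_linear)

section \<open>Homogeneous components\<close>

definition ext_part :: "nat \<Rightarrow> 'k::field ext \<Rightarrow> 'k ext" where
  "ext_part d x = (\<lambda>S. if card S = d then x S else 0)"

lemma ext_part_apply: "ext_part d x S = (if card S = d then x S else 0)"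
  by (simp add: ext_part_def)

lemma ext_part_linear: "ext_part d (x + y) = ext_part d x + ext_part d y"
  "ext_part d (x - y) = ext_part d x - ext_part d y" "ext_part d 0 = 0"
  by (auto simp: ext_part_def fun_eq_iff)

lemma ext_part_deg: "x \<in> ext_carrier n \<Longrightarrow> ext_part d x \<in> ext_deg n d"
  by (auto simp: ext_deg_def ext_carrier_iff ext_part_def)

lemma ext_part_closed [simp]: "x \<in> ext_carrier n \<Longrightarrow> ext_part d x \<in> ext_carrier n"
  by (auto simp: ext_carrier_iff ext_part_def)

lemma ext_part_same: "x \<in> ext_deg n e \<Longrightarrow> ext_part d x = (if d = e then x else 0)"
  by (auto simp: ext_deg_def ext_part_def fun_eq_iff)

lemma ext_mult_nonzeroE:
  assumes "(a \<cdot> b) U \<noteq> 0"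
  obtains S where "finite U" "S \<subseteq> U" "a S \<noteq> 0" "b (U - S) \<noteq> 0"
proof -
  have "finite U" using assms by (cases "finite U") (auto simp: ext_mult_apply)
  moreover obtain S where "S \<in> Pow U" "ext_sign S (U - S) * a S * b (U - S) \<noteq> 0"
    using assms unfolding ext_mult_apply by (rule sum.not_neutral_contains_not_neutral)
  ultimately show ?thesis using that by auto
qed

lemma ext_deg_mult:
  assumes "x \<in> ext_deg n d" "y \<in> ext_deg n e"
  shows "x \<cdot> y \<in> ext_deg n (d + e)"
proof -
  have "card U = d + e" if nz: "(x \<cdot> y) U \<noteq> 0" for U
  proof -
    obtain S where S: "finite U" "S \<subseteq> U" "x S \<noteq> 0" "y (U - S) \<noteq> 0" by (rule ext_mult_nonzeroE[OF nz])
    then have "card S = d" "card (U - S) = e" using assms by (auto simp: ext_deg_def)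
    moreover have "card U = card S + card (U - S)"
      using S by (metis card_Diff_subset card_mono finite_subset le_add_diff_inverse)
    ultimately show ?thesis by simp
  qed
  then show ?thesis using assms by (simp add: ext_deg_def)
qed

lemma ext_part_sum:
  assumes "x \<in> ext_carrier n"
  shows "(\<Sum>d\<in>{..n}. ext_part d x) = x"
proof
  fix S show "(\<Sum>d\<in>{..n}. ext_part d x) S = x S"
  proof (cases "S \<subseteq> {1..n}")
    case True
    then have "card S \<le> n" using card_mono[of "{1..n}" S] by auto
    then show ?thesis by (simp add: sum_fun_apply ext_part_apply)
  next
    case False
    then show ?thesis using assms by (simp add: sum_fun_apply ext_part_apply ext_carrier_zero)
  qed
qed

text \<open>Multiplication by a form of degree \<open>e\<close> shifts components by
  \<open>e\<close>. Left and right versions are both present because homogeneous elements commute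
  only up to sign.\<close>

lemma ext_part_mult:
  assumes "x \<in> ext_carrier n" "y \<in> ext_deg n e"
  shows "ext_part (d + e) (x \<cdot> y) = ext_part d x \<cdot> y" "ext_part (e + d) (y \<cdot> x) = y \<cdot> ext_part d x"
    and "d < e \<Longrightarrow> ext_part d (x \<cdot> y) = 0" "d < e \<Longrightarrow> ext_part d (y \<cdot> x) = 0"
proof -
  have *: "card U = card S + card (U - S)" if "finite U" "S \<subseteq> U" for S U :: "nat set"
    using that by (metis card_Diff_subset card_mono finite_subset le_add_diff_inverse)
  have y: "card S = e" if "y S \<noteq> 0" for S using assms(2) that by (auto simp: ext_deg_def)
  have sum: "ext_part m (x \<cdot> y) = (if e \<le> m then ext_part (m - e) x \<cdot> y else 0)
      \<and> ext_part m (y \<cdot> x) = (if e \<le> m then y \<cdot> ext_part (m - e) x else 0)" for m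
  proof (intro conjI ext)
    fix U
    show "ext_part m (x \<cdot> y) U = (if e \<le> m then ext_part (m - e) x \<cdot> y else 0) U"
    proof (cases "finite U")
      case True
      then have "(if card U = m then ext_sign S (U - S) * x S * y (U - S) else 0) =
        (if e \<le> m then ext_sign S (U - S) * ext_part (m - e) x S * y (U - S) else 0)" if "S \<in> Pow U" for S
        using that y[of "U - S"] *[of U S] by (cases "y (U - S) = 0") (auto simp: ext_part_apply)
      then have "(\<Sum>S\<in>Pow U. if card U = m then ext_sign S (U - S) * x S * y (U - S) else 0) =
        (\<Sum>S\<in>Pow U. if e \<le> m then ext_sign S (U - S) * ext_part (m - e) x S * y (U - S) else 0)"
        by (intro sum.cong) auto
      then show ?thesis by (auto simp: ext_part_apply ext_mult_apply split: if_splits)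
    qed (auto simp: ext_part_apply ext_mult_apply)
    show "ext_part m (y \<cdot> x) U = (if e \<le> m then y \<cdot> ext_part (m - e) x else 0) U"
    proof (cases "finite U")
      case True
      then have "(if card U = m then ext_sign S (U - S) * y S * x (U - S) else 0) =
        (if e \<le> m then ext_sign S (U - S) * y S * ext_part (m - e) x (U - S) else 0)" if "S \<in> Pow U" for S
        using that y[of "S"] *[of U S] by (cases "y (S) = 0") (auto simp: ext_part_apply)
      then have "(\<Sum>S\<in>Pow U. if card U = m then ext_sign S (U - S) * y S * x (U - S) else 0) =
        (\<Sum>S\<in>Pow U. if e \<le> m then ext_sign S (U - S) * y S * ext_part (m - e) x (U - S) else 0)"
        by (intro sum.cong) auto
      then show ?thesis by (auto simp: ext_part_apply ext_mult_apply split: if_splits)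
    qed (auto simp: ext_part_apply ext_mult_apply)
  qed
  show "ext_part (d + e) (x \<cdot> y) = ext_part d x \<cdot> y" "ext_part (e + d) (y \<cdot> x) = y \<cdot> ext_part d x"
    using sum[of "d + e"] sum[of "e + d"] by simp_all
  show "ext_part d (x \<cdot> y) = 0" "ext_part d (y \<cdot> x) = 0" if "d < e" using sum[of d] that by simp_all
qed

text \<open>Each pair in \<open>S \<times> T\<close> is an inversion in exactly one of the two
  orders, so the two exponents add up to \<open>card S * card T\<close>.\<close>

lemma ext_sign_swap:
  assumes "finite S" "finite T" "S \<inter> T = {}"
  shows "ext_sign T S = (-1) ^ (card S * card T) * (ext_sign S T :: 'k::field)"
proof -
  define A where "A = {(s, t). s \<in> S \<and> t \<in> T \<and> t < s}"
  define B where "B = {(s, t). s \<in> T \<and> t \<in> S \<and> t < s}"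
  have B: "card B = card (prod.swap ` B)" by (simp add: card_image)
  have "S \<times> T = A \<union> prod.swap ` B"
  proof (intro equalityI subsetI)
    fix p assume "p \<in> S \<times> T"
    then obtain s t where p: "p = (s, t)" "s \<in> S" "t \<in> T" by auto
    moreover from p assms(3) have "s \<noteq> t" by auto
    ultimately show "p \<in> A \<union> prod.swap ` B"
      by (cases "s < t") (auto simp: A_def B_def image_iff)
  qed (auto simp: A_def B_def)
  moreover have "A \<inter> prod.swap ` B = {}" by (auto simp: A_def B_def)
  moreover have "finite A" "finite (prod.swap ` B)"
    using assms(1,2) by (auto simp: A_def B_def intro: finite_subset[of _ "S \<times> T"] finite_subset[of _ "T \<times> S"])
  ultimately have *: "card S * card T = card A + card B"
    unfolding B by (metis card_Un_disjoint card_cartesian_product)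
  have "(-1) ^ (card S * card T) * (ext_sign S T :: 'k) = (-1) ^ (card A + card A) * (-1) ^ card B"
    unfolding * power_add ext_sign_def A_def by (simp only: mult_ac)
  also have "\<dots> = ext_sign T S"
    by (simp add: ext_sign_def B_def flip: mult_2)
  finally show ?thesis by simp
qed

lemma quadratic_form_central:
  assumes "h \<in> ext_deg n 2"
  shows "h \<cdot> x = x \<cdot> h"
proof
  fix U show "(h \<cdot> x) U = (x \<cdot> h) U"
  proof (cases "finite U")
    case True
    have "(x \<cdot> h) U = (\<Sum>S\<in>Pow U. ext_sign (U - S) S * x (U - S) * h S)"
      unfolding ext_mult_apply
      by (rule sum.reindex_bij_witness[of _ "\<lambda>S. U - S" "\<lambda>S. U - S"]) (auto simp: double_diff mult_ac)
    also have "\<dots> = (h \<cdot> x) U"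
      unfolding ext_mult_apply
    proof (rule sum.cong[OF refl])
      fix S assume "S \<in> Pow U"
      then have "finite S" "finite (U - S)" using True finite_subset by auto
      then have "h S = 0 \<or> ext_sign (U - S) S = (ext_sign S (U - S) :: 'a)"
        using assms by (subst ext_sign_swap) (auto simp: ext_deg_def power_mult)
      then show "ext_sign (U - S) S * x (U - S) * h S = ext_sign S (U - S) * h S * x (U - S)"
        by auto
    qed
    finally show ?thesis by simp
  qed (simp add: ext_mult_apply)
qed

text \<open>Each monomial e_T is assigned to its largest index b, because splitting off that index
  on the right costs no sign.\<close>

lemma lin_combination_of_gens:
  assumes "c \<in> ext_carrier n" "c {} = 0"
  obtains v where "\<And>b. v b \<in> ext_carrier n" "c = (\<Sum>b\<in>{1..n}. v b \<cdot> ext_gen b)"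
proof -
  define v where "v b S = (if S \<subseteq> {..<b} \<and> b \<in> {1..n} then c (insert b S) else 0)" for b S
  have 1: "v b \<in> ext_carrier n" for b
    using assms(1) by (auto simp: v_def ext_carrier_iff)
  have "c = (\<Sum>b\<in>{1..n}. v b \<cdot> ext_gen b)"
  proof
    fix T show "c T = (\<Sum>b\<in>{1..n}. v b \<cdot> ext_gen b) T"
    proof (cases "T \<subseteq> {1..n} \<and> T \<noteq> {}")
      case True
      then have fT: "finite T" by (meson finite_atLeastAtMost finite_subset)
      have m: "Max T \<in> T" using True fT by simp
      have "(\<Sum>b\<in>{1..n}. v b \<cdot> ext_gen b) T = (\<Sum>b\<in>{1..n}. if b = Max T then c T else 0)"
        unfolding sum_fun_apply
      proof (rule sum.cong[OF refl])
        fix b assume b: "b \<in> {1..n}"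
        show "(v b \<cdot> ext_gen b) T = (if b = Max T then c T else 0)"
        proof (cases "b \<in> T \<and> T - {b} \<subseteq> {..<b}")
          case True
          then have "b = Max T" using fT by (intro Max_eqI[symmetric]) auto
          moreover have "{t \<in> T. b < t} = {}" using True by auto
          ultimately show ?thesis using True fT b
            by (simp add: ext_mult_gen_apply v_def gen_sign_def insert_absorb del: Collect_empty_eq)
        next
          case False
          then have "b \<noteq> Max T" using fT m by (auto simp: less_le)
          then show ?thesis using False by (auto simp: ext_mult_gen_apply v_def)
        qed
      qed
      then show ?thesis using m True by auto
    next
      case False
      then have "c T = 0" using assms(2) ext_carrier_zero[OF assms(1), of T] by blast
      moreover have "(\<Sum>b\<in>{1..n}. v b \<cdot> ext_gen b) T = 0"
      proof (cases "T = {}")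
        case True
        then show ?thesis by (simp add: sum_fun_apply ext_mult_gen_apply)
      next
        case nonempty: False
        have "(\<Sum>b\<in>{1..n}. v b \<cdot> ext_gen b) \<in> ext_carrier n"
          using 1 by (intro ext_carrier_sum ext_carrier_closed ext_gen_closed) auto
        then show ?thesis using False nonempty by (blast dest: ext_carrier_zero)
      qed
      ultimately show ?thesis by simp
    qed
  qed
  then show ?thesis using that 1 by blast
qed

text \<open>Exactness of the Cartan complex of the exterior algebra at its second place, by an
  explicit homotopy. No averaging over \<open>a\<close> and \<open>b\<close> takes place, so the
  argument is valid in characteristic 2.\<close>

lemma linear_syzygy_gens:
  assumes w: "\<And>b. w b \<in> ext_carrier n" and rel: "(\<Sum>b\<in>{1..n}. w b \<cdot> ext_gen b) = 0"
  obtains u where "\<And>a b. u a b \<in> ext_carrier n" "\<And>a b. u a b = u b a"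
    "\<And>b. b \<in> {1..n} \<Longrightarrow> w b = (\<Sum>a\<in>{1..n}. u a b \<cdot> ext_gen a)"
proof -
  \<comment> \<open>The diagonal entries account for the coefficients of \<open>w a\<close> at sets
    containing \<open>a\<close>. Off the diagonal an entry is nonzero only if \<open>a\<close> or
    \<open>b\<close> is the smallest of all indices involved, and its value is then taken from the
    \<open>w\<close> of the other index.\<close>
  define u where "u a b S = (if a \<notin> {1..n} \<or> b \<notin> {1..n} \<or> a \<in> S \<or> b \<in> S \<or> \<not> S \<subseteq> {1..n} then 0 else
     if a = b then gen_sign (insert a S) a * w a (insert a S) else
     if a = Min (insert a (insert b S)) then gen_sign (insert a S) a * w b (insert a S) else
     if b = Min (insert a (insert b S)) then gen_sign (insert b S) b * w a (insert b S) else 0)" for a b S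
  have rel': "(\<Sum>b\<in>T. gen_sign T b * w b (T - {b})) = 0" if "T \<subseteq> {1..n}" for T
  proof -
    have fT: "finite T" using that by (meson finite_atLeastAtMost finite_subset)
    have "(\<Sum>b\<in>T. gen_sign T b * w b (T - {b})) = (\<Sum>b\<in>{1..n}. w b \<cdot> ext_gen b) T"
      unfolding sum_fun_apply using fT that
      by (intro sum.mono_neutral_cong_left) (auto simp: ext_mult_gen_apply)
    then show ?thesis using rel by simp
  qed
  have 1: "u a b \<in> ext_carrier n" for a b by (auto simp: u_def ext_carrier_iff)
  have 2: "u a b = u b a" for a b
    by (rule ext) (auto simp: u_def insert_commute)
  have 3: "w b = (\<Sum>a\<in>{1..n}. u a b \<cdot> ext_gen a)" if b: "b \<in> {1..n}" for b
  proof
    fix T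
    show "w b T = (\<Sum>a\<in>{1..n}. u a b \<cdot> ext_gen a) T"
    proof (cases "T \<subseteq> {1..n}")
      case False
      moreover have "(\<Sum>a\<in>{1..n}. u a b \<cdot> ext_gen a) \<in> ext_carrier n"
        using 1 by (intro ext_carrier_sum ext_carrier_closed ext_gen_closed) auto
      ultimately show ?thesis using w by (metis ext_carrier_zero)
    next
      case True
      have fT: "finite T" using True by (meson finite_atLeastAtMost finite_subset)
      have "(\<Sum>a\<in>{1..n}. u a b \<cdot> ext_gen a) T = (\<Sum>a\<in>T. gen_sign T a * u a b (T - {a}))"
        unfolding sum_fun_apply using fT True
        by (intro sum.mono_neutral_cong_right) (auto simp: ext_mult_gen_apply)
      also have "\<dots> = w b T"
      proof (cases "b \<in> T")
        case bT: True
        have "(\<Sum>a\<in>T. gen_sign T a * u a b (T - {a})) = (\<Sum>a\<in>T. if a = b then w b T else 0)"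
          using True bT b by (intro sum.cong) (auto simp: u_def insert_absorb)
        then show ?thesis using bT fT by simp
      next
        case bT: False
        define T' where "T' = insert b T"
        have T': "T = T' - {b}" "T' \<subseteq> {1..n}" "finite T'" "b \<in> T'"
          using bT b True fT by (auto simp: T'_def)
        have ins: "insert a (insert b (T - {a})) = T'" "insert b (T - {a}) = T' - {a}"
            "insert a (T - {a}) = T" if "a \<in> T" for a using that bT by (auto simp: T'_def)
        show ?thesis
        proof (cases "b = Min T'")
          case bm: True
          \<comment> \<open>Now every \<open>a\<close> in \<open>T\<close> contributes, and the
            given relation at \<open>T'\<close>, solved for its \<open>b\<close>-term, yields
            \<open>w b T\<close>.\<close>
          have "(\<Sum>a\<in>T. gen_sign T a * u a b (T - {a})) =
             (\<Sum>a\<in>T. gen_sign T a * (gen_sign (T' - {a}) b * w a (T' - {a})))"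
          proof (rule sum.cong[OF refl])
            fix a assume a: "a \<in> T"
            then have "a \<noteq> b" "a \<in> {1..n}" using bT True by auto
            moreover have "a \<noteq> Min T'" using bm a bT by auto
            moreover have "T - {a} \<subseteq> {1..n}" using True by auto
            moreover have "insert a T' = T'" using a by (auto simp: T'_def)
            ultimately show "gen_sign T a * u a b (T - {a}) = gen_sign T a * (gen_sign (T' - {a}) b * w a (T' - {a}))"
              using a bT b by (simp add: u_def ins bm[symmetric])
          qed
          also have "\<dots> = (\<Sum>a\<in>T. - gen_sign T' b * (gen_sign T' a * w a (T' - {a})))"
          proof (rule sum.cong[OF refl])
            fix a assume a: "a \<in> T"
            have "gen_sign (T' - {b}) a * gen_sign (T' - {a}) b = - (gen_sign T' a * gen_sign T' b :: 'a)"
              using a T' bT by (intro gen_sign_anticomm) auto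
            then have "gen_sign T a * (gen_sign (T' - {a}) b * w a (T' - {a})) =
               - (gen_sign T' a * gen_sign T' b) * w a (T' - {a})"
              unfolding T'(1)[symmetric] by (metis mult.assoc)
            then show "gen_sign T a * (gen_sign (T' - {a}) b * w a (T' - {a})) =
               - gen_sign T' b * (gen_sign T' a * w a (T' - {a}))"
              by (simp add: mult_ac)
          qed
          also have "\<dots> = - gen_sign T' b * ((\<Sum>a\<in>T'. gen_sign T' a * w a (T' - {a})) - gen_sign T' b * w b (T' - {b}))"
            unfolding sum_distrib_left[symmetric] T'(1) using T'(3,4) by (subst sum_diff1) auto
          also have "\<dots> = w b T"
            using rel'[OF T'(2)] by (simp flip: T'(1) add: mult.assoc)
          finally show ?thesis .
        next
          case bm: False
          \<comment> \<open>Only the minimum of \<open>T'\<close> contributes, and its entry of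
            \<open>u\<close> was defined so as to produce \<open>w b T\<close>.\<close>
          define p where "p = Min T'"
          have "p \<in> T'" unfolding p_def using T'(3,4) by (intro Min_in) auto
          then have p: "p \<in> T" using bm by (auto simp: p_def T'_def)
          have "(\<Sum>a\<in>T. gen_sign T a * u a b (T - {a})) = (\<Sum>a\<in>T. if a = p then w b T else 0)"
          proof (rule sum.cong[OF refl])
            fix a assume a: "a \<in> T"
            then have "a \<noteq> b" "a \<in> {1..n}" using bT True by auto
            moreover have "T - {a} \<subseteq> {1..n}" using True by auto
            ultimately show "gen_sign T a * u a b (T - {a}) = (if a = p then w b T else 0)"
              using a bT b bm unfolding u_def ins(1)[OF a] ins(3)[OF a] p_def[symmetric]
              by (simp del: Diff_insert0)
          qed
          then show ?thesis using p fT by simp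
        qed
      qed
      finally show ?thesis by simp
    qed
  qed
  show ?thesis using that 1 2 3 by blast
qed

text \<open>Contraction from the right, so that no sign arises when the last factor is contracted.\<close>

definition ext_contract :: "nat \<Rightarrow> (nat \<Rightarrow> 'k::field) \<Rightarrow> 'k ext \<Rightarrow> 'k ext" where
  "ext_contract n \<phi> x = (\<lambda>S. \<Sum>i\<in>{1..n}. if i \<in> S then 0 else \<phi> i * gen_sign S i * x (insert i S))"

lemma ext_contract_closed [simp]: "x \<in> ext_carrier n \<Longrightarrow> ext_contract n \<phi> x \<in> ext_carrier n"
  unfolding ext_contract_def ext_carrier_iff
  by (intro allI impI sum.neutral ballI) (metis mult_zero_right subset_insertI subset_trans)

lemma ext_contract_add: "ext_contract n \<phi> (x + y) = ext_contract n \<phi> x + ext_contract n \<phi> y"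
  unfolding ext_contract_def fun_eq_iff plus_fun_apply sum.distrib[symmetric]
  by (intro allI sum.cong) (auto simp: distrib_left)

lemma ext_contract_scale: "ext_contract n \<phi> (k \<bullet> x) = k \<bullet> ext_contract n \<phi> x"
  unfolding ext_contract_def fun_eq_iff ext_scale_apply sum_distrib_left
  by (intro allI sum.cong) auto

lemma ext_contract_zero [simp]: "ext_contract n \<phi> 0 = 0"
  by (auto simp: ext_contract_def fun_eq_iff intro!: sum.neutral)

lemma ext_contract_sum: "ext_contract n \<phi> (\<Sum>i\<in>A. f i) = (\<Sum>i\<in>A. ext_contract n \<phi> (f i))"
  unfolding ext_contract_def fun_eq_iff sum_fun_apply
  by (subst sum.swap) (auto simp: sum_distrib_left intro!: sum.cong)

text \<open>The antiderivation rule, with the last factor contracted first.\<close>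

lemma ext_contract_mult_gen:
  assumes x: "x \<in> ext_carrier n" and b: "b \<in> {1..n}"
  shows "ext_contract n \<phi> (x \<cdot> ext_gen b) = \<phi> b \<bullet> x - ext_contract n \<phi> x \<cdot> ext_gen b"
proof
  fix S
  show "ext_contract n \<phi> (x \<cdot> ext_gen b) S = (\<phi> b \<bullet> x - ext_contract n \<phi> x \<cdot> ext_gen b) S"
  proof (cases "finite S")
    case False
    then show ?thesis using x by (auto simp: ext_contract_def ext_mult_gen_apply ext_carrier_infinite intro!: sum.neutral)
  next
    case True
    define c where "c i = (if i \<in> S then 0 else \<phi> i * gen_sign S i * (x \<cdot> ext_gen b) (insert i S))" for i
    define e where "e i = (if b \<notin> S \<or> i \<in> S - {b} then 0 else
      gen_sign S b * (\<phi> i * gen_sign (S - {b}) i * x (insert i (S - {b}))))" for i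
    have rhs: "(ext_contract n \<phi> x \<cdot> ext_gen b) S = (\<Sum>i\<in>{1..n}. e i)"
      using True by (cases "b \<in> S")
        (auto simp: ext_mult_gen_apply ext_contract_def e_def sum_distrib_left intro!: sum.cong)
    \<comment> \<open>For \<open>i = b\<close> exactly one of the two terms is present, depending on
      whether \<open>b\<close> is in \<open>S\<close>, and it gives the scalar term. For other
      \<open>i\<close> the terms cancel by anticommutation, or both are 0.\<close>
    have ce: "c i + e i = (if i = b then \<phi> b * x S else 0)" if "i \<in> {1..n}" for i
    proof (cases "i = b")
      case True
      moreover have "{t. (t = b \<or> t \<in> S) \<and> b < t} = {t \<in> S. b < t}" by auto
      moreover have "{t \<in> S. t \<noteq> b \<and> b < t} = {t \<in> S. b < t}" by auto
      ultimately show ?thesis using \<open>finite S\<close>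
      proof (cases "b \<in> S")
        case bS: True
        have "gen_sign (S - {b}) b = (gen_sign S b :: 'a)"
          unfolding gen_sign_def by (rule arg_cong[where f = "\<lambda>X. (-1) ^ card X"]) auto
        moreover have "gen_sign S b * (\<phi> b * gen_sign S b * x S) = \<phi> b * x S"
          by (simp add: mult.assoc mult.left_commute[of "gen_sign S b"])
        ultimately show ?thesis using True bS by (simp add: c_def e_def insert_absorb)
      next
        case bS: False
        have "gen_sign (insert b S) b = (gen_sign S b :: 'a)"
          unfolding gen_sign_def by (rule arg_cong[where f = "\<lambda>X. (-1) ^ card X"]) auto
        then show ?thesis using True bS \<open>finite S\<close>
          by (simp add: c_def e_def ext_mult_gen_apply mult.assoc)
      qed
    next
      case ib: False
      show ?thesis
      proof (cases "i \<notin> S \<and> b \<in> S")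
        case A: True
        define T where "T = insert i S"
        have T: "finite T" "i \<in> T" "b \<in> T" "insert i S = T" "S = T - {i}" "insert i (S - {b}) = T - {b}"
          using True A ib by (auto simp: T_def)
        have s1: "gen_sign S i = (gen_sign T i :: 'a)" "gen_sign (S - {b}) i = (gen_sign (T - {b}) i :: 'a)"
          unfolding gen_sign_def T_def by (rule arg_cong[where f = "\<lambda>X. (-1) ^ card X"]; use ib in auto)+
        have anti: "gen_sign (T - {b}) i * gen_sign S b = - (gen_sign T i * gen_sign T b :: 'a)"
          using gen_sign_anticomm[of T i b] T ib by simp
        have "gen_sign S b * (\<phi> i * gen_sign (T - {b}) i * x (T - {b})) =
           (gen_sign (T - {b}) i * gen_sign S b) * (\<phi> i * x (T - {b}))"
          by (simp only: mult_ac)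
        also have "\<dots> = - (\<phi> i * gen_sign T i * (gen_sign T b * x (T - {b})))"
          unfolding anti by (simp add: mult_ac)
        finally have "gen_sign S b * (\<phi> i * gen_sign (T - {b}) i * x (T - {b})) =
           - (\<phi> i * gen_sign T i * (gen_sign T b * x (T - {b})))" .
        then show ?thesis using A ib T(1-4,6) by (simp add: c_def e_def ext_mult_gen_apply s1 T(4,6))
      qed (use ib in \<open>auto simp: c_def e_def ext_mult_gen_apply\<close>)
    qed
    have "ext_contract n \<phi> (x \<cdot> ext_gen b) S + (ext_contract n \<phi> x \<cdot> ext_gen b) S =
      (\<Sum>i\<in>{1..n}. if i = b then \<phi> b * x S else 0)"
      unfolding rhs unfolding ext_contract_def c_def[symmetric] sum.distrib[symmetric] by (rule sum.cong[OF refl ce])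
    then show ?thesis using b by (simp add: eq_diff_eq)
  qed
qed

lemma ext_contract_mult_lin:
  assumes "x \<in> ext_carrier n"
  shows "ext_contract n \<phi> (x \<cdot> ext_lin n \<alpha>) =
    (\<Sum>i\<in>{1..n}. \<phi> i * \<alpha> i) \<bullet> x - ext_contract n \<phi> x \<cdot> ext_lin n \<alpha>"
proof -
  have "ext_contract n \<phi> (x \<cdot> ext_lin n \<alpha>) = (\<Sum>a\<in>{1..n}. \<alpha> a \<bullet> (\<phi> a \<bullet> x - ext_contract n \<phi> x \<cdot> ext_gen a))"
    unfolding ext_mult_lin ext_contract_sum using assms
    by (intro sum.cong) (auto simp: ext_contract_scale ext_contract_mult_gen)
  also have "\<dots> = (\<Sum>i\<in>{1..n}. \<phi> i * \<alpha> i) \<bullet> x - ext_contract n \<phi> x \<cdot> ext_lin n \<alpha>"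
    by (simp add: ext_mult_lin ext_scale_simps sum_subtractf ext_scale_sum_left mult.commute)
  finally show ?thesis .
qed

section \<open>The quotient by a form\<close>

lemma ext_deg_subgroup: "subgroup (ext_deg n d :: 'k::field ext set) (add_monoid (exterior_algebra n))"
proof -
  interpret E: ring "exterior_algebra n :: 'k::field ext ring" by (rule exterior_algebra_ring)
  show ?thesis
  proof (rule E.add.subgroupI)
    show "ext_deg n d \<noteq> {}" using ext_deg_closed(1) by blast
  qed (auto simp: ext_minus ext_deg_carrier)
qed

locale form_quotient =
  fixes n e :: nat and h :: "'k::field ext"
  assumes form_deg: "h \<in> ext_deg n e"
begin

abbreviation "E \<equiv> exterior_algebra n :: 'k ext ring"
abbreviation "I \<equiv> Idl\<^bsub>E\<^esub> {h}"
abbreviation "Q \<equiv> ext_quot n h"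
abbreviation "gr \<equiv> ext_quot_deg n h"

definition cls :: "'k ext \<Rightarrow> 'k ext set" where
  "cls x = I +>\<^bsub>E\<^esub> x"

lemma form_closed [simp]: "h \<in> ext_carrier n"
  using form_deg ext_deg_carrier by blast

sublocale E: ring E by (rule exterior_algebra_ring)

sublocale I: ideal I E by (rule E.genideal_ideal) simp

sublocale Q: ring Q unfolding ext_quot_def by (rule I.quotient_is_ring)

sublocale cls: ring_hom_ring E Q cls
  using I.rcos_ring_hom_ring unfolding cls_def ext_quot_def by (simp add: ring_hom_ring_def ring_hom_ring_axioms_def)

lemma gr_def: "gr d = cls ` ext_deg n d"
  by (simp add: ext_quot_deg_def cls_def)

lemma I_closed: "x \<in> I \<Longrightarrow> x \<in> ext_carrier n"
  by (rule I.Icarr)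

lemma cls_eq_iff: "x \<in> ext_carrier n \<Longrightarrow> y \<in> ext_carrier n \<Longrightarrow> cls x = cls y \<longleftrightarrow> x - y \<in> I"
  using E.quotient_eq_iff_same_a_r_cos[OF I.ideal_axioms, of x y]
  by (simp add: cls_def a_minus_def ext_minus)

lemma cls_eq_0_iff: "x \<in> ext_carrier n \<Longrightarrow> cls x = \<zero>\<^bsub>Q\<^esub> \<longleftrightarrow> x \<in> I"
  using cls_eq_iff[of x 0] cls.hom_zero by simp

lemma cls_surj: "X \<in> carrier Q \<Longrightarrow> \<exists>x\<in>ext_carrier n. X = cls x"
  by (auto simp: ext_quot_def FactRing_def A_RCOSETS_def' cls_def)

lemma cls_mult: "x \<in> ext_carrier n \<Longrightarrow> y \<in> ext_carrier n \<Longrightarrow> cls (x \<cdot> y) = cls x \<otimes>\<^bsub>Q\<^esub> cls y"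
  using cls.hom_mult[of x y] by simp

lemma cls_add: "x \<in> ext_carrier n \<Longrightarrow> y \<in> ext_carrier n \<Longrightarrow> cls (x + y) = cls x \<oplus>\<^bsub>Q\<^esub> cls y"
  using cls.hom_add[of x y] by simp

lemma cls_0: "cls 0 = \<zero>\<^bsub>Q\<^esub>"
  using cls.hom_zero by simp

lemma cls_sum: "(\<And>i. i \<in> A \<Longrightarrow> x i \<in> ext_carrier n) \<Longrightarrow> cls (\<Sum>i\<in>A. x i) = (\<Oplus>\<^bsub>Q\<^esub>i\<in>A. cls (x i))"
proof (induction A rule: infinite_finite_induct)
  case (insert i A)
  then have "(\<Sum>i\<in>insert i A. x i) = x i + (\<Sum>i\<in>A. x i)" by (intro sum.insert) auto
  then have "cls (\<Sum>i\<in>insert i A. x i) = cls (x i) \<oplus>\<^bsub>Q\<^esub> cls (\<Sum>i\<in>A. x i)"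
    using insert.prems by (simp only: cls_add ext_carrier_sum insert_iff simp_thms)
  moreover have "(\<Oplus>\<^bsub>Q\<^esub>i\<in>insert i A. cls (x i)) = cls (x i) \<oplus>\<^bsub>Q\<^esub> (\<Oplus>\<^bsub>Q\<^esub>i\<in>A. cls (x i))"
    using insert.prems insert.hyps by (intro Q.finsum_insert) auto
  ultimately show ?case using insert.IH insert.prems by (metis insertI2)
qed (simp_all only: sum.infinite sum.empty cls_0 Q.add.finprod_infinite Q.finsum_empty not_False_eq_True)

text \<open>The elements without coefficients below degree \<open>e\<close> form an ideal containing
  \<open>h\<close>. Through this fact congruences modulo \<open>I\<close> turn into identities in
  low degrees.\<close>

lemma I_low:
  assumes "x \<in> I" "card S < e"
  shows "x S = 0"
proof -
  let ?J = "{x \<in> ext_carrier n. \<forall>S. card S < e \<longrightarrow> x S = 0}"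
  have "ideal ?J E"
  proof (rule idealI[OF exterior_algebra_ring])
    show "subgroup ?J (add_monoid E)"
      by (rule E.add.subgroupI) (auto simp: ext_minus intro: exI[of _ 0])
  next
    fix a x :: "'k ext" assume a: "a \<in> ?J" and x: "x \<in> ext_carrier n"
    have "(x \<cdot> a) U = 0" "(a \<cdot> x) U = 0" if U: "card U < e" for U
    proof -
      show "(x \<cdot> a) U = 0"
      proof (rule ccontr)
        assume nz: "(x \<cdot> a) U \<noteq> 0"
        obtain S where "finite U" "S \<subseteq> U" "a (U - S) \<noteq> 0" by (rule ext_mult_nonzeroE[OF nz])
        moreover have "card (U - S) \<le> card U" using \<open>finite U\<close> by (intro card_mono) auto
        ultimately show False using a U by auto
      qed
      show "(a \<cdot> x) U = 0"
      proof (rule ccontr)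
        assume nz: "(a \<cdot> x) U \<noteq> 0"
        obtain S where "finite U" "S \<subseteq> U" "a S \<noteq> 0" by (rule ext_mult_nonzeroE[OF nz])
        moreover have "card S \<le> card U" using \<open>finite U\<close> \<open>S \<subseteq> U\<close> by (intro card_mono) auto
        ultimately show False using a U by auto
      qed
    qed
    then show "x \<otimes>\<^bsub>E\<^esub> a \<in> ?J" "a \<otimes>\<^bsub>E\<^esub> x \<in> ?J" using a x by auto
  qed
  moreover have "{h} \<subseteq> ?J" using form_deg by (auto simp: ext_deg_def)
  ultimately have "I \<subseteq> ?J" by (rule E.genideal_minimal)
  then show ?thesis using assms by auto
qed

lemma form_in_I: "h \<in> I"
  by (rule E.genideal_self') simp

end

section \<open>The grading on the quotient by a quadratic form\<close>

locale quadric_quotient = form_quotient n 2 h for n :: nat and h :: "'k::field ext"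
begin

lemma form_central: "h \<cdot> x = x \<cdot> h"
  using quadratic_form_central[OF form_deg] .

text \<open>A quadratic form is central, so its one-sided multiples already form a two-sided ideal
  and a single cofactor suffices for membership.\<close>

lemma I_eq: "I = (\<lambda>x. h \<cdot> x) ` ext_carrier n"
proof
  let ?J = "(\<lambda>x. h \<cdot> x) ` ext_carrier n"
  have "ideal ?J E"
  proof (rule idealI[OF exterior_algebra_ring])
    show "subgroup ?J (add_monoid E)"
    proof (rule E.add.subgroupI)
      fix a assume "a \<in> ?J"
      then show "\<ominus>\<^bsub>E\<^esub> a \<in> ?J" by (auto simp: ext_minus simp flip: ext_mult_uminus_right)
    next
      fix a b assume "a \<in> ?J" "b \<in> ?J"
      then show "a \<oplus>\<^bsub>E\<^esub> b \<in> ?J" by (auto simp flip: ext_mult_add_right)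
    qed auto
  next
    fix a x :: "'k ext" assume "a \<in> ?J" and x: "x \<in> ext_carrier n"
    then obtain y where y: "a = h \<cdot> y" "y \<in> ext_carrier n" by auto
    have "x \<cdot> (h \<cdot> y) = h \<cdot> (x \<cdot> y)" by (metis ext_mult_assoc form_central)
    then show "x \<otimes>\<^bsub>E\<^esub> a \<in> ?J" using x y by auto
    show "a \<otimes>\<^bsub>E\<^esub> x \<in> ?J" using x y by (auto simp: ext_mult_assoc)
  qed
  moreover have "h \<in> ?J"
    by (rule image_eqI[of _ _ "\<lambda>S. if S = {} then 1 else 0"]) (simp_all only: ext_one_mult(2)[OF form_closed] ext_carrier_closed)
  ultimately show "I \<subseteq> ?J" by (intro E.genideal_minimal) auto
  show "?J \<subseteq> I" using I.I_r_closed[OF form_in_I] by auto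
qed

lemma ext_part_I: "x \<in> I \<Longrightarrow> ext_part d x \<in> I"
proof -
  assume "x \<in> I"
  then obtain y where y: "x = h \<cdot> y" "y \<in> ext_carrier n" by (auto simp: I_eq)
  show ?thesis
  proof (cases "d < 2")
    case True
    then show ?thesis
      using ext_part_mult(4)[OF y(2) form_deg, of d] y I.zero_closed by simp
  next
    case False
    then have "d = 2 + (d - 2)" by simp
    then have "ext_part d x = h \<cdot> ext_part (d - 2) y"
      using ext_part_mult(2)[OF y(2) form_deg, of "d - 2"] y by simp
    then show ?thesis using y by (auto simp: I_eq)
  qed
qed

text \<open>The choice of the representative does not matter, since \<open>I\<close> is closed under
  taking components; \<open>hcomp_cls\<close> makes this precise.\<close>

definition hcomp :: "nat \<Rightarrow> 'k ext set \<Rightarrow> 'k ext set" where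
  "hcomp d X = cls (ext_part d (SOME x. x \<in> ext_carrier n \<and> X = cls x))"

lemma hcomp_cls:
  assumes "x \<in> ext_carrier n"
  shows "hcomp d (cls x) = cls (ext_part d x)"
proof -
  define y where "y = (SOME y. y \<in> ext_carrier n \<and> cls x = cls y)"
  have y: "y \<in> ext_carrier n \<and> cls x = cls y"
    unfolding y_def by (rule someI[of _ x]) (use assms in auto)
  then have "x - y \<in> I" using assms cls_eq_iff by blast
  then have "ext_part d x - ext_part d y \<in> I"
    unfolding ext_part_linear(2)[symmetric] by (rule ext_part_I)
  then show ?thesis
    unfolding hcomp_def y_def[symmetric] using y assms cls_eq_iff by (metis ext_part_closed)
qed

lemma gr_closed: "X \<in> gr d \<Longrightarrow> X \<in> carrier Q"
  by (auto simp: gr_def ext_deg_carrier)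

lemma hcomp_gr: "X \<in> carrier Q \<Longrightarrow> hcomp d X \<in> gr d"
  using cls_surj[of X] by (auto simp: hcomp_cls gr_def ext_part_deg)

lemma hcomp_closed [simp]: "X \<in> carrier Q \<Longrightarrow> hcomp d X \<in> carrier Q"
  using hcomp_gr gr_closed by blast

lemma hcomp_add: "X \<in> carrier Q \<Longrightarrow> Y \<in> carrier Q \<Longrightarrow> hcomp d (X \<oplus>\<^bsub>Q\<^esub> Y) = hcomp d X \<oplus>\<^bsub>Q\<^esub> hcomp d Y"
  using cls_surj[of X] cls_surj[of Y]
  by (auto simp: hcomp_cls ext_part_linear simp flip: cls_add)

lemma hcomp_0: "hcomp d \<zero>\<^bsub>Q\<^esub> = \<zero>\<^bsub>Q\<^esub>"
  unfolding cls_0[symmetric] by (simp add: hcomp_cls ext_part_linear)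

lemma hcomp_same: "X \<in> gr d' \<Longrightarrow> hcomp d X = (if d = d' then X else \<zero>\<^bsub>Q\<^esub>)"
  by (auto simp: gr_def hcomp_cls ext_deg_carrier ext_part_same cls_0)

lemma hcomp_mult: "X \<in> carrier Q \<Longrightarrow> Y \<in> gr d' \<Longrightarrow> hcomp (d + d') (X \<otimes>\<^bsub>Q\<^esub> Y) = hcomp d X \<otimes>\<^bsub>Q\<^esub> Y"
  using cls_surj[of X]
  by (auto simp: gr_def hcomp_cls ext_deg_carrier ext_part_mult simp flip: cls_mult)

lemma hcomp_finsum:
  "finite A \<Longrightarrow> f \<in> A \<rightarrow> carrier Q \<Longrightarrow> hcomp d (\<Oplus>\<^bsub>Q\<^esub>i\<in>A. f i) = (\<Oplus>\<^bsub>Q\<^esub>i\<in>A. hcomp d (f i))"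
proof (induction A rule: finite_induct)
  case (insert i A)
  then have "f i \<in> carrier Q" "f \<in> A \<rightarrow> carrier Q" by auto
  then show ?case using insert by (simp add: hcomp_add Q.finsum_insert Pi_def)
qed (simp add: hcomp_0)

lemma scalar_in_gr_0: "X \<in> gr 0 \<Longrightarrow> \<exists>k. X = cls (\<lambda>S. if S = {} then k else 0)"
proof -
  assume "X \<in> gr 0"
  then obtain x where x: "x \<in> ext_deg n 0" "X = cls x" by (auto simp: gr_def)
  have "x S = 0" if "S \<noteq> {}" for S
  proof (cases "finite S")
    case True then show ?thesis using x that by (auto simp: ext_deg_def)
  next
    case False then show ?thesis using x ext_carrier_infinite ext_deg_carrier by metis
  qed
  then have "x = (\<lambda>S. if S = {} then x {} else 0)" by auto
  then show ?thesis using x by metis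
qed

lemma scalar_gr_0: "cls (\<lambda>S. if S = {} then k else 0) \<in> gr 0"
  unfolding gr_def by (rule imageI) (auto simp: ext_deg_def)

lemma one_eq: "\<one>\<^bsub>Q\<^esub> = cls (\<lambda>S. if S = {} then 1 else 0)"
  using cls.hom_one by simp

lemma one_ne_zero: "\<one>\<^bsub>Q\<^esub> \<noteq> \<zero>\<^bsub>Q\<^esub>"
  unfolding one_eq by (subst cls_eq_0_iff) (auto dest: I_low[of _ "{}"])

lemma gr_subgroup: "subgroup (gr d) (add_monoid Q)"
  unfolding gr_def by (rule cls.img_is_add_subgroup[OF ext_deg_subgroup])

lemma gr_mult: "X \<in> gr d \<Longrightarrow> Y \<in> gr d' \<Longrightarrow> X \<otimes>\<^bsub>Q\<^esub> Y \<in> gr (d + d')"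
  by (auto simp: gr_def ext_deg_carrier intro!: ext_deg_mult simp flip: cls_mult)

lemma gr_0_central: "X \<in> gr 0 \<Longrightarrow> Y \<in> carrier Q \<Longrightarrow> X \<otimes>\<^bsub>Q\<^esub> Y = Y \<otimes>\<^bsub>Q\<^esub> X"
  using scalar_in_gr_0[of X] cls_surj[of Y] by (auto simp: ext_one_mult' simp flip: cls_mult)

lemma gr_0_field: "field (Q\<lparr>carrier := gr 0\<rparr>)"
proof -
  have "subring (gr 0) Q"
  proof (rule Q.subringI)
    show "gr 0 \<subseteq> carrier Q" by (auto intro: gr_closed)
    show "\<one>\<^bsub>Q\<^esub> \<in> gr 0" unfolding one_eq by (rule scalar_gr_0)
    show "\<And>X. X \<in> gr 0 \<Longrightarrow> \<ominus>\<^bsub>Q\<^esub> X \<in> gr 0"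
      using subgroup.m_inv_closed[OF gr_subgroup] by (simp add: a_inv_def)
    show "\<And>X Y. X \<in> gr 0 \<Longrightarrow> Y \<in> gr 0 \<Longrightarrow> X \<oplus>\<^bsub>Q\<^esub> Y \<in> gr 0"
      using subgroup.m_closed[OF gr_subgroup] by simp
    show "\<And>X Y. X \<in> gr 0 \<Longrightarrow> Y \<in> gr 0 \<Longrightarrow> X \<otimes>\<^bsub>Q\<^esub> Y \<in> gr 0"
      using gr_mult[of _ 0 _ 0] by simp
  qed
  then have "subcring (gr 0) Q"
    by (rule Q.subcringI) (simp add: gr_0_central gr_closed)
  then have "cring (Q\<lparr>carrier := gr 0\<rparr>)"
    by (subst (asm) Q.subcring_iff) (auto intro: gr_closed)
  then show ?thesis
  proof (rule cring.cring_fieldI2)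
    show "\<zero>\<^bsub>Q\<lparr>carrier := gr 0\<rparr>\<^esub> \<noteq> \<one>\<^bsub>Q\<lparr>carrier := gr 0\<rparr>\<^esub>" using one_ne_zero by simp
    fix X assume "X \<in> carrier (Q\<lparr>carrier := gr 0\<rparr>)" and nz: "X \<noteq> \<zero>\<^bsub>Q\<lparr>carrier := gr 0\<rparr>\<^esub>"
    then have "X \<in> gr 0" by simp
    then obtain k where X: "X = cls (\<lambda>S. if S = {} then k else 0)" by (blast dest: scalar_in_gr_0)
    have "k \<noteq> 0"
    proof
      assume "k = 0"
      then have "X = cls 0" unfolding X zero_fun_def by (simp cong: if_cong)
      then show False using nz cls_0 by simp
    qed
    then have "k \<bullet> (\<lambda>S. if S = {} then inverse k else 0) = (\<lambda>S::nat set. if S = {} then 1 else 0)"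
      by (auto simp: fun_eq_iff)
    then have "X \<otimes>\<^bsub>Q\<^esub> cls (\<lambda>S. if S = {} then inverse k else 0) = \<one>\<^bsub>Q\<^esub>"
      unfolding X one_eq by (subst cls_mult[symmetric]) (simp_all only: ext_one_mult' ext_carrier_closed)
    then show "\<exists>Y\<in>carrier (Q\<lparr>carrier := gr 0\<rparr>). X \<otimes>\<^bsub>Q\<lparr>carrier := gr 0\<rparr>\<^esub> Y = \<one>\<^bsub>Q\<lparr>carrier := gr 0\<rparr>\<^esub>"
      using scalar_gr_0[of "inverse k"] by (intro bexI) simp_all
  qed
qed

lemma generated_in_degree_1:
  "generate_ring Q (gr 0 \<union> cls ` ext_gen ` {1..n}) = carrier Q"
proof
  let ?G = "generate_ring Q (gr 0 \<union> cls ` ext_gen ` {1..n})"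
  show "?G \<subseteq> carrier Q"
    by (rule Q.generate_ring_incl) (auto intro: gr_closed)
  \<comment> \<open>Induction on the largest index: a new index exceeding all of \<open>U\<close> is
    appended on the right without a sign.\<close>
  have mono: "cls (\<lambda>S. if S = U then k else 0) \<in> ?G" if "finite U" "U \<subseteq> {1..n}" for U k
    using that
  proof (induction U rule: finite_linorder_max_induct)
    case empty
    then show ?case using scalar_gr_0 by (intro generate_ring.incl) auto
  next
    case (insert b U)
    let ?m = "\<lambda>S. if S = U then k else 0"
    have m: "?m \<in> ext_carrier n" using insert by (auto simp: ext_carrier_iff)
    have eq: "(\<lambda>S. if S = insert b U then k else 0) = ?m \<cdot> ext_gen b"
    proof
      fix T
      have bU: "b \<notin> U" and fU: "finite U" using insert.hyps by auto
      have "gen_sign (insert b U) b = (1 :: 'k)"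
      proof -
        have "{t \<in> insert b U. b < t} = {}" using insert.hyps(2) less_asym by blast
        then show ?thesis by (simp only: gen_sign_def card.empty power_0)
      qed
      moreover have "insert b U - {b} = U" using bU by auto
      moreover have "T - {b} \<noteq> U" if "b \<in> T" "T \<noteq> insert b U" using that by auto
      ultimately show "(if T = insert b U then k else 0) = (?m \<cdot> ext_gen b) T"
        using fU by (cases "T = insert b U") (simp_all add: ext_mult_gen_apply)
    qed
    have "cls (ext_gen b) \<in> ?G" using insert.prems by (intro generate_ring.incl) blast
    moreover have "cls ?m \<in> ?G" using insert.prems by (intro insert.IH) blast
    ultimately have "cls ?m \<otimes>\<^bsub>Q\<^esub> cls (ext_gen b) \<in> ?G" by (intro generate_ring.eng_mult)
    moreover have "ext_gen b \<in> ext_carrier n" using insert.prems by simp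
    ultimately show ?case unfolding eq by (metis cls_mult[OF m])
  qed
  show "carrier Q \<subseteq> ?G"
  proof
    fix X assume "X \<in> carrier Q"
    then obtain x where x: "x \<in> ext_carrier n" "X = cls x" using cls_surj by blast
    define mon where "mon U = (\<lambda>S. if S = U then x U else 0)" for U
    have xs: "x = (\<Sum>U\<in>Pow {1..n}. mon U)"
    proof
      fix S show "x S = (\<Sum>U\<in>Pow {1..n}. mon U) S"
        using x(1) by (auto simp: sum_fun_apply ext_carrier_iff mon_def)
    qed
    have "cls (\<Sum>U\<in>Pow {1..n}. mon U) =
      (\<Oplus>\<^bsub>Q\<^esub>U\<in>Pow {1..n}. cls (mon U))"
      by (rule cls_sum) (auto simp: ext_carrier_iff mon_def)
    then have X: "X = (\<Oplus>\<^bsub>Q\<^esub>U\<in>Pow {1..n}. cls (mon U))"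
      using x(2) by (simp only: xs[symmetric])
    have "(\<Oplus>\<^bsub>Q\<^esub>U\<in>A. cls (mon U)) \<in> ?G" if "finite A" "A \<subseteq> Pow {1..n}" for A
      using that
    proof (induction A rule: finite_induct)
      case empty
      then show ?case by (simp add: Q.zero_in_generate)
    next
      case (insert U A)
      have cl: "cls (mon V) \<in> carrier Q" if "V \<subseteq> {1..n}" for V
        using that by (intro cls.hom_closed) (auto simp: ext_carrier_iff mon_def)
      have "(\<Oplus>\<^bsub>Q\<^esub>U\<in>insert U A. cls (mon U)) =
        cls (mon U) \<oplus>\<^bsub>Q\<^esub> (\<Oplus>\<^bsub>Q\<^esub>U\<in>A. cls (mon U))"
        using insert cl by (intro Q.finsum_insert) auto
      moreover have "cls (mon U) \<in> ?G"
        using insert.prems finite_subset[of U "{1..n}"] unfolding mon_def by (intro mono) auto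
      moreover have "(\<Oplus>\<^bsub>Q\<^esub>U\<in>A. cls (mon U)) \<in> ?G"
        using insert by auto
      ultimately show ?case by (metis generate_ring.eng_add)
    qed
    then show "X \<in> ?G" unfolding X by simp
  qed
qed

lemma decomposition:
  assumes "X \<in> carrier Q"
  shows "\<exists>!c. (\<forall>d. c d \<in> gr d) \<and> finite {d. c d \<noteq> \<zero>\<^bsub>Q\<^esub>} \<and> X = (\<Oplus>\<^bsub>Q\<^esub>d\<in>{d. c d \<noteq> \<zero>\<^bsub>Q\<^esub>}. c d)"
proof (rule ex1I[of _ "\<lambda>d. hcomp d X"])
  obtain x where x: "x \<in> ext_carrier n" "X = cls x" using assms cls_surj by blast
  have "ext_part d x = 0" if "d > n" for d
  proof
    fix S
    have "card S \<le> n" if "S \<subseteq> {1..n}" using card_mono[OF _ that] by simp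
    then have "card S \<noteq> d \<or> x S = 0" using ext_carrier_zero[OF x(1), of S] \<open>d > n\<close> by fastforce
    then show "ext_part d x S = 0 S" by (simp add: ext_part_apply)
  qed
  then have "hcomp d X = \<zero>\<^bsub>Q\<^esub>" if "d > n" for d
    using that x by (simp add: hcomp_cls cls_0)
  then have sub: "{d. hcomp d X \<noteq> \<zero>\<^bsub>Q\<^esub>} \<subseteq> {..n}" 
    unfolding subset_iff mem_Collect_eq atMost_iff not_le[symmetric] by blast
  have "X = (\<Oplus>\<^bsub>Q\<^esub>d\<in>{..n}. cls (ext_part d x))"
    using x cls_sum[of "{..n}" "\<lambda>d. ext_part d x"] by (simp only: ext_part_sum ext_part_closed simp_thms)
  also have "\<dots> = (\<Oplus>\<^bsub>Q\<^esub>d\<in>{..n}. hcomp d X)"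
    using x by (simp add: hcomp_cls)
  also have "\<dots> = (\<Oplus>\<^bsub>Q\<^esub>d\<in>{d. hcomp d X \<noteq> \<zero>\<^bsub>Q\<^esub>}. hcomp d X)"
    by (rule Q.add.finprod_mono_neutral_cong_right) (use sub assms in auto)
  finally show "(\<forall>d. hcomp d X \<in> gr d) \<and> finite {d. hcomp d X \<noteq> \<zero>\<^bsub>Q\<^esub>} \<and>
      X = (\<Oplus>\<^bsub>Q\<^esub>d\<in>{d. hcomp d X \<noteq> \<zero>\<^bsub>Q\<^esub>}. hcomp d X)"
    using hcomp_gr[OF assms] finite_subset[OF sub] by blast
  fix c assume c: "(\<forall>d. c d \<in> gr d) \<and> finite {d. c d \<noteq> \<zero>\<^bsub>Q\<^esub>} \<and> X = (\<Oplus>\<^bsub>Q\<^esub>d\<in>{d. c d \<noteq> \<zero>\<^bsub>Q\<^esub>}. c d)"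
  \<comment> \<open>Uniqueness: applying the component map of degree \<open>d\<close> to the sum
    leaves only the summand \<open>c d\<close>.\<close>
  show "c = (\<lambda>d. hcomp d X)"
  proof
    fix d
    let ?A = "{d. c d \<noteq> \<zero>\<^bsub>Q\<^esub>}"
    have cc: "c d \<in> carrier Q" for d using conjunct1[OF c] gr_closed by blast
    have "hcomp d X = hcomp d (\<Oplus>\<^bsub>Q\<^esub>i\<in>?A. c i)" using c by metis
    also have "\<dots> = (\<Oplus>\<^bsub>Q\<^esub>i\<in>?A. hcomp d (c i))"
      using c cc by (intro hcomp_finsum) blast+
    also have "\<dots> = (\<Oplus>\<^bsub>Q\<^esub>i\<in>?A. if d = i then c i else \<zero>\<^bsub>Q\<^esub>)"
      using conjunct1[OF c] cc by (intro Q.finsum_cong') (auto simp: hcomp_same)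
    also have "\<dots> = c d"
    proof (cases "d \<in> ?A")
      case True
      then show ?thesis using c cc by (intro Q.finsum_singleton) blast+
    next
      case False
      then have "(\<Oplus>\<^bsub>Q\<^esub>i\<in>?A. if d = i then c i else \<zero>\<^bsub>Q\<^esub>) = \<zero>\<^bsub>Q\<^esub>"
        by (intro Q.add.finprod_one_eqI) auto
      then show ?thesis using False by simp
    qed
    finally show "c d = hcomp d X" by simp
  qed
qed

lemma standard_graded: "standard_graded Q gr"
proof (intro standard_graded.intro standard_graded_axioms.intro)
  show "\<exists>B. finite B \<and> B \<subseteq> gr 1 \<and> generate_ring Q (gr 0 \<union> B) = carrier Q"
  proof (intro exI conjI)
    show "cls ` ext_gen ` {1..n} \<subseteq> gr 1" unfolding gr_def using ext_gen_deg by blast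
    show "finite (cls ` ext_gen ` {1..n})" by simp
  qed (rule generated_in_degree_1)
qed (fact Q.ring_axioms additive_subgroupI[OF gr_subgroup] decomposition gr_mult gr_0_field gr_0_central)+

end

section \<open>Resolutions by linear quotients\<close>

context ring
begin

text \<open>Equality is required only in the columns below \<open>p\<close>, so \<open>y\<close>
  need not be extensional as the elements of \<open>free_mod\<close> are.\<close>

definition row_span :: "nat \<Rightarrow> nat \<Rightarrow> (nat \<Rightarrow> nat \<Rightarrow> 'a) \<Rightarrow> (nat \<Rightarrow> 'a) \<Rightarrow> bool" where
  "row_span q p A y \<longleftrightarrow> (\<exists>z\<in>{..<q} \<rightarrow> carrier R. \<forall>c<p. y c = (\<Oplus>l\<in>{..<q}. z l \<otimes> A l c))"

definition matrix_over :: "nat \<Rightarrow> nat \<Rightarrow> (nat \<Rightarrow> nat \<Rightarrow> 'a) \<Rightarrow> 'a set \<Rightarrow> bool" where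
  "matrix_over q p A C \<longleftrightarrow> (\<forall>l<q. \<forall>c<p. A l c \<in> C)"

lemma row_span_cong:
  assumes "\<And>l c. l < q \<Longrightarrow> c < p \<Longrightarrow> A l c = B l c" "\<And>c. c < p \<Longrightarrow> y c = y' c"
    "matrix_over q p A (carrier R)"
  shows "row_span q p A y \<longleftrightarrow> row_span q p B y'"
proof -
  have "(\<Oplus>l\<in>{..<q}. z l \<otimes> A l c) = (\<Oplus>l\<in>{..<q}. z l \<otimes> B l c)"
    if "z \<in> {..<q} \<rightarrow> carrier R" "c < p" for z c
    using that assms by (intro finsum_cong') (auto simp: Pi_iff matrix_over_def)
  then show ?thesis using assms(2) by (auto simp: row_span_def)
qed

lemma row_sum_Suc:
  assumes "z \<in> {..<Suc q} \<rightarrow> carrier R" "matrix_over (Suc q) p A (carrier R)" "c < p"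
  shows "(\<Oplus>l\<in>{..<Suc q}. z l \<otimes> A l c) = z q \<otimes> A q c \<oplus> (\<Oplus>l\<in>{..<q}. z l \<otimes> A l c)"
  unfolding lessThan_Suc using assms by (intro finsum_insert) (auto simp: Pi_iff matrix_over_def)

lemma row_sum_closed:
  assumes "z \<in> {..<q} \<rightarrow> carrier R" "matrix_over q p A (carrier R)" "c < p"
  shows "(\<Oplus>l\<in>{..<q}. z l \<otimes> A l c) \<in> carrier R"
  using assms by (intro finsum_closed) (auto simp: Pi_iff matrix_over_def)

text \<open>Spans are enlarged one row at a time, and membership in the larger span is reduced to
  the smaller one. The same rule serves for matrices and for the flag.\<close>

lemma row_span_Suc:
  assumes A: "matrix_over (Suc q) p A (carrier R)" and y: "\<And>c. c < p \<Longrightarrow> y c \<in> carrier R"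
  shows "row_span (Suc q) p A y \<longleftrightarrow> (\<exists>r\<in>carrier R. row_span q p A (\<lambda>c. y c \<ominus> r \<otimes> A q c))"
proof
  have A': "matrix_over q p A (carrier R)" "\<And>c. c < p \<Longrightarrow> A q c \<in> carrier R"
    using A by (auto simp: matrix_over_def)
  {
    assume "row_span (Suc q) p A y"
    then obtain z where z: "z \<in> {..<Suc q} \<rightarrow> carrier R" "\<And>c. c < p \<Longrightarrow> y c = (\<Oplus>l\<in>{..<Suc q}. z l \<otimes> A l c)"
      by (auto simp: row_span_def)
    have z': "z \<in> {..<q} \<rightarrow> carrier R" "z q \<in> carrier R" using z(1) by auto
    have "y c \<ominus> z q \<otimes> A q c = (\<Oplus>l\<in>{..<q}. z l \<otimes> A l c)" if "c < p" for c
      unfolding z(2)[OF that] row_sum_Suc[OF z(1) A that]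
      using row_sum_closed[OF z'(1) A'(1) that] z'(2) A'(2)[OF that]
      by (simp add: a_minus_def a_comm[of "z q \<otimes> A q c"] a_assoc r_neg)
    then show "\<exists>r\<in>carrier R. row_span q p A (\<lambda>c. y c \<ominus> r \<otimes> A q c)"
      using z' by (auto simp: row_span_def)
  }
  {
    assume "\<exists>r\<in>carrier R. row_span q p A (\<lambda>c. y c \<ominus> r \<otimes> A q c)"
    then obtain r z where r: "r \<in> carrier R" and z: "z \<in> {..<q} \<rightarrow> carrier R"
      "\<And>c. c < p \<Longrightarrow> y c \<ominus> r \<otimes> A q c = (\<Oplus>l\<in>{..<q}. z l \<otimes> A l c)"
      by (auto simp: row_span_def)
    have zr: "z(q := r) \<in> {..<Suc q} \<rightarrow> carrier R" using z(1) r by (auto simp: less_Suc_eq)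
    have "y c = (\<Oplus>l\<in>{..<Suc q}. (z(q := r)) l \<otimes> A l c)" if "c < p" for c
    proof -
      have "(\<Oplus>l\<in>{..<q}. (z(q := r)) l \<otimes> A l c) = (\<Oplus>l\<in>{..<q}. z l \<otimes> A l c)"
        using z(1) A'(1) that by (intro finsum_cong') (auto simp: Pi_iff matrix_over_def)
      then show ?thesis
        unfolding row_sum_Suc[OF zr A that] z(2)[OF that, symmetric]
        using y[OF that] r A'(2)[OF that] by (simp add: a_minus_def a_lcomm r_neg)
    qed
    then show "row_span (Suc q) p A y"
      using zr by (auto simp only: row_span_def)
  }
qed

end

text \<open>\<open>L\<close> stands for the homogeneous component of degree \<open>1\<close>, and \<open>P\<close>, \<open>Q\<close> for the projections
  to the components of degrees \<open>1\<close> and \<open>2\<close>.\<close>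

locale linear_flag = ring R for R (structure) +
  fixes L :: "'a set" and m :: nat and f :: "nat \<Rightarrow> 'a" and P Q :: "'a \<Rightarrow> 'a"
  assumes L_subgroup: "subgroup L (add_monoid R)"
    and f_L: "s < m \<Longrightarrow> f s \<in> L"
    and colon: "s < m \<Longrightarrow> \<exists>\<tau>\<le>m. \<forall>r\<in>carrier R.
       row_span s 1 (\<lambda>t c. f t) (\<lambda>c. r \<otimes> f s) \<longleftrightarrow> row_span \<tau> 1 (\<lambda>t c. f t) (\<lambda>c. r)"
    and P_L: "x \<in> carrier R \<Longrightarrow> P x \<in> L"
    and P_id: "x \<in> L \<Longrightarrow> P x = x"
    and Q_add: "x \<in> carrier R \<Longrightarrow> y \<in> carrier R \<Longrightarrow> Q (x \<oplus> y) = Q x \<oplus> Q y"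
    and Q_zero: "Q \<zero> = \<zero>"
    and Q_mult: "x \<in> carrier R \<Longrightarrow> y \<in> L \<Longrightarrow> Q (x \<otimes> y) = P x \<otimes> y"
begin

text \<open>The flag is treated as a matrix with one column. Ideals generated by initial segments
  are then row spans, and the flag is itself a matrix with linear quotients.\<close>

abbreviation flag_span :: "nat \<Rightarrow> 'a \<Rightarrow> bool" where
  "flag_span s r \<equiv> row_span s 1 (\<lambda>t c. f t) (\<lambda>c. r)"

lemma L_closed: "x \<in> L \<Longrightarrow> x \<in> carrier R"
  using subgroup.mem_carrier[OF L_subgroup] by simp

lemma L_zero: "\<zero> \<in> L"
  using subgroup.one_closed[OF L_subgroup] by simp

lemma L_minus: "x \<in> L \<Longrightarrow> \<ominus> x \<in> L"
  using subgroup.m_inv_closed[OF L_subgroup] by (simp add: a_inv_def)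

lemma matrix_over_L: "matrix_over q p A L \<Longrightarrow> matrix_over q p A (carrier R)"
  by (auto simp: matrix_over_def L_closed)

lemma flag_matrix: "s \<le> m \<Longrightarrow> matrix_over s 1 (\<lambda>t c. f t) (carrier R)"
  by (auto simp: matrix_over_def L_closed f_L)

text \<open>Modulo the earlier rows, row \<open>i\<close> generates a copy of \<open>R\<close>
  modulo the left ideal of an initial segment of the flag. The length \<open>\<tau>\<close> may vary
  with \<open>i\<close>.\<close>

definition linear_quotients :: "nat \<Rightarrow> nat \<Rightarrow> (nat \<Rightarrow> nat \<Rightarrow> 'a) \<Rightarrow> bool" where
  "linear_quotients q p A \<longleftrightarrow> matrix_over q p A L \<and>
     (\<forall>i<q. \<exists>\<tau>\<le>m. \<forall>r\<in>carrier R. row_span i p A (\<lambda>c. r \<otimes> A i c) \<longleftrightarrow> flag_span \<tau> r)"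

lemma linear_quotients_flag: "linear_quotients m 1 (\<lambda>t c. f t)"
  using colon f_L by (auto simp: linear_quotients_def matrix_over_def)

lemma linear_quotients_append:
  assumes B: "linear_quotients q p B" and w: "\<And>c. c < p \<Longrightarrow> w c \<in> L"
    and \<tau>: "\<tau> \<le> m" "\<And>r. r \<in> carrier R \<Longrightarrow> row_span q p B (\<lambda>c. r \<otimes> w c) \<longleftrightarrow> flag_span \<tau> r"
  shows "linear_quotients (Suc q) p (B(q := w))"
  unfolding linear_quotients_def
proof (intro conjI allI impI)
  have B': "matrix_over q p B L" using B by (simp add: linear_quotients_def)
  then show "matrix_over (Suc q) p (B(q := w)) L"
    using w by (auto simp: matrix_over_def less_Suc_eq)
  fix i assume i: "i < Suc q"
  have *: "row_span i p (B(q := w)) (\<lambda>c. r \<otimes> (B(q := w)) i c) \<longleftrightarrow>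
      row_span i p B (\<lambda>c. r \<otimes> (if i = q then w c else B i c))" for r
    using i B' by (intro row_span_cong) (auto simp: matrix_over_def L_closed)
  show "\<exists>\<tau>\<le>m. \<forall>r\<in>carrier R. row_span i p (B(q := w)) (\<lambda>c. r \<otimes> (B(q := w)) i c) \<longleftrightarrow> flag_span \<tau> r"
  proof (cases "i = q")
    case True
    then show ?thesis unfolding * using \<tau> by auto
  next
    case False
    then have "i < q" using i by simp
    then show ?thesis unfolding * using B False by (simp add: linear_quotients_def)
  qed
qed

section \<open>Syzygies of a matrix with linear quotients\<close>

definition syzygy :: "nat \<Rightarrow> nat \<Rightarrow> (nat \<Rightarrow> nat \<Rightarrow> 'a) \<Rightarrow> (nat \<Rightarrow> 'a) \<Rightarrow> bool" where
  "syzygy q p A y \<longleftrightarrow> (\<forall>c<p. (\<Oplus>r\<in>{..<q}. y r \<otimes> A r c) = \<zero>)"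

lemma row_sum_support:
  assumes y: "y \<in> {..<q} \<rightarrow> carrier R" and A: "matrix_over q p A (carrier R)" and c: "c < p"
    and i: "i < q" "\<And>r. i < r \<Longrightarrow> r < q \<Longrightarrow> y r = \<zero>"
  shows "(\<Oplus>r\<in>{..<q}. y r \<otimes> A r c) = y i \<otimes> A i c \<oplus> (\<Oplus>r\<in>{..<i}. y r \<otimes> A r c)"
proof -
  have "(\<Oplus>r\<in>{..<q}. y r \<otimes> A r c) = (\<Oplus>r\<in>{..<Suc i}. y r \<otimes> A r c)"
  proof (rule add.finprod_mono_neutral_cong_right)
    fix r assume "r \<in> {..<q} - {..<Suc i}"
    then show "y r \<otimes> A r c = \<zero>" using i(2)[of r] A c by (auto simp: matrix_over_def)
  qed (use i y A c in \<open>auto simp: Pi_iff matrix_over_def\<close>)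
  also have "\<dots> = y i \<otimes> A i c \<oplus> (\<Oplus>r\<in>{..<i}. y r \<otimes> A r c)"
    using y A c i(1) by (intro row_sum_Suc[of y i p A]) (auto simp: Pi_iff matrix_over_def)
  finally show ?thesis .
qed

lemma syzygy_diff_iff:
  assumes y: "y \<in> {..<q} \<rightarrow> carrier R" and w: "w \<in> {..<q} \<rightarrow> carrier R" "syzygy q p A w"
    and r: "r \<in> carrier R" and A: "matrix_over q p A (carrier R)"
  shows "syzygy q p A (\<lambda>l. y l \<ominus> r \<otimes> w l) \<longleftrightarrow> syzygy q p A y"
proof -
  have "(\<Oplus>l\<in>{..<q}. (y l \<ominus> r \<otimes> w l) \<otimes> A l c) = (\<Oplus>l\<in>{..<q}. y l \<otimes> A l c)" if c: "c < p" for c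
  proof -
    have cl: "y l \<in> carrier R" "w l \<in> carrier R" "A l c \<in> carrier R" if "l \<in> {..<q}" for l
      using that y w(1) A c by (auto simp: matrix_over_def)
    have "(\<Oplus>l\<in>{..<q}. (y l \<ominus> r \<otimes> w l) \<otimes> A l c) = (\<Oplus>l\<in>{..<q}. y l \<otimes> A l c \<oplus> (\<ominus> r) \<otimes> (w l \<otimes> A l c))"
      using cl r by (intro finsum_cong') (auto simp: a_minus_def l_distr m_assoc l_minus)
    also have "\<dots> = (\<Oplus>l\<in>{..<q}. y l \<otimes> A l c) \<oplus> (\<Oplus>l\<in>{..<q}. (\<ominus> r) \<otimes> (w l \<otimes> A l c))"
      using cl r by (intro finsum_addf) auto
    also have "(\<Oplus>l\<in>{..<q}. (\<ominus> r) \<otimes> (w l \<otimes> A l c)) = (\<ominus> r) \<otimes> (\<Oplus>l\<in>{..<q}. w l \<otimes> A l c)"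
      using cl r by (intro finsum_rdistr[symmetric]) auto
    also have "\<dots> = \<zero>" using w(2) c r by (simp add: syzygy_def)
    finally show ?thesis using row_sum_closed[OF y A c] by simp
  qed
  then show ?thesis by (simp add: syzygy_def)
qed

lemma flag_span_member:
  assumes "s < \<tau>" "\<tau> \<le> m"
  shows "flag_span \<tau> (f s)"
proof -
  let ?z = "\<lambda>t. if t = s then \<one> else \<zero>"
  have "(\<Oplus>t\<in>{..<\<tau>}. ?z t \<otimes> f t) = (\<Oplus>t\<in>{..<\<tau>}. if s = t then f t else \<zero>)"
    using assms by (intro finsum_cong') (auto simp: L_closed f_L)
  also have "\<dots> = f s"
    using assms by (intro finsum_singleton) (auto simp: L_closed f_L)
  finally show ?thesis unfolding row_span_def by (intro bexI[of _ ?z]) auto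
qed

text \<open>The left-hand side has degree 2 and the rows are linear, so the projection to degree 2
  replaces every coefficient by its linear part.\<close>

lemma linear_coefficients:
  assumes A: "matrix_over i p A L" and v: "\<And>c. c < p \<Longrightarrow> v c \<in> L" and g: "g \<in> L"
    and sp: "row_span i p A (\<lambda>c. g \<otimes> v c)"
  shows "\<exists>a\<in>{..<i} \<rightarrow> L. \<forall>c<p. g \<otimes> v c = (\<Oplus>l\<in>{..<i}. a l \<otimes> A l c)"
proof -
  obtain z where z: "z \<in> {..<i} \<rightarrow> carrier R" "\<And>c. c < p \<Longrightarrow> g \<otimes> v c = (\<Oplus>l\<in>{..<i}. z l \<otimes> A l c)"
    using sp by (auto simp: row_span_def)
  have "g \<otimes> v c = (\<Oplus>l\<in>{..<i}. P (z l) \<otimes> A l c)" if c: "c < p" for c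
  proof -
    have QS: "Q (\<Oplus>l\<in>{..<k}. z l \<otimes> A l c) = (\<Oplus>l\<in>{..<k}. P (z l) \<otimes> A l c)" if "k \<le> i" for k
      using that
    proof (induction k)
      case 0
      then show ?case by (simp add: Q_zero)
    next
      case (Suc k)
      have cl: "z l \<in> carrier R" "A l c \<in> L" if "l < Suc k" for l
        using that Suc.prems z(1) A c by (auto simp: matrix_over_def)
      have "(\<Oplus>l\<in>{..<Suc k}. z l \<otimes> A l c) = z k \<otimes> A k c \<oplus> (\<Oplus>l\<in>{..<k}. z l \<otimes> A l c)"
        "(\<Oplus>l\<in>{..<Suc k}. P (z l) \<otimes> A l c) = P (z k) \<otimes> A k c \<oplus> (\<Oplus>l\<in>{..<k}. P (z l) \<otimes> A l c)"
        unfolding lessThan_Suc using cl by (intro finsum_insert; auto simp: L_closed P_L)+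
      moreover have "(\<Oplus>l\<in>{..<k}. z l \<otimes> A l c) \<in> carrier R"
        using cl by (intro finsum_closed) (auto simp: L_closed)
      ultimately show ?case using Suc cl[of k] by (simp add: Q_add Q_mult L_closed)
    qed
    have "g \<otimes> v c = Q (g \<otimes> v c)" using g v[OF c] by (simp add: Q_mult P_id L_closed)
    also have "\<dots> = (\<Oplus>l\<in>{..<i}. P (z l) \<otimes> A l c)" unfolding z(2)[OF c] by (rule QS) simp
    finally show ?thesis .
  qed
  then show ?thesis using z(1) by (intro bexI[of _ "\<lambda>l. P (z l)"]) (auto intro!: P_L)
qed

text \<open>The syzygies of a matrix with linear quotients are filtered by the last index \<open>i\<close> of their
  support and by the smallest member of the flag that contains their \<open>i\<close>-th component. Each step
  of this filtration adds a single linear generator, and the colon ideal of that step is the colon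
  ideal of the flag.\<close>

lemma syzygies_linear_quotients_step:
  assumes A: "linear_quotients q p A" and i: "i < q"
    and \<tau>: "\<tau> \<le> m" "\<And>r. r \<in> carrier R \<Longrightarrow> row_span i p A (\<lambda>c. r \<otimes> A i c) \<longleftrightarrow> flag_span \<tau> r"
    and s: "s < \<tau>"
    and B: "linear_quotients q' q B"
      "\<And>y. y \<in> {..<q} \<rightarrow> carrier R \<Longrightarrow> row_span q' q B y \<longleftrightarrow>
         (\<forall>r. i < r \<longrightarrow> r < q \<longrightarrow> y r = \<zero>) \<and> syzygy q p A y \<and> flag_span s (y i)"
  obtains w where "linear_quotients (Suc q') q (B(q' := w))"
      "\<And>y. y \<in> {..<q} \<rightarrow> carrier R \<Longrightarrow> row_span (Suc q') q (B(q' := w)) y \<longleftrightarrow>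
         (\<forall>r. i < r \<longrightarrow> r < q \<longrightarrow> y r = \<zero>) \<and> syzygy q p A y \<and> flag_span (Suc s) (y i)"
proof -
  have AL: "matrix_over q p A L" using A by (simp add: linear_quotients_def)
  have AC: "matrix_over q p A (carrier R)" by (rule matrix_over_L[OF AL])
  have sm: "s < m" using s \<tau>(1) by simp
  have fs: "f s \<in> L" "f s \<in> carrier R" using f_L[OF sm] L_closed by auto
  \<comment> \<open>As \<open>s < \<tau>\<close>, the element \<open>f s\<close> lies in the colon
    ideal of row \<open>i\<close>.\<close>
  have "row_span i p A (\<lambda>c. f s \<otimes> A i c)"
    using \<tau>(2)[OF fs(2)] flag_span_member[OF s \<tau>(1)] by simp
  then have "\<exists>a\<in>{..<i} \<rightarrow> L. \<forall>c<p. f s \<otimes> A i c = (\<Oplus>l\<in>{..<i}. a l \<otimes> A l c)"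
    using AL i fs by (intro linear_coefficients) (auto simp: matrix_over_def)
  then obtain a where a: "a \<in> {..<i} \<rightarrow> L" "\<And>c. c < p \<Longrightarrow> f s \<otimes> A i c = (\<Oplus>l\<in>{..<i}. a l \<otimes> A l c)"
    by blast
  \<comment> \<open>The relation between \<open>f s\<close> times row \<open>i\<close> and the
    earlier rows, read as a syzygy whose last nonzero position is \<open>i\<close>.\<close>
  define w where "w r = (if r < i then \<ominus> a r else if r = i then f s else \<zero>)" for r
  have wL: "w r \<in> L" for r using a(1) fs by (auto simp: w_def L_zero intro!: L_minus)
  have wC: "w \<in> {..<q} \<rightarrow> carrier R" using wL L_closed by auto
  have wi: "w i = f s" "\<And>r. i < r \<Longrightarrow> w r = \<zero>" by (auto simp: w_def)
  have wsyz: "syzygy q p A w"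
    unfolding syzygy_def
  proof (intro allI impI)
    fix c assume c: "c < p"
    have cl: "a l \<in> carrier R" "A l c \<in> carrier R" if "l < i" for l
      using that a(1) AC c i L_closed by (auto simp: matrix_over_def)
    have "(\<Oplus>r\<in>{..<q}. w r \<otimes> A r c) = w i \<otimes> A i c \<oplus> (\<Oplus>r\<in>{..<i}. w r \<otimes> A r c)"
      by (rule row_sum_support[OF wC AC c i wi(2)])
    also have "(\<Oplus>r\<in>{..<i}. w r \<otimes> A r c) = (\<Oplus>r\<in>{..<i}. (\<ominus> \<one>) \<otimes> (a r \<otimes> A r c))"
      using cl by (intro finsum_cong') (auto simp: w_def l_minus)
    also have "\<dots> = (\<ominus> \<one>) \<otimes> (\<Oplus>r\<in>{..<i}. a r \<otimes> A r c)"
      using cl by (intro finsum_rdistr[symmetric]) auto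
    also have "(\<Oplus>r\<in>{..<i}. a r \<otimes> A r c) = f s \<otimes> A i c" using a(2)[OF c] by simp
    finally show "(\<Oplus>r\<in>{..<q}. w r \<otimes> A r c) = \<zero>"
      using fs AC c i by (simp add: wi l_minus matrix_over_def r_neg)
  qed
  obtain \<tau>' where \<tau>': "\<tau>' \<le> m" "\<And>r. r \<in> carrier R \<Longrightarrow> flag_span s (r \<otimes> f s) \<longleftrightarrow> flag_span \<tau>' r"
    using colon[OF sm] by blast
  have rw: "syzygy q p A (\<lambda>c. r \<otimes> w c)" if r: "r \<in> carrier R" for r
    unfolding syzygy_def
  proof (intro allI impI)
    fix c assume c: "c < p"
    have cl: "w l \<in> carrier R" "A l c \<in> carrier R" if "l < q" for l
      using that AC c wC by (auto simp: matrix_over_def)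
    have "(\<Oplus>l\<in>{..<q}. (r \<otimes> w l) \<otimes> A l c) = (\<Oplus>l\<in>{..<q}. r \<otimes> (w l \<otimes> A l c))"
      using cl r by (intro finsum_cong') (auto simp: m_assoc)
    also have "\<dots> = r \<otimes> (\<Oplus>l\<in>{..<q}. w l \<otimes> A l c)"
      using cl r by (intro finsum_rdistr[symmetric]) auto
    also have "\<dots> = \<zero>" using wsyz c r by (simp add: syzygy_def)
    finally show "(\<Oplus>l\<in>{..<q}. (r \<otimes> w l) \<otimes> A l c) = \<zero>" .
  qed
  \<comment> \<open>Each multiple of \<open>w\<close> is a syzygy supported up to \<open>i\<close>,
    so only its entry \<open>r \<otimes> f s\<close> at \<open>i\<close> decides whether it lies in
    the span of \<open>B\<close>. The new colon ideal is therefore that of \<open>f s\<close> over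
    its predecessors in the flag.\<close>
  have 1: "linear_quotients (Suc q') q (B(q' := w))"
  proof (rule linear_quotients_append[OF B(1) wL \<tau>'(1)])
    fix r assume r: "r \<in> carrier R"
    then have "(\<lambda>c. r \<otimes> w c) \<in> {..<q} \<rightarrow> carrier R" using wC by auto
    then show "row_span q' q B (\<lambda>c. r \<otimes> w c) \<longleftrightarrow> flag_span \<tau>' r"
      using r rw \<tau>'(2) by (simp add: B(2) wi)
  qed
  have 2: "row_span (Suc q') q (B(q' := w)) y \<longleftrightarrow>
      (\<forall>r. i < r \<longrightarrow> r < q \<longrightarrow> y r = \<zero>) \<and> syzygy q p A y \<and> flag_span (Suc s) (y i)"
    if y: "y \<in> {..<q} \<rightarrow> carrier R" for y
  proof -
    have yi: "y i \<in> carrier R" using y i by auto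
    have M: "matrix_over (Suc q') q (B(q' := w)) (carrier R)"
      using 1 matrix_over_L by (simp add: linear_quotients_def)
    have M': "matrix_over q' q B (carrier R)"
      using B(1) matrix_over_L by (simp add: linear_quotients_def)
    \<comment> \<open>Subtracting a multiple of \<open>w\<close> preserves the support condition and
      the property of being a syzygy; only the condition on entry \<open>i\<close> moves.\<close>
    have d: "row_span q' q (B(q' := w)) (\<lambda>c. y c \<ominus> r \<otimes> (B(q' := w)) q' c) \<longleftrightarrow>
        (\<forall>r. i < r \<longrightarrow> r < q \<longrightarrow> y r = \<zero>) \<and> syzygy q p A y \<and> flag_span s (y i \<ominus> r \<otimes> f s)"
      if r: "r \<in> carrier R" for r
    proof -
      have "row_span q' q (B(q' := w)) (\<lambda>c. y c \<ominus> r \<otimes> (B(q' := w)) q' c) \<longleftrightarrow>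
        row_span q' q B (\<lambda>c. y c \<ominus> r \<otimes> w c)"
        using M' by (intro row_span_cong) (auto simp: matrix_over_def)
      also have "\<dots> \<longleftrightarrow> (\<forall>l. i < l \<longrightarrow> l < q \<longrightarrow> y l \<ominus> r \<otimes> w l = \<zero>) \<and>
          syzygy q p A (\<lambda>c. y c \<ominus> r \<otimes> w c) \<and> flag_span s (y i \<ominus> r \<otimes> w i)"
        using y wC r by (intro B(2)) auto
      also have "(\<forall>l. i < l \<longrightarrow> l < q \<longrightarrow> y l \<ominus> r \<otimes> w l = \<zero>) \<longleftrightarrow> (\<forall>l. i < l \<longrightarrow> l < q \<longrightarrow> y l = \<zero>)"
        using y r by (auto simp: wi a_minus_def Pi_iff)
      finally show ?thesis unfolding syzygy_diff_iff[OF y wC wsyz r AC] wi(1) .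
    qed
    have "row_span (Suc q') q (B(q' := w)) y \<longleftrightarrow>
      (\<exists>r\<in>carrier R. row_span q' q (B(q' := w)) (\<lambda>c. y c \<ominus> r \<otimes> (B(q' := w)) q' c))"
      using y by (intro row_span_Suc[OF M]) auto
    moreover have "flag_span (Suc s) (y i) \<longleftrightarrow> (\<exists>r\<in>carrier R. flag_span s (y i \<ominus> r \<otimes> f s))"
      using sm yi by (intro row_span_Suc flag_matrix) auto
    ultimately show ?thesis using d by blast
  qed
  show ?thesis using that 1 2 by blast
qed

text \<open>Two nested inductions assemble the steps: the inner one runs through the colon ideal of
  row \<open>i\<close>, the outer one moves the bound on the support from \<open>i\<close> to
  \<open>Suc i\<close>.\<close>

lemma syzygies_linear_quotients:
  assumes A: "linear_quotients q p A"
  obtains q' B where "linear_quotients q' q B"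
    "\<And>y. y \<in> {..<q} \<rightarrow> carrier R \<Longrightarrow> row_span q' q B y \<longleftrightarrow> syzygy q p A y"
proof -
  have AL: "matrix_over q p A L" using A by (simp add: linear_quotients_def)
  have AC: "matrix_over q p A (carrier R)" by (rule matrix_over_L[OF AL])
  have "\<exists>q' B. linear_quotients q' q B \<and> (\<forall>y \<in> {..<q} \<rightarrow> carrier R.
      row_span q' q B y \<longleftrightarrow> (\<forall>r. i \<le> r \<longrightarrow> r < q \<longrightarrow> y r = \<zero>) \<and> syzygy q p A y)" if "i \<le> q" for i
    using that
  proof (induction i)
    case 0
    have "linear_quotients 0 q A" by (simp add: linear_quotients_def matrix_over_def)
    moreover have "syzygy q p A y" if "\<forall>r<q. y r = \<zero>" for y
      unfolding syzygy_def
    proof (intro allI impI add.finprod_one_eqI)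
      fix c r assume "c < p" "r \<in> {..<q}"
      then show "y r \<otimes> A r c = \<zero>" using that AC by (auto simp: matrix_over_def)
    qed
    ultimately show ?case
      by (intro exI[of _ 0] exI[of _ A]) (auto simp: row_span_def)
  next
    case (Suc i)
    then have i: "i < q" by simp
    obtain \<tau> where \<tau>: "\<tau> \<le> m" "\<And>r. r \<in> carrier R \<Longrightarrow> row_span i p A (\<lambda>c. r \<otimes> A i c) \<longleftrightarrow> flag_span \<tau> r"
      using A i unfolding linear_quotients_def by blast
    have "\<exists>q' B. linear_quotients q' q B \<and> (\<forall>y \<in> {..<q} \<rightarrow> carrier R. row_span q' q B y \<longleftrightarrow>
         (\<forall>r. i < r \<longrightarrow> r < q \<longrightarrow> y r = \<zero>) \<and> syzygy q p A y \<and> flag_span s (y i))" if "s \<le> \<tau>" for s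
      using that
    proof (induction s)
      case 0
      obtain q' B where B: "linear_quotients q' q B" "\<And>y. y \<in> {..<q} \<rightarrow> carrier R \<Longrightarrow>
          row_span q' q B y \<longleftrightarrow> (\<forall>r. i \<le> r \<longrightarrow> r < q \<longrightarrow> y r = \<zero>) \<and> syzygy q p A y"
        using Suc.IH[OF less_imp_le[OF i]] by blast
      \<comment> \<open>The empty segment forces entry \<open>i\<close> to vanish, which is the
        result of the outer induction for \<open>i\<close>.\<close>
      have "flag_span 0 r \<longleftrightarrow> r = \<zero>" for r by (auto simp: row_span_def)
      moreover have "(\<forall>r. i \<le> r \<longrightarrow> r < q \<longrightarrow> y r = \<zero>) \<longleftrightarrow> (\<forall>r. i < r \<longrightarrow> r < q \<longrightarrow> y r = \<zero>) \<and> y i = \<zero>" for y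
        using i le_eq_less_or_eq by auto
      ultimately have "row_span q' q B y \<longleftrightarrow>
         (\<forall>r. i < r \<longrightarrow> r < q \<longrightarrow> y r = \<zero>) \<and> syzygy q p A y \<and> flag_span 0 (y i)"
        if "y \<in> {..<q} \<rightarrow> carrier R" for y
        using B(2)[OF that] by (simp only:) blast
      then show ?case using B(1) by blast
    next
      case (Suc s)
      then obtain q' B where B: "linear_quotients q' q B" "\<And>y. y \<in> {..<q} \<rightarrow> carrier R \<Longrightarrow>
          row_span q' q B y \<longleftrightarrow> (\<forall>r. i < r \<longrightarrow> r < q \<longrightarrow> y r = \<zero>) \<and> syzygy q p A y \<and> flag_span s (y i)"
        using Suc_leD by blast
      obtain w where "linear_quotients (Suc q') q (B(q' := w))"
        "\<And>y. y \<in> {..<q} \<rightarrow> carrier R \<Longrightarrow> row_span (Suc q') q (B(q' := w)) y \<longleftrightarrow>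
         (\<forall>r. i < r \<longrightarrow> r < q \<longrightarrow> y r = \<zero>) \<and> syzygy q p A y \<and> flag_span (Suc s) (y i)"
        by (rule syzygies_linear_quotients_step[OF A i \<tau> _ B]) (use Suc.prems in \<open>simp_all add: Suc_le_eq\<close>)
      then show ?case by blast
    qed
    from this[OF order_refl] obtain q' B where B: "linear_quotients q' q B" "\<And>y. y \<in> {..<q} \<rightarrow> carrier R \<Longrightarrow>
       row_span q' q B y \<longleftrightarrow> (\<forall>r. i < r \<longrightarrow> r < q \<longrightarrow> y r = \<zero>) \<and> syzygy q p A y \<and> flag_span \<tau> (y i)"
      by blast
    \<comment> \<open>At \<open>\<tau>\<close> the inner condition holds automatically: for a syzygy
      with last position \<open>i\<close>, the product of \<open>y i\<close> with row
      \<open>i\<close> is minus a combination of the earlier rows, so \<open>y i\<close> lies in the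
      colon ideal of that row.\<close>
    have "flag_span \<tau> (y i)" if y: "y \<in> {..<q} \<rightarrow> carrier R" and sup: "\<And>r. i < r \<Longrightarrow> r < q \<Longrightarrow> y r = \<zero>"
      and syz: "syzygy q p A y" for y
    proof -
      have yC: "y l \<in> carrier R" if "l \<le> i" for l using y i that by auto
      have "y i \<otimes> A i c = (\<Oplus>l\<in>{..<i}. (\<ominus> y l) \<otimes> A l c)" if c: "c < p" for c
      proof -
        have cl: "A l c \<in> carrier R" if "l \<le> i" for l
          using that AC c i by (auto simp: matrix_over_def)
        have sc: "(\<Oplus>r\<in>{..<i}. y r \<otimes> A r c) \<in> carrier R"
          using cl yC by (intro finsum_closed) auto
        have "y i \<otimes> A i c \<oplus> (\<Oplus>r\<in>{..<i}. y r \<otimes> A r c) = \<zero>"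
          using row_sum_support[OF y AC c i sup] syz c by (simp add: syzygy_def)
        then have "y i \<otimes> A i c = \<ominus> (\<Oplus>r\<in>{..<i}. y r \<otimes> A r c)"
          using sc yC cl minus_equality[of "y i \<otimes> A i c" "\<Oplus>r\<in>{..<i}. y r \<otimes> A r c"] by simp
        also have "\<dots> = (\<ominus> \<one>) \<otimes> (\<Oplus>r\<in>{..<i}. y r \<otimes> A r c)" using sc by (simp add: l_minus)
        also have "\<dots> = (\<Oplus>r\<in>{..<i}. (\<ominus> \<one>) \<otimes> (y r \<otimes> A r c))"
          using cl yC by (intro finsum_rdistr) auto
        also have "\<dots> = (\<Oplus>l\<in>{..<i}. (\<ominus> y l) \<otimes> A l c)"
          using cl yC by (intro finsum_cong') (auto simp: l_minus)
        finally show ?thesis .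
      qed
      then have "row_span i p A (\<lambda>c. y i \<otimes> A i c)"
        unfolding row_span_def using yC by (intro bexI[of _ "\<lambda>l. \<ominus> y l"]) auto
      then show ?thesis using \<tau>(2) yC by simp
    qed
    then have "row_span q' q B y \<longleftrightarrow> (\<forall>r. Suc i \<le> r \<longrightarrow> r < q \<longrightarrow> y r = \<zero>) \<and> syzygy q p A y"
      if "y \<in> {..<q} \<rightarrow> carrier R" for y
      unfolding B(2)[OF that] Suc_le_eq using that by blast
    then show ?case using B(1) by blast
  qed
  from this[OF order_refl] obtain q' B where "linear_quotients q' q B"
    and B: "\<And>y. y \<in> {..<q} \<rightarrow> carrier R \<Longrightarrow>
      row_span q' q B y \<longleftrightarrow> (\<forall>r. q \<le> r \<longrightarrow> r < q \<longrightarrow> y r = \<zero>) \<and> syzygy q p A y"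
    by blast
  moreover have "(\<forall>r. q \<le> r \<longrightarrow> r < q \<longrightarrow> y r = \<zero>) \<longleftrightarrow> True" for y :: "nat \<Rightarrow> 'a" by auto
  ultimately show ?thesis using that by simp
qed

text \<open>Syzygies are taken repeatedly, starting from the flag as the presentation of the
  irrelevant ideal. All matrices stay linear, so the basis of F_i sits in degree
  \<open>i\<close>.\<close>

lemma linear_resolution_exists:
  assumes L: "L = gr 1" and irr: "\<And>x. x \<in> carrier R \<Longrightarrow> x \<in> irrelevant_ideal R gr \<longleftrightarrow> flag_span m x"
  shows "has_linear_resolution R gr"
proof -
  define ok where "ok x \<longleftrightarrow> linear_quotients (fst x) (fst (snd x)) (snd (snd x))" for x
  define step where "step x y \<longleftrightarrow> fst (snd y) = fst x \<and> (\<forall>v \<in> {..<fst x} \<rightarrow> carrier R.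
    row_span (fst y) (fst x) (snd (snd y)) v \<longleftrightarrow> syzygy (fst x) (fst (snd x)) (snd (snd x)) v)" for x y
  have "\<exists>g. g 0 = (m, 1, \<lambda>t c. f t) \<and> (\<forall>i::nat. ok (g i) \<and> step (g i) (g (Suc i)))"
  proof -
    \<comment> \<open>The choice principle prescribes only properties of the states
      \<open>(q, p, A)\<close>; the implication for \<open>i = 0\<close> pins down the initial
      one.\<close>
    have "\<exists>g. \<forall>i::nat. (ok (g i) \<and> (i = 0 \<longrightarrow> g i = (m, 1, \<lambda>t c. f t))) \<and> step (g i) (g (Suc i))"
    proof (rule dependent_nat_choice)
      show "\<exists>x. ok x \<and> (0 = (0::nat) \<longrightarrow> x = (m, 1, \<lambda>t c. f t))"
        using linear_quotients_flag by (auto simp: ok_def)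
      fix x i assume "ok x \<and> (i = (0::nat) \<longrightarrow> x = (m, 1, \<lambda>t c. f t))"
      then obtain q p A where x: "x = (q, p, A)" "linear_quotients q p A"
        by (metis ok_def prod.collapse)
      obtain q' B where "linear_quotients q' q B"
        "\<And>y. y \<in> {..<q} \<rightarrow> carrier R \<Longrightarrow> row_span q' q B y \<longleftrightarrow> syzygy q p A y"
        by (rule syzygies_linear_quotients[OF x(2)]) blast
      then show "\<exists>y. (ok y \<and> (Suc i = 0 \<longrightarrow> y = (m, 1, \<lambda>t c. f t))) \<and> step x y"
        by (intro exI[of _ "(q', q, B)"]) (auto simp: ok_def step_def x)
    qed
    then show ?thesis by blast
  qed
  then obtain g where g: "g 0 = (m, 1, \<lambda>t c. f t)" "\<And>i::nat. ok (g i)" "\<And>i. step (g i) (g (Suc i))"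
    by blast
  define b where "b i = fst (snd (g i))" for i
  define A where "A i = snd (snd (g i))" for i
  have b0: "b 0 = 1" and A0: "A 0 = (\<lambda>t c. f t)" using g(1) by (auto simp: b_def A_def)
  have bS: "fst (g i) = b (Suc i)" for i
    using g(3)[of i] by (simp add: step_def b_def)
  have b1: "b 1 = m" using bS[of 0] g(1) by simp
  have lq: "linear_quotients (b (Suc i)) (b i) (A i)" for i
    using g(2)[of i] unfolding bS[symmetric] by (simp add: ok_def b_def A_def)
  then have AL: "matrix_over (b (Suc i)) (b i) (A i) L" for i by (simp add: linear_quotients_def)
  then have AC: "matrix_over (b (Suc i)) (b i) (A i) (carrier R)" for i by (rule matrix_over_L)
  have ex: "row_span (b (Suc (Suc i))) (b (Suc i)) (A (Suc i)) y \<longleftrightarrow> syzygy (b (Suc i)) (b i) (A i) y"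
    if "y \<in> {..<b (Suc i)} \<rightarrow> carrier R" for i y
    using g(3)[of i] that unfolding bS[symmetric] by (simp add: step_def b_def A_def)
  define s where "s i = replicate (b i) i" for i :: nat
  define D where "D i = row_map R (b (Suc i)) (b i) (A i)" for i
  have Dim: "x \<in> D i ` free_mod R (b (Suc i)) \<longleftrightarrow> row_span (b (Suc i)) (b i) (A i) x"
    if x: "x \<in> free_mod R (b i)" for i x
  proof
    assume "x \<in> D i ` free_mod R (b (Suc i))"
    then obtain z where "z \<in> free_mod R (b (Suc i))" "x = D i z" by blast
    then show "row_span (b (Suc i)) (b i) (A i) x"
      unfolding row_span_def
      by (intro bexI[of _ z]) (auto simp: D_def row_map_def free_mod_def PiE_def)
  next
    assume "row_span (b (Suc i)) (b i) (A i) x"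
    then obtain z where z: "z \<in> {..<b (Suc i)} \<rightarrow> carrier R"
      "\<And>c. c < b i \<Longrightarrow> x c = (\<Oplus>l\<in>{..<b (Suc i)}. z l \<otimes> A i l c)"
      by (auto simp: row_span_def)
    \<comment> \<open>Elements of \<open>free_mod\<close> are extensional, so the coefficient vector
      has to be cut off.\<close>
    let ?z = "restrict z {..<b (Suc i)}"
    have zf: "?z \<in> free_mod R (b (Suc i))" using z(1) by (auto simp: free_mod_def)
    have "x = D i ?z"
    proof
      fix c show "x c = D i ?z c"
      proof (cases "c < b i")
        case True
        have "(\<Oplus>l\<in>{..<b (Suc i)}. z l \<otimes> A i l c) = (\<Oplus>l\<in>{..<b (Suc i)}. ?z l \<otimes> A i l c)"
          using z(1) AC[of i] True by (intro finsum_cong') (auto simp: Pi_iff matrix_over_def)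
        then show ?thesis using z(2)[OF True] True by (simp add: D_def row_map_def)
      next
        case False
        then show ?thesis using x by (auto simp: D_def row_map_def free_mod_def PiE_def extensional_def)
      qed
    qed
    then show "x \<in> D i ` free_mod R (b (Suc i))" using zf by blast
  qed
  have Dcl: "D i z \<in> free_mod R (b i)" if z: "z \<in> free_mod R (b (Suc i))" for i z
    unfolding free_mod_def
  proof (rule PiE_I)
    fix c assume "c \<in> {..<b i}"
    then show "D i z c \<in> carrier R"
      using z AC[of i] row_sum_closed[of z "b (Suc i)" "b i" "A i" c]
      by (auto simp: D_def row_map_def free_mod_def PiE_def)
  qed (auto simp: D_def row_map_def)
  have "graded_free_resolution R gr s A"
    unfolding graded_free_resolution_def Let_def
  proof (intro conjI allI impI)
    show "s 0 = [0]" by (simp add: s_def b0)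
  next
    fix i r c assume "r < length (s (Suc i))" "c < length (s i)"
    then show "if s i ! c \<le> s (Suc i) ! r then A i r c \<in> gr (s (Suc i) ! r - s i ! c) else A i r c = \<zero>"
      using AL[of i] L by (auto simp: s_def matrix_over_def)
  next
    have "x \<in> D 0 ` free_mod R (b 1) \<longleftrightarrow> x \<in> free_mod R (b 0) \<and> x 0 \<in> irrelevant_ideal R gr" for x
    proof -
      have "row_span (b 1) (b 0) (A 0) x \<longleftrightarrow> x 0 \<in> irrelevant_ideal R gr" if x: "x \<in> free_mod R (b 0)"
      proof -
        have "x 0 \<in> carrier R" using x by (auto simp: free_mod_def b0)
        moreover have "row_span (b 1) (b 0) (A 0) x \<longleftrightarrow> flag_span m (x 0)"
          unfolding A0 b0 b1 by (rule row_span_cong[OF refl _ flag_matrix[OF order_refl]]) simp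
        ultimately show ?thesis using irr by simp
      qed
      then show ?thesis using Dim[of x 0] Dcl[of _ 0] by auto
    qed
    then show "row_map R (length (s (Suc 0))) (length (s 0)) (A 0) ` free_mod R (length (s 1)) =
      {x \<in> free_mod R (length (s 0)). x 0 \<in> irrelevant_ideal R gr}"
      by (auto simp: s_def D_def)
  next
    fix i
    have "x \<in> D (Suc i) ` free_mod R (b (Suc (Suc i))) \<longleftrightarrow>
       x \<in> free_mod R (b (Suc i)) \<and> (\<forall>c<b i. D i x c = \<zero>)" for x
    proof -
      have "row_span (b (Suc (Suc i))) (b (Suc i)) (A (Suc i)) x \<longleftrightarrow> (\<forall>c<b i. D i x c = \<zero>)"
        if x: "x \<in> free_mod R (b (Suc i))"
        using ex[of x i] x by (auto simp: syzygy_def D_def row_map_def free_mod_def PiE_def)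
      then show ?thesis using Dim[of x "Suc i"] Dcl[of _ "Suc i"] by auto
    qed
    then show "row_map R (length (s (Suc (Suc i)))) (length (s (Suc i))) (A (Suc i)) `
        free_mod R (length (s (Suc (Suc i)))) =
       {x \<in> free_mod R (length (s (Suc i))). \<forall>c<length (s i).
          row_map R (length (s (Suc i))) (length (s i)) (A i) x c = \<zero>}"
      by (auto simp: s_def D_def)
  qed
  then show ?thesis unfolding has_linear_resolution_def
    by (intro exI[of _ s] exI[of _ A]) (auto simp: s_def)
qed

end

section \<open>Reducible quadratic forms\<close>

lemma sum_closed_property:
  fixes g :: "'i \<Rightarrow> 'a::comm_monoid_add"
  assumes "T 0" "\<And>x y. T x \<Longrightarrow> T y \<Longrightarrow> T (x + y)" "\<And>i. i \<in> A \<Longrightarrow> T (g i)"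
  shows "T (\<Sum>i\<in>A. g i)"
  using assms(3) by (induction A rule: infinite_finite_induct) (auto simp: assms(1,2))

lemma double_sum_triangle:
  fixes T :: "nat \<Rightarrow> nat \<Rightarrow> 'a::comm_monoid_add"
  shows "(\<Sum>a\<in>{1..n}. \<Sum>b\<in>{1..n}. T a b) =
    (\<Sum>a\<in>{1..n}. T a a) + (\<Sum>b\<in>{1..n}. \<Sum>a\<in>{1..<b}. T a b + T b a)"
proof (induction n)
  case (Suc n)
  have "{1..Suc n} = insert (Suc n) {1..n}" "{1..<Suc n} = {1..n}" by auto
  then show ?case using Suc by (simp add: sum.distrib add_ac)
qed simp

text \<open>The vanishing diagonal is a separate assumption because antisymmetry does not imply it
  in characteristic 2.\<close>

lemma double_sum_antisym:
  fixes T :: "nat \<Rightarrow> nat \<Rightarrow> 'a::ab_group_add"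
  assumes "\<And>a b. T a b = - T b a" "\<And>a. T a a = 0"
  shows "(\<Sum>a\<in>{1..n}. \<Sum>b\<in>{1..n}. T a b) = 0"
proof -
  have "T a b + T b a = 0" for a b using assms(1)[of a b] by simp
  then show ?thesis unfolding double_sum_triangle using assms(2) by simp
qed

lemma ext_mult_lin_lin:
  "x \<cdot> ext_lin n \<alpha> \<cdot> ext_lin n \<beta> =
    (\<Sum>a\<in>{1..n}. \<Sum>b\<in>{1..n}. (\<alpha> a * \<beta> b) \<bullet> (x \<cdot> ext_gen a \<cdot> ext_gen b))"
proof -
  have "x \<cdot> ext_lin n \<alpha> \<cdot> ext_lin n \<beta> =
    (\<Sum>b\<in>{1..n}. \<Sum>a\<in>{1..n}. (\<alpha> a * \<beta> b) \<bullet> (x \<cdot> ext_gen a \<cdot> ext_gen b))"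
    by (simp only: ext_mult_lin ext_mult_sum_left ext_mult_scale_left ext_scale_sum_right ext_scale_simps(5) mult.commute)
  also have "\<dots> = (\<Sum>a\<in>{1..n}. \<Sum>b\<in>{1..n}. (\<alpha> a * \<beta> b) \<bullet> (x \<cdot> ext_gen a \<cdot> ext_gen b))"
    by (rule sum.swap)
  finally show ?thesis .
qed

lemma linear_form_anticomm:
  assumes "f \<in> ext_deg n 1" "g \<in> ext_deg n 1"
  shows "x \<cdot> f \<cdot> g = - (x \<cdot> g \<cdot> f)"
proof -
  have "x \<cdot> ext_lin n \<alpha> \<cdot> ext_lin n \<beta> = - (x \<cdot> ext_lin n \<beta> \<cdot> ext_lin n \<alpha>)" for \<alpha> \<beta>
  proof -
    have "x \<cdot> ext_lin n \<beta> \<cdot> ext_lin n \<alpha> =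
        (\<Sum>a\<in>{1..n}. \<Sum>b\<in>{1..n}. (\<beta> b * \<alpha> a) \<bullet> (x \<cdot> ext_gen b \<cdot> ext_gen a))"
      unfolding ext_mult_lin_lin by (rule sum.swap)
    also have "\<dots> = (\<Sum>a\<in>{1..n}. \<Sum>b\<in>{1..n}. - ((\<alpha> a * \<beta> b) \<bullet> (x \<cdot> ext_gen a \<cdot> ext_gen b)))"
      by (intro sum.cong refl) (subst ext_gen_anticomm, simp only: ext_scale_simps mult.commute)
    also have "\<dots> = - (x \<cdot> ext_lin n \<alpha> \<cdot> ext_lin n \<beta>)"
      unfolding ext_mult_lin_lin by (simp only: sum_negf)
    finally show ?thesis by simp
  qed
  then show ?thesis using ext_lin_eq[OF assms(1)] ext_lin_eq[OF assms(2)] by metis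
qed

lemma linear_form_sq:
  assumes "f \<in> ext_deg n 1"
  shows "x \<cdot> f \<cdot> f = 0"
proof -
  define \<alpha> where "\<alpha> a = f {a}" for a
  have "x \<cdot> ext_lin n \<alpha> \<cdot> ext_lin n \<alpha> = 0"
    unfolding ext_mult_lin_lin
  proof (rule double_sum_antisym)
    fix a b
    show "(\<alpha> a * \<alpha> b) \<bullet> (x \<cdot> ext_gen a \<cdot> ext_gen b) = - ((\<alpha> b * \<alpha> a) \<bullet> (x \<cdot> ext_gen b \<cdot> ext_gen a))"
      by (subst ext_gen_anticomm) (simp only: ext_scale_simps mult.commute)
  qed simp
  then show ?thesis using ext_lin_eq[OF assms] by (simp only: \<alpha>_def[abs_def])
qed

lemma ext_contract_mult_linear_form:
  assumes "x \<in> ext_carrier n" "f \<in> ext_deg n 1"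
  shows "ext_contract n \<phi> (x \<cdot> f) = (\<Sum>i\<in>{1..n}. \<phi> i * f {i}) \<bullet> x - ext_contract n \<phi> x \<cdot> f"
  using ext_contract_mult_lin[OF assms(1), of \<phi> "\<lambda>i. f {i}"] ext_lin_eq[OF assms(2)] by metis

text \<open>The functionals \<open>\<phi> s\<close> are dual to the flag only in the triangular
  sense, which is what contraction modulo earlier members requires. The last assumption expresses
  that the \<open>f t\<close> generate all linear forms.\<close>

locale adapted_flag = quadric_quotient n h for n :: nat and h :: "'k::field ext" +
  fixes f :: "nat \<Rightarrow> 'k ext" and \<phi> :: "nat \<Rightarrow> nat \<Rightarrow> 'k"
  assumes f_deg: "t < n \<Longrightarrow> f t \<in> ext_deg n 1"
    and form_cases: "h = 0 \<or> 2 \<le> n \<and> h = f 0 \<cdot> f 1"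
    and dual_same: "s < n \<Longrightarrow> (\<Sum>i\<in>{1..n}. \<phi> s i * f s {i}) = 1"
    and dual_less: "t < s \<Longrightarrow> s < n \<Longrightarrow> (\<Sum>i\<in>{1..n}. \<phi> s i * f t {i}) = 0"
    and f_span: "x \<in> ext_carrier n \<Longrightarrow> b \<in> {1..n} \<Longrightarrow>
      \<exists>k. (\<forall>t. k t \<in> ext_carrier n) \<and> x \<cdot> ext_gen b = (\<Sum>t\<in>{..<n}. k t \<cdot> f t)"
begin

lemma f_closed: "t < n \<Longrightarrow> f t \<in> ext_carrier n"
  using f_deg ext_deg_carrier by blast

text \<open>The preimage in the exterior algebra of \<open>flag_span\<close> over the quotient.
  Working upstairs is essential, since contraction need not preserve \<open>I\<close>.\<close>

definition Sp :: "nat \<Rightarrow> 'k ext \<Rightarrow> bool" where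
  "Sp s r \<longleftrightarrow> (\<exists>y. (\<forall>t. y t \<in> ext_carrier n) \<and> r - (\<Sum>t\<in>{..<s}. y t \<cdot> f t) \<in> I)"

lemma I_add: "x \<in> I \<Longrightarrow> y \<in> I \<Longrightarrow> x + y \<in> I"
  using I.a_closed[of x y] by simp

lemma I_minus: "x \<in> I \<Longrightarrow> - x \<in> I"
  using I.a_inv_closed[of x] I_closed by (simp add: ext_minus)

lemma Sp_add:
  assumes "Sp s x" "Sp s y"
  shows "Sp s (x + y)"
proof -
  obtain u v where "\<forall>t. u t \<in> ext_carrier n" "\<forall>t. v t \<in> ext_carrier n"
    and 1: "x - (\<Sum>t\<in>{..<s}. u t \<cdot> f t) \<in> I" "y - (\<Sum>t\<in>{..<s}. v t \<cdot> f t) \<in> I"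
    using assms unfolding Sp_def by blast
  moreover have "x + y - (\<Sum>t\<in>{..<s}. (u t + v t) \<cdot> f t) =
      (x - (\<Sum>t\<in>{..<s}. u t \<cdot> f t)) + (y - (\<Sum>t\<in>{..<s}. v t \<cdot> f t))"
    by (simp only: ext_mult_add_left sum.distrib add_diff_add)
  ultimately show ?thesis
    unfolding Sp_def by (intro exI[of _ "\<lambda>t. u t + v t"]) (simp only: I_add ext_carrier_closed simp_thms)
qed

lemma Sp_minus:
  assumes "Sp s x"
  shows "Sp s (- x)"
proof -
  obtain u where "\<forall>t. u t \<in> ext_carrier n" and 1: "x - (\<Sum>t\<in>{..<s}. u t \<cdot> f t) \<in> I"
    using assms unfolding Sp_def by blast
  moreover have "- x - (\<Sum>t\<in>{..<s}. (- u t) \<cdot> f t) = - (x - (\<Sum>t\<in>{..<s}. u t \<cdot> f t))"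
    by (simp only: ext_mult_uminus_left sum_negf) simp
  ultimately show ?thesis
    unfolding Sp_def by (intro exI[of _ "\<lambda>t. - u t"]) (simp only: I_minus ext_carrier_closed simp_thms)
qed

lemma Sp_diff: "Sp s x \<Longrightarrow> Sp s y \<Longrightarrow> Sp s (x - y)"
  using Sp_add[of s x "- y"] Sp_minus by simp

lemma Sp_I: "x \<in> I \<Longrightarrow> Sp s x"
  unfolding Sp_def by (intro exI[of _ "\<lambda>t. 0"]) simp

lemma Sp_0: "Sp s 0"
  using I.zero_closed by (intro Sp_I) simp

lemma Sp_sum: "(\<And>i. i \<in> A \<Longrightarrow> Sp s (g i)) \<Longrightarrow> Sp s (\<Sum>i\<in>A. g i)"
  using sum_closed_property[of "Sp s" A g] Sp_0 Sp_add by blast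

lemma Sp_f: "x \<in> ext_carrier n \<Longrightarrow> t < s \<Longrightarrow> Sp s (x \<cdot> f t)"
proof -
  assume x: "x \<in> ext_carrier n" "t < s"
  have "(\<Sum>t'\<in>{..<s}. (if t' = t then x else 0) \<cdot> f t') = (\<Sum>t'\<in>{..<s}. if t' = t then x \<cdot> f t' else 0)"
    by (intro sum.cong) auto
  also have "\<dots> = x \<cdot> f t" using x by (subst sum.delta) auto
  finally show ?thesis
    unfolding Sp_def using x I.zero_closed by (intro exI[of _ "\<lambda>t'. if t' = t then x else 0"]) auto
qed

lemma Sp_cases:
  assumes "Sp s x"
  obtains y i where "\<And>t. y t \<in> ext_carrier n" "i \<in> I" "x = (\<Sum>t\<in>{..<s}. y t \<cdot> f t) + i"
proof -
  obtain y where y: "\<And>t. y t \<in> ext_carrier n" "x - (\<Sum>t\<in>{..<s}. y t \<cdot> f t) \<in> I"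
    using assms unfolding Sp_def by blast
  then show ?thesis using that[of y "x - (\<Sum>t\<in>{..<s}. y t \<cdot> f t)"] by simp
qed

lemma row_span_iff_Sp:
  assumes r: "r \<in> ext_carrier n" and s: "s \<le> n"
  shows "Q.row_span s 1 (\<lambda>t c. cls (f t)) (\<lambda>c. cls r) \<longleftrightarrow> Sp s r"
proof
  assume "Q.row_span s 1 (\<lambda>t c. cls (f t)) (\<lambda>c. cls r)"
  then obtain z where z: "z \<in> {..<s} \<rightarrow> carrier Q" "cls r = (\<Oplus>\<^bsub>Q\<^esub>t\<in>{..<s}. z t \<otimes>\<^bsub>Q\<^esub> cls (f t))"
    by (auto simp: Q.row_span_def)
  then have "\<forall>t\<in>{..<s}. \<exists>y\<in>ext_carrier n. z t = cls y" using cls_surj by blast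
  then obtain y where y: "\<And>t. t < s \<Longrightarrow> y t \<in> ext_carrier n" "\<And>t. t < s \<Longrightarrow> z t = cls (y t)"
    by (metis lessThan_iff)
  have c: "y t \<cdot> f t \<in> ext_carrier n" if "t \<in> {..<s}" for t using that y(1) f_closed s by simp
  have "(\<Oplus>\<^bsub>Q\<^esub>t\<in>{..<s}. z t \<otimes>\<^bsub>Q\<^esub> cls (f t)) = (\<Oplus>\<^bsub>Q\<^esub>t\<in>{..<s}. cls (y t \<cdot> f t))"
    using y f_closed s c by (intro Q.finsum_cong') (auto simp: cls_mult)
  also have "\<dots> = cls (\<Sum>t\<in>{..<s}. y t \<cdot> f t)" by (rule cls_sum[symmetric, OF c])
  finally have "r - (\<Sum>t\<in>{..<s}. y t \<cdot> f t) \<in> I"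
    using z(2) r c by (simp only: cls_eq_iff[symmetric] ext_carrier_sum)
  moreover have "(\<Sum>t\<in>{..<s}. (if t < s then y t else 0) \<cdot> f t) = (\<Sum>t\<in>{..<s}. y t \<cdot> f t)"
    by (intro sum.cong) auto
  ultimately show "Sp s r"
    unfolding Sp_def using y(1) by (intro exI[of _ "\<lambda>t. if t < s then y t else 0"]) auto
next
  assume "Sp s r"
  then obtain y where y: "\<And>t. y t \<in> ext_carrier n" "r - (\<Sum>t\<in>{..<s}. y t \<cdot> f t) \<in> I"
    unfolding Sp_def by blast
  have c: "y t \<cdot> f t \<in> ext_carrier n" if "t \<in> {..<s}" for t using that y(1) f_closed s by simp
  have "cls r = cls (\<Sum>t\<in>{..<s}. y t \<cdot> f t)"
    using y(2) r c by (simp only: cls_eq_iff ext_carrier_sum)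
  also have "\<dots> = (\<Oplus>\<^bsub>Q\<^esub>t\<in>{..<s}. cls (y t \<cdot> f t))" by (rule cls_sum[OF c])
  also have "\<dots> = (\<Oplus>\<^bsub>Q\<^esub>t\<in>{..<s}. cls (y t) \<otimes>\<^bsub>Q\<^esub> cls (f t))"
    using y f_closed s c by (intro Q.finsum_cong') (auto simp: cls_mult)
  finally show "Q.row_span s 1 (\<lambda>t c. cls (f t)) (\<lambda>c. cls r)"
    unfolding Q.row_span_def using y(1) by (intro bexI[of _ "\<lambda>t. cls (y t)"]) auto
qed

lemma contract_f:
  assumes "x \<in> ext_carrier n" "t \<le> s" "s < n"
  shows "ext_contract n (\<phi> s) (x \<cdot> f t) = (if t = s then x else 0) - ext_contract n (\<phi> s) x \<cdot> f t"
  using assms ext_contract_mult_linear_form[OF assms(1) f_deg, of t "\<phi> s"] dual_same dual_less by auto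

text \<open>Contraction with a functional that vanishes on \<open>f t\<close> for \<open>t < s\<close> and takes the value \<open>1\<close> on
  \<open>f s\<close> recovers \<open>r\<close> from \<open>r \<cdot> f s\<close>, up to a multiple of \<open>f s\<close>.\<close>

lemma colon_Sp_forward:
  assumes s: "s < n" and r: "r \<in> ext_carrier n" and sp: "Sp s (r \<cdot> f s)"
  shows "Sp (if h \<noteq> 0 \<and> s = 0 then 2 else Suc s) r"
proof -
  \<comment> \<open>If \<open>h\<close> is nonzero, \<open>f 0\<close> is killed modulo
    \<open>h\<close> by \<open>f 1\<close> as well as by itself, so the colon ideal for
    \<open>s = 0\<close> has two generators. For \<open>s > 0\<close> the form adds nothing beyond
    \<open>f 0, ..., f s\<close>.\<close>
  let ?\<iota> = "ext_contract n (\<phi> s)" and ?\<tau> = "if h \<noteq> 0 \<and> s = 0 then 2 else Suc s"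
  obtain y i where y: "\<And>t. y t \<in> ext_carrier n" "i \<in> I" "r \<cdot> f s = (\<Sum>t\<in>{..<s}. y t \<cdot> f t) + i"
    by (rule Sp_cases[OF sp]) blast
  obtain w where w: "i = h \<cdot> w" "w \<in> ext_carrier n" using y(2) by (auto simp: I_eq)
  have "?\<iota> (r \<cdot> f s) = r - ?\<iota> r \<cdot> f s" using contract_f[OF r _ s, of s] by simp
  moreover have "?\<iota> (\<Sum>t\<in>{..<s}. y t \<cdot> f t) = (\<Sum>t\<in>{..<s}. - (?\<iota> (y t) \<cdot> f t))"
    unfolding ext_contract_sum using contract_f y(1) s by (intro sum.cong) auto
  moreover have "?\<iota> (r \<cdot> f s) = ?\<iota> (\<Sum>t\<in>{..<s}. y t \<cdot> f t) + ?\<iota> i"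
    unfolding y(3) by (rule ext_contract_add)
  ultimately have eq: "r = ?\<iota> r \<cdot> f s + (\<Sum>t\<in>{..<s}. - (?\<iota> (y t) \<cdot> f t)) + ?\<iota> i"
    by (metis add.assoc add.commute diff_eq_eq)
  have "Sp ?\<tau> (?\<iota> r \<cdot> f s)" using r by (intro Sp_f) auto
  moreover have "Sp ?\<tau> (\<Sum>t\<in>{..<s}. - (?\<iota> (y t) \<cdot> f t))"
    using y(1) by (intro Sp_sum Sp_minus Sp_f) auto
  moreover have "Sp ?\<tau> (?\<iota> i)"
  proof (cases "h = 0")
    case True
    then show ?thesis using w(1) Sp_0 by simp
  next
    case False
    then have n: "2 \<le> n" and h: "h = f 0 \<cdot> f 1" using form_cases by auto
    have i: "i = w \<cdot> f 0 \<cdot> f 1"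
      using w form_central[of w] by (simp add: h ext_mult_assoc)
    have wf: "w \<cdot> f 0 \<in> ext_carrier n" using w(2) f_closed n by simp
    have hI: "?\<iota> w \<cdot> f 0 \<cdot> f 1 \<in> I"
    proof -
      have "?\<iota> w \<cdot> f 0 \<cdot> f 1 = h \<cdot> ?\<iota> w" unfolding form_central by (simp add: h ext_mult_assoc)
      then show ?thesis using w(2) by (auto simp: I_eq)
    qed
    let ?c1 = "\<Sum>i\<in>{1..n}. \<phi> s i * f 1 {i}" and ?c0 = "\<Sum>i\<in>{1..n}. \<phi> s i * f 0 {i}"
    have "?\<iota> i = ?c1 \<bullet> (w \<cdot> f 0) - ?\<iota> (w \<cdot> f 0) \<cdot> f 1"
      unfolding i using wf f_deg n by (intro ext_contract_mult_linear_form) auto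
    also have "?\<iota> (w \<cdot> f 0) = ?c0 \<bullet> w - ?\<iota> w \<cdot> f 0"
      using w(2) f_deg n by (intro ext_contract_mult_linear_form) auto
    \<comment> \<open>Contracting a multiple of \<open>h\<close> leaves multiples of
      \<open>f 0\<close> and \<open>f 1\<close>, and again a multiple of \<open>h\<close>.\<close>
    finally have \<iota>: "?\<iota> i = (?c1 \<bullet> w) \<cdot> f 0 - (?c0 \<bullet> w) \<cdot> f 1 + ?\<iota> w \<cdot> f 0 \<cdot> f 1"
      by (simp only: ext_mult_diff_left ext_mult_scale_left diff_diff_eq2 diff_add_eq)
    show ?thesis
    \<comment> \<open>For \<open>s < 2\<close> the target segment contains both \<open>f 0\<close>
      and \<open>f 1\<close>; for larger \<open>s\<close> the functional vanishes on both.\<close>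
    proof (cases "s < 2")
      case True
      have s1: "Sp ?\<tau> ((?c1 \<bullet> w) \<cdot> f 0)" using w(2) by (intro Sp_f) auto
      have s2: "Sp ?\<tau> ((?c0 \<bullet> w) \<cdot> f 1)" using w(2) True False by (intro Sp_f) auto
      show ?thesis unfolding \<iota> by (intro Sp_add Sp_diff s1 s2 Sp_I hI)
    next
      case False
      then have "?c0 = 0" "?c1 = 0" using dual_less s by auto
      then show ?thesis unfolding \<iota> using Sp_I[OF hI] by simp
    qed
  qed
  ultimately show ?thesis by (subst eq) (intro Sp_add)
qed

text \<open>Earlier members are moved to the right by anticommutation, \<open>f s\<close> has square
  zero, and the exceptional product of \<open>f 1\<close> with \<open>f 0\<close> is minus
  \<open>h\<close>.\<close>

lemma colon_Sp_backward:
  assumes s: "s < n" and r: "r \<in> ext_carrier n" and sp: "Sp (if h \<noteq> 0 \<and> s = 0 then 2 else Suc s) r"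
  shows "Sp s (r \<cdot> f s)"
proof -
  let ?\<tau> = "if h \<noteq> 0 \<and> s = 0 then 2 else Suc s"
  have tn: "t < n" if "t < ?\<tau>" for t using that form_cases s by (auto split: if_splits)
  obtain y i where y: "\<And>t. y t \<in> ext_carrier n" "i \<in> I" "r = (\<Sum>t\<in>{..<?\<tau>}. y t \<cdot> f t) + i"
    by (rule Sp_cases[OF sp]) blast
  have "i \<cdot> f s \<in> I" using I.I_r_closed[OF y(2) f_closed[OF s]] by simp
  then have "Sp s (i \<cdot> f s)" by (rule Sp_I)
  moreover have "Sp s (\<Sum>t\<in>{..<?\<tau>}. y t \<cdot> f t \<cdot> f s)"
  proof (rule Sp_sum)
    fix t assume t: "t \<in> {..<?\<tau>}"
    then have tn: "t < n" using tn by blast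
    have ac: "y t \<cdot> f t \<cdot> f s = (- (y t \<cdot> f s)) \<cdot> f t"
      using linear_form_anticomm[OF f_deg[OF tn] f_deg[OF s]] by (simp add: ext_mult_uminus_left)
    consider "t < s" | "t = s" | "s = 0" "t = 1" "h \<noteq> 0"
      using t by (cases "h \<noteq> 0 \<and> s = 0") (auto simp: less_2_cases_iff less_Suc_eq)
    then show "Sp s (y t \<cdot> f t \<cdot> f s)"
    proof cases
      case 1
      then show ?thesis unfolding ac using y(1) f_closed[OF s] by (intro Sp_f) auto
    next
      case 2
      then show ?thesis using linear_form_sq[OF f_deg[OF s]] Sp_0 by simp
    next
      case 3
      then have "h = f 0 \<cdot> f 1" using form_cases by auto
      then have "y t \<cdot> f t \<cdot> f s = - (h \<cdot> y t)"
        unfolding ac form_central using 3 by (simp add: ext_mult_assoc ext_mult_uminus_left)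
      moreover have "h \<cdot> y t \<in> I" using y(1) by (auto simp: I_eq)
      ultimately show ?thesis using I_minus Sp_I by simp
    qed
  qed
  ultimately have "Sp s ((\<Sum>t\<in>{..<?\<tau>}. y t \<cdot> f t \<cdot> f s) + i \<cdot> f s)" by (intro Sp_add)
  then show ?thesis unfolding y(3) ext_mult_add_left ext_mult_sum_left .
qed

sublocale flag: linear_flag Q "gr 1" n "\<lambda>t. cls (f t)" "hcomp 1" "hcomp 2"
proof (intro linear_flag.intro linear_flag_axioms.intro)
  show "ring Q" by (rule Q.ring_axioms)
  show "subgroup (gr 1) (add_monoid Q)" by (rule gr_subgroup)
  show "\<And>s. s < n \<Longrightarrow> cls (f s) \<in> gr 1" using f_deg by (auto simp: gr_def)
  show "\<And>x. x \<in> carrier Q \<Longrightarrow> hcomp 1 x \<in> gr 1" by (rule hcomp_gr)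
  show "\<And>x. x \<in> gr 1 \<Longrightarrow> hcomp 1 x = x" by (simp add: hcomp_same)
  show "\<And>x y. x \<in> carrier Q \<Longrightarrow> y \<in> carrier Q \<Longrightarrow> hcomp 2 (x \<oplus>\<^bsub>Q\<^esub> y) = hcomp 2 x \<oplus>\<^bsub>Q\<^esub> hcomp 2 y"
    by (rule hcomp_add)
  show "hcomp 2 \<zero>\<^bsub>Q\<^esub> = \<zero>\<^bsub>Q\<^esub>" by (rule hcomp_0)
  show "\<And>x y. x \<in> carrier Q \<Longrightarrow> y \<in> gr 1 \<Longrightarrow> hcomp 2 (x \<otimes>\<^bsub>Q\<^esub> y) = hcomp 1 x \<otimes>\<^bsub>Q\<^esub> y"
    using hcomp_mult[of _ _ 1 1] by (simp add: numeral_2_eq_2)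
next
  fix s assume s: "s < n"
  let ?\<tau> = "if h \<noteq> 0 \<and> s = 0 then 2 else Suc s"
  have \<tau>n: "?\<tau> \<le> n" using s form_cases by auto
  have "Q.row_span s 1 (\<lambda>t c. cls (f t)) (\<lambda>c. X \<otimes>\<^bsub>Q\<^esub> cls (f s)) \<longleftrightarrow>
      Q.row_span ?\<tau> 1 (\<lambda>t c. cls (f t)) (\<lambda>c. X)" if "X \<in> carrier Q" for X
  proof -
    obtain r where r: "r \<in> ext_carrier n" "X = cls r" using cls_surj \<open>X \<in> carrier Q\<close> by blast
    have "X \<otimes>\<^bsub>Q\<^esub> cls (f s) = cls (r \<cdot> f s)" using r f_closed[OF s] by (simp add: cls_mult)
    then show ?thesis
      using row_span_iff_Sp[of "r \<cdot> f s" s] row_span_iff_Sp[OF r(1) \<tau>n] r f_closed[OF s] s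
        colon_Sp_forward[OF s r(1)] colon_Sp_backward[OF s r(1)] by (simp only: ext_carrier_closed less_imp_le) blast
  qed
  then show "\<exists>\<tau>\<le>n. \<forall>r\<in>carrier Q. Q.row_span s 1 (\<lambda>t c. cls (f t)) (\<lambda>c. r \<otimes>\<^bsub>Q\<^esub> cls (f s)) \<longleftrightarrow>
      Q.row_span \<tau> 1 (\<lambda>t c. cls (f t)) (\<lambda>c. r)"
    using \<tau>n by blast
qed

text \<open>Classes in the irrelevant ideal have representatives without constant term; these are
  combinations of the generators, hence of the flag.\<close>

lemma irrelevant_ideal_iff_Sp:
  assumes x: "x \<in> ext_carrier n"
  shows "cls x \<in> irrelevant_ideal Q gr \<longleftrightarrow> Sp n x"
proof
  have gens: "(\<Union>d\<in>{1..}. gr d) \<subseteq> carrier Q" using gr_closed by blast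
  interpret J: ideal "irrelevant_ideal Q gr" Q
    unfolding irrelevant_ideal_def by (rule Q.genideal_ideal[OF gens])
  {
    assume "Sp n x"
    then obtain y i where y: "\<And>t. y t \<in> ext_carrier n" "i \<in> I" "x = (\<Sum>t\<in>{..<n}. y t \<cdot> f t) + i"
      by (rule Sp_cases) blast
    have c: "y t \<cdot> f t \<in> ext_carrier n" if "t \<in> {..<n}" for t using that y(1) f_closed by simp
    have "cls x = cls (\<Sum>t\<in>{..<n}. y t \<cdot> f t)"
      using y(2,3) x c by (subst cls_eq_iff) (auto intro!: ext_carrier_sum)
    also have "\<dots> = (\<Oplus>\<^bsub>Q\<^esub>t\<in>{..<n}. cls (y t \<cdot> f t))" by (rule cls_sum[OF c])
    also have "\<dots> \<in> irrelevant_ideal Q gr"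
    proof -
      have "cls (y t \<cdot> f t) \<in> irrelevant_ideal Q gr" if "t < n" for t
      proof -
        have "cls (f t) \<in> (\<Union>d\<in>{1..}. gr d)" using f_deg[OF that] by (auto simp: gr_def)
        then have "cls (f t) \<in> irrelevant_ideal Q gr"
          using Q.genideal_self[OF gens] unfolding irrelevant_ideal_def by blast
        then show ?thesis using J.I_l_closed[of "cls (f t)" "cls (y t)"] y(1) f_closed[OF that] by (simp add: cls_mult)
      qed
      then have "(\<Oplus>\<^bsub>Q\<^esub>t\<in>{..<k}. cls (y t \<cdot> f t)) \<in> irrelevant_ideal Q gr" if "k \<le> n" for k
        using that
      proof (induction k)
        case 0
        then show ?case by (simp add: J.zero_closed)
      next
        case (Suc k)
        then have "(\<Oplus>\<^bsub>Q\<^esub>t\<in>{..<Suc k}. cls (y t \<cdot> f t)) =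
            cls (y k \<cdot> f k) \<oplus>\<^bsub>Q\<^esub> (\<Oplus>\<^bsub>Q\<^esub>t\<in>{..<k}. cls (y t \<cdot> f t))"
          unfolding lessThan_Suc using J.Icarr by (intro Q.finsum_insert) auto
        then show ?case using Suc by (simp add: J.a_closed)
      qed
      then show ?thesis by blast
    qed
    finally show "cls x \<in> irrelevant_ideal Q gr" .
  }
  {
    \<comment> \<open>The classes with such a representative form an ideal containing every
      component of positive degree.\<close>
    let ?J = "cls ` {x \<in> ext_carrier n. x {} = 0}"
    have "ideal ?J Q"
    proof (rule idealI[OF Q.ring_axioms])
      have "subgroup {x \<in> ext_carrier n. x {} = 0} (add_monoid E)"
        by (rule E.add.subgroupI) (auto simp: ext_minus intro: exI[of _ 0])
      then show "subgroup ?J (add_monoid Q)" by (rule cls.img_is_add_subgroup)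
    next
      fix a X assume "a \<in> ?J" and X: "X \<in> carrier Q"
      then obtain z u where z: "a = cls z" "z \<in> ext_carrier n" "z {} = 0" "X = cls u" "u \<in> ext_carrier n"
        using cls_surj[OF X] by blast
      have "(z \<cdot> u) {} = 0" "(u \<cdot> z) {} = 0" using z(3) by (simp_all add: ext_mult_apply)
      then show "X \<otimes>\<^bsub>Q\<^esub> a \<in> ?J" "a \<otimes>\<^bsub>Q\<^esub> X \<in> ?J" using z by (auto simp flip: cls_mult)
    qed
    moreover have "(\<Union>d\<in>{1..}. gr d) \<subseteq> ?J" by (auto simp: gr_def ext_deg_def)
    ultimately have sub: "irrelevant_ideal Q gr \<subseteq> ?J"
      unfolding irrelevant_ideal_def by (rule Q.genideal_minimal)
    assume "cls x \<in> irrelevant_ideal Q gr"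
    then obtain z where z: "cls x = cls z" "z \<in> ext_carrier n" "z {} = 0" using sub by blast
    obtain v where v: "\<And>b. v b \<in> ext_carrier n" "z = (\<Sum>b\<in>{1..n}. v b \<cdot> ext_gen b)"
      by (rule lin_combination_of_gens[OF z(2,3)]) blast
    have "Sp n (v b \<cdot> ext_gen b)" if b: "b \<in> {1..n}" for b
    proof -
      obtain k where k: "\<forall>t. k t \<in> ext_carrier n" "v b \<cdot> ext_gen b = (\<Sum>t\<in>{..<n}. k t \<cdot> f t)"
        using f_span[OF v(1) b] by blast
      show ?thesis unfolding k(2) using k(1) by (intro Sp_sum Sp_f) auto
    qed
    then have "Sp n z" unfolding v(2) by (rule Sp_sum)
    moreover have "x - z \<in> I" using z x cls_eq_iff by blast
    ultimately have "Sp n (z + (x - z))" by (rule Sp_add[OF _ Sp_I])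
    moreover have "z + (x - z) = x" by simp
    ultimately show "Sp n x" by metis
  }
qed

lemma koszul_quotient: "koszul Q gr"
  unfolding koszul_def
proof
  show "has_linear_resolution Q gr"
  proof (rule flag.linear_resolution_exists[of gr, OF refl])
    fix X assume "X \<in> carrier Q"
    then obtain x where "x \<in> ext_carrier n" "X = cls x" using cls_surj by blast
    then show "X \<in> irrelevant_ideal Q gr \<longleftrightarrow> flag.flag_span n X"
      using irrelevant_ideal_iff_Sp[of x] row_span_iff_Sp[of x n] by simp
  qed
qed (rule standard_graded)

end

section \<open>Flags adapted to 0 and to a product of two linear forms\<close>

lemma koszul_zero: "koszul (ext_quot n (0 :: 'k::field ext)) (ext_quot_deg n 0)"
proof -
  have d: "(\<Sum>i\<in>{1..n}. (if i = Suc s then 1 else 0) * (ext_gen (Suc t) {i} :: 'k)) = (if s = t then 1 else 0)"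
    if "s < n" for s t
  proof -
    have "(\<Sum>i\<in>{1..n}. (if i = Suc s then 1 else 0) * (ext_gen (Suc t) {i} :: 'k)) =
      (\<Sum>i\<in>{1..n}. if i = Suc s then (if s = t then 1 else 0) else 0)"
      by (intro sum.cong) (auto simp: ext_gen_def)
    then show ?thesis using that by simp
  qed
  interpret adapted_flag n "0 :: 'k ext" "\<lambda>t. ext_gen (Suc t)" "\<lambda>s i. if i = Suc s then 1 else 0"
  proof
    fix x :: "'k ext" and b assume x: "x \<in> ext_carrier n" "b \<in> {1..n}"
    let ?k = "\<lambda>t. if t = b - 1 then x else 0"
    have "(\<Sum>t\<in>{..<n}. ?k t \<cdot> ext_gen (Suc t)) = (\<Sum>t\<in>{..<n}. if t = b - 1 then x \<cdot> ext_gen b else 0)"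
      using x by (intro sum.cong) auto
    also have "\<dots> = x \<cdot> ext_gen b" using x by (subst sum.delta) auto
    finally show "\<exists>k. (\<forall>t. k t \<in> ext_carrier n) \<and> x \<cdot> ext_gen b = (\<Sum>t\<in>{..<n}. k t \<cdot> ext_gen (Suc t))"
      using x by (intro exI[of _ ?k]) auto
  qed (use d in \<open>auto intro: ext_gen_deg[unfolded One_nat_def]\<close>)
  show ?thesis by (rule koszul_quotient)
qed

text \<open>The coefficients of a product of two linear forms are the 2 by 2 minors of their
  coefficient rows.\<close>

lemma linear_form_mult_apply:
  assumes "a \<in> ext_deg n 1" "b \<in> ext_deg n 1" "p < q"
  shows "(a \<cdot> b) {p, q} = a {p} * b {q} - a {q} * b {p}"
proof -
  have "(a \<cdot> b) {p, q} = (\<Sum>S\<in>{{p}, {q}}. ext_sign S ({p, q} - S) * a S * b ({p, q} - S))"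
    unfolding ext_mult_apply
  proof (rule sum.mono_neutral_cong_right)
    show "\<forall>S\<in>Pow {p, q} - {{p}, {q}}. ext_sign S ({p, q} - S) * a S * b ({p, q} - S) = 0"
    proof
      fix S assume "S \<in> Pow {p, q} - {{p}, {q}}"
      then have "S = {} \<or> S = {p, q}" by auto
      then have "card S \<noteq> 1" using assms(3) by auto
      then have "a S = 0" using assms(1) by (auto simp: ext_deg_def)
      then show "ext_sign S ({p, q} - S) * a S * b ({p, q} - S) = 0" by simp
    qed
  qed auto
  also have "\<dots> = ext_sign {p} ({p, q} - {p}) * a {p} * b ({p, q} - {p})
      + ext_sign {q} ({p, q} - {q}) * a {q} * b ({p, q} - {q})"
    using assms(3) by (subst sum.insert) auto
  also have "{p, q} - {p} = {q}" using assms(3) by auto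
  also have "{p, q} - {q} = {p}" using assms(3) by auto
  also have "ext_sign {p} {q} = (1 :: 'a)"
  proof -
    have "{(s, t). s \<in> {p} \<and> t \<in> {q} \<and> t < s} = {}" using assms(3) by auto
    then show ?thesis by (simp only: ext_sign_def card.empty power_0)
  qed
  also have "ext_sign {q} {p} = (- 1 :: 'a)"
  proof -
    have "{(s, t). s \<in> {q} \<and> t \<in> {p} \<and> t < s} = {(q, p)}" using assms(3) by auto
    then show ?thesis by (simp add: ext_sign_def)
  qed
  finally show ?thesis by simp
qed

text \<open>A nonzero minor at coordinates \<open>p\<close>, \<open>q\<close> allows the two factors
  to be normalised there and completed to a basis by the remaining generators.\<close>

lemma koszul_product:
  fixes a b :: "'k::field ext"
  assumes a: "a \<in> ext_deg n 1" and b: "b \<in> ext_deg n 1" and nz: "a \<cdot> b \<noteq> 0"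
  shows "koszul (ext_quot n (a \<cdot> b)) (ext_quot_deg n (a \<cdot> b))"
proof -
  have h: "a \<cdot> b \<in> ext_deg n 2" using ext_deg_mult[OF a b] by (simp add: numeral_2_eq_2)
  obtain U where "(a \<cdot> b) U \<noteq> 0" using nz by (auto simp: fun_eq_iff)
  then have U: "card U = 2" "U \<subseteq> {1..n}" "(a \<cdot> b) U \<noteq> 0"
    using h ext_carrier_zero[of "a \<cdot> b" n U] by (auto simp: ext_deg_def)
  obtain p q where pq: "U = {p, q}" "p < q"
    using U(1) by (metis card_2_iff doubleton_eq_iff linorder_neq_iff)
  define \<delta> where "\<delta> = a {p} * b {q} - a {q} * b {p}"
  have \<delta>: "\<delta> \<noteq> 0" using U(3) pq linear_form_mult_apply[OF a b pq(2)] by (simp add: \<delta>_def)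
  have pqn: "p \<in> {1..n}" "q \<in> {1..n}" "p \<noteq> q" using U(2) pq by auto
  \<comment> \<open>Row reduction at the coordinates \<open>p\<close>, \<open>q\<close> by a matrix
    of determinant 1, so that the product is unchanged. The price is the entry
    \<open>\<delta>\<close> instead of 1 in \<open>b'\<close>.\<close>
  define a' where "a' = (b {q} / \<delta>) \<bullet> a - (a {q} / \<delta>) \<bullet> b"
  define b' where "b' = a {p} \<bullet> b - b {p} \<bullet> a"
  have a': "a' \<in> ext_deg n 1" and b': "b' \<in> ext_deg n 1" using a b by (simp_all add: a'_def b'_def)
  have "a' {p} = (a {p} * b {q} - a {q} * b {p}) / \<delta>"
    by (simp add: a'_def diff_divide_distrib mult.commute)
  then have a'p: "a' {p} = 1" "a' {q} = 0" and b'q: "b' {p} = 0" "b' {q} = \<delta>"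
    using \<delta> by (simp_all add: \<delta>_def[symmetric]) (simp_all add: a'_def b'_def \<delta>_def mult.commute)
  have ab: "a' \<cdot> b' = a \<cdot> b"
  proof -
    let ?one = "\<lambda>S. if S = {} then 1 else 0 :: 'k"
    have one: "?one \<cdot> x = x" if "x \<in> ext_deg n 1" for x
      using ext_one_mult(1) ext_deg_carrier[OF that] by blast
    have aa: "a \<cdot> a = 0" "b \<cdot> b = 0" "b \<cdot> a = - (a \<cdot> b)"
      using linear_form_sq[OF a, of ?one] linear_form_sq[OF b, of ?one] linear_form_anticomm[OF b a, of ?one]
      unfolding one[OF a] one[OF b] by blast+
    show ?thesis
    proof
      fix S
      have "(a' \<cdot> b') S = (b {q} / \<delta>) * (a {p} * (a \<cdot> b) S) - (a {q} / \<delta>) * (b {p} * (a \<cdot> b) S)"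
        unfolding a'_def b'_def
        by (simp only: ext_mult_linear ext_scale_simps aa ext_scale_0 minus_apply ext_scale_apply
          uminus_apply zero_fun_apply) (simp add: algebra_simps)
      also have "\<dots> = (\<delta> / \<delta>) * (a \<cdot> b) S"
        unfolding \<delta>_def by (simp add: field_simps diff_divide_distrib)
      finally show "(a' \<cdot> b') S = (a \<cdot> b) S" using \<delta> by simp
    qed
  qed
  have "card ({1..n} - {p, q}) = n - 2" using pqn by (subst card_Diff_subset) auto
  then obtain g where g: "bij_betw g {..<n - 2} ({1..n} - {p, q})"
    using ex_bij_betw_nat_finite[of "{1..n} - {p, q}"] by (auto simp: atLeast0LessThan)
  have n2: "2 \<le> n" using pqn by auto
  have gin: "g t \<in> {1..n}" "g t \<noteq> p" "g t \<noteq> q" if "t < n - 2" for t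
    using bij_betwE[OF g] that by auto
  have ginj: "g s = g t \<longleftrightarrow> s = t" if "s < n - 2" "t < n - 2" for s t
    using bij_betw_imp_inj_on[OF g] that by (auto simp: inj_on_eq_iff)
  define f where "f t = (if t = 0 then a' else if t = 1 then b' else ext_gen (g (t - 2)))" for t
  \<comment> \<open>The coordinate functional of a remaining generator, corrected at
    \<open>p\<close> and \<open>q\<close> so that it vanishes on \<open>a'\<close> and
    \<open>b'\<close>.\<close>
  define \<phi> :: "nat \<Rightarrow> nat \<Rightarrow> 'k" where "\<phi> s i = (if s = 0 then (if i = p then 1 else 0)
     else if s = 1 then (if i = q then 1 / \<delta> else 0)
     else (if i = g (s - 2) then 1 else if i = p then - a' {g (s - 2)}
       else if i = q then - b' {g (s - 2)} / \<delta> else 0))" for s i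
  have sum_\<phi>: "(\<Sum>i\<in>{1..n}. \<phi> s i * x {i}) = (if s = 0 then x {p} else if s = 1 then x {q} / \<delta>
     else x {g (s - 2)} - a' {g (s - 2)} * x {p} - b' {g (s - 2)} / \<delta> * x {q})" if s: "s < n" for s x
  proof -
    consider "s = 0" | "s = 1" | "2 \<le> s" by linarith
    then show ?thesis
    proof cases
      case 1
      then have "(\<Sum>i\<in>{1..n}. \<phi> s i * x {i}) = (\<Sum>i\<in>{1..n}. if i = p then x {p} else 0)"
        by (intro sum.cong) (auto simp: \<phi>_def)
      then show ?thesis using 1 pqn by simp
    next
      case 2
      then have "(\<Sum>i\<in>{1..n}. \<phi> s i * x {i}) = (\<Sum>i\<in>{1..n}. if i = q then x {q} / \<delta> else 0)"
        by (intro sum.cong) (auto simp: \<phi>_def)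
      then show ?thesis using 2 pqn by simp
    next
      case 3
      then have s2: "s - 2 < n - 2" using s by auto
      have "(\<Sum>i\<in>{1..n}. \<phi> s i * x {i}) = (\<Sum>i\<in>{1..n}. (if i = g (s - 2) then x {g (s - 2)} else 0)
          + (if i = p then - a' {g (s - 2)} * x {p} else 0) + (if i = q then - b' {g (s - 2)} / \<delta> * x {q} else 0))"
        using 3 gin[OF s2] pqn(3) by (intro sum.cong) (auto simp: \<phi>_def)
      also have "\<dots> = x {g (s - 2)} + - a' {g (s - 2)} * x {p} + - b' {g (s - 2)} / \<delta> * x {q}"
        unfolding sum.distrib using gin[OF s2] pqn by simp
      finally show ?thesis using 3 by simp
    qed
  qed
  have f01: "f 0 = a'" "f (Suc 0) = b'" and f2: "\<And>t. 2 \<le> t \<Longrightarrow> f t = ext_gen (g (t - 2))"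
    by (auto simp: f_def)
  have gv: "ext_gen (g t) {p} = (0 :: 'k)" "ext_gen (g t) {q} = (0 :: 'k)"
    "s < n - 2 \<Longrightarrow> ext_gen (g t) {g s} = (if s = t then 1 else 0 :: 'k)" if "t < n - 2" for t s
    using gin[OF that] ginj[of s t] that by (simp_all add: ext_gen_def)
  interpret adapted_flag n "a \<cdot> b" f \<phi>
  proof
    show "a \<cdot> b \<in> ext_deg n 2" by (rule h)
    show "a \<cdot> b = 0 \<or> 2 \<le> n \<and> a \<cdot> b = f 0 \<cdot> f 1" using n2 ab by (simp add: f_def)
    show "f t \<in> ext_deg n 1" if "t < n" for t
    proof (cases "t < 2")
      case True
      then show ?thesis using a' b' by (auto simp: f_def)
    next
      case False
      then have "g (t - 2) \<in> {1..n}" using that by (intro gin(1)) simp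
      then show ?thesis unfolding f2[OF False[unfolded not_less]] by (rule ext_gen_deg)
    qed
    show "(\<Sum>i\<in>{1..n}. \<phi> s i * f s {i}) = 1" if s: "s < n" for s
    proof -
      consider "s = 0" | "s = 1" | "2 \<le> s" by linarith
      then show ?thesis
      proof cases
        case 3
        then have s2: "s - 2 < n - 2" using s by simp
        show ?thesis unfolding sum_\<phi>[OF s] f2[OF 3] gv[OF s2] using 3 gv(3)[OF s2 s2] by simp
      qed (unfold sum_\<phi>[OF s], simp_all add: f01 a'p b'q \<delta>)
    qed
    show "(\<Sum>i\<in>{1..n}. \<phi> s i * f t {i}) = 0" if t: "t < s" and s: "s < n" for s t
    proof -
      consider "s = 1" "t = 0" | "2 \<le> s" "t = 0" | "2 \<le> s" "t = 1" | "2 \<le> s" "2 \<le> t" using t by linarith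
      then show ?thesis
      proof cases
        case 4
        then have s2: "s - 2 < n - 2" and t2: "t - 2 < n - 2" and st: "t - 2 \<noteq> s - 2" using s t by auto
        show ?thesis unfolding sum_\<phi>[OF s] f2[OF 4(2)] gv[OF t2] using 4 gv(3)[OF t2 s2] st by simp
      qed (unfold sum_\<phi>[OF s], simp_all add: f01 a'p b'q \<delta>)
    qed
    fix x :: "'k ext" and i assume x: "x \<in> ext_carrier n" and i: "i \<in> {1..n}"
    \<comment> \<open>The generators other than those at \<open>p\<close> and \<open>q\<close>
      belong to the flag; those two are recovered from \<open>a'\<close> and
      \<open>b'\<close>.\<close>
    define T where "T y \<longleftrightarrow> (\<exists>k. (\<forall>t. k t \<in> ext_carrier n) \<and> y = (\<Sum>t\<in>{..<n}. k t \<cdot> f t))" for y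
    have T_f: "T (y \<cdot> f t)" if "y \<in> ext_carrier n" "t < n" for y t
    proof -
      have "(\<Sum>t'\<in>{..<n}. (if t' = t then y else 0) \<cdot> f t') = (\<Sum>t'\<in>{..<n}. if t' = t then y \<cdot> f t' else 0)"
        by (intro sum.cong) auto
      also have "\<dots> = y \<cdot> f t" using that by (subst sum.delta) auto
      finally show ?thesis
        unfolding T_def using that by (intro exI[of _ "\<lambda>t'. if t' = t then y else 0"]) auto
    qed
    have T_diff: "T (y - z)" if Ty: "T y" and Tz: "T z" for y z
    proof -
      obtain k where k: "\<forall>t. k t \<in> ext_carrier n" "y = (\<Sum>t\<in>{..<n}. k t \<cdot> f t)"
        using Ty unfolding T_def by blast
      obtain l where l: "\<forall>t. l t \<in> ext_carrier n" "z = (\<Sum>t\<in>{..<n}. l t \<cdot> f t)"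
        using Tz unfolding T_def by blast
      have "y - z = (\<Sum>t\<in>{..<n}. (k t - l t) \<cdot> f t)"
        unfolding k(2) l(2) by (simp only: ext_mult_diff_left sum_subtractf)
      moreover have "\<forall>t. k t - l t \<in> ext_carrier n" using k(1) l(1) by simp
      ultimately show ?thesis unfolding T_def by (intro exI[of _ "\<lambda>t. k t - l t"] conjI)
    qed
    have T_0: "T 0" using T_f[of 0 0] n2 by simp
    have T_add: "T (y + z)" if "T y" "T z" for y z
      using T_diff[OF that(1) T_diff[OF T_0 that(2)]] by (simp only: diff_0 diff_minus_eq_add)
    have T_sum: "T (\<Sum>i\<in>A. y i)" if "\<And>i. i \<in> A \<Longrightarrow> T (y i)" for A and y :: "nat \<Rightarrow> 'k ext"
      by (rule sum_closed_property[of T]) (use T_0 T_add that in blast)+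
    have T_gen: "T (y \<cdot> ext_gen j)" if "j \<in> {1..n} - {p, q}" "y \<in> ext_carrier n" for j y
    proof -
      have "j \<in> g ` {..<n - 2}" using that(1) bij_betw_imp_surj_on[OF g] by simp
      then obtain t where t: "t < n - 2" "j = g t" by blast
      then show ?thesis using T_f[OF that(2), of "t + 2"] by (simp add: f_def)
    qed
    \<comment> \<open>The product of \<open>y\<close> with \<open>c\<close> is solved for its term
      at \<open>r\<close>: the other of the two special coordinates is absent from \<open>c\<close>,
      and the remaining terms are multiples of flag members.\<close>
    have T_lin: "T (c {r} \<bullet> (y \<cdot> ext_gen r))"
      if c: "c \<in> ext_deg n 1" "T (y \<cdot> c)" and y: "y \<in> ext_carrier n" and r: "r \<in> {p, q}" "\<And>r'. r' \<in> {p, q} - {r} \<Longrightarrow> c {r'} = 0"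
      for c y r
    proof -
      have "y \<cdot> c = (\<Sum>j\<in>{1..n}. c {j} \<bullet> (y \<cdot> ext_gen j))"
        using ext_mult_lin[of y n "\<lambda>j. c {j}"] unfolding ext_lin_eq[OF c(1), symmetric] .
      also have "\<dots> = c {r} \<bullet> (y \<cdot> ext_gen r) + (\<Sum>j\<in>{1..n} - {r}. c {j} \<bullet> (y \<cdot> ext_gen j))"
        using r(1) pqn by (intro sum.remove) auto
      finally have eq: "c {r} \<bullet> (y \<cdot> ext_gen r) = y \<cdot> c - (\<Sum>j\<in>{1..n} - {r}. c {j} \<bullet> (y \<cdot> ext_gen j))"
        by (simp only: add_diff_cancel_right')
      have "T (\<Sum>j\<in>{1..n} - {r}. c {j} \<bullet> (y \<cdot> ext_gen j))"
      proof (rule T_sum)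
        fix j assume j: "j \<in> {1..n} - {r}"
        show "T (c {j} \<bullet> (y \<cdot> ext_gen j))"
        proof (cases "j \<in> {p, q}")
          case True
          then have "c {j} = 0" using r(2) j by auto
          then show ?thesis using T_0 by (simp only: ext_scale_0)
        next
          case False
          then have "j \<in> {1..n} - {p, q}" using j by blast
          from T_gen[OF this ext_carrier_closed(5)[OF y, of "c {j}"]]
          show ?thesis unfolding ext_mult_scale_left .
        qed
      qed
      from T_diff[OF c(2) this] show ?thesis unfolding eq .
    qed
    have "T (x \<cdot> ext_gen i)"
    proof (cases "i \<in> {p, q}")
      case False
      then show ?thesis using T_gen[of i x] i x by blast
    next
      case True
      then consider "i = p" | "i = q" by auto
      then show ?thesis
      proof cases
        case 1
        have "T (x \<cdot> a')" using T_f[OF x, of 0] n2 by (simp add: f_def)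
        moreover have "\<And>r'. r' \<in> {p, q} - {p} \<Longrightarrow> a' {r'} = 0" using a'p by auto
        ultimately have "T (a' {p} \<bullet> (x \<cdot> ext_gen p))" by (intro T_lin[OF a' _ x]) simp_all
        then show ?thesis unfolding 1 a'p ext_scale_1 .
      next
        case 2
        \<comment> \<open>The scaling compensates for the coefficient \<open>\<delta>\<close> of
          \<open>b'\<close> at \<open>q\<close>.\<close>
        let ?y = "(1 / \<delta>) \<bullet> x"
        have "T (?y \<cdot> b')" using T_f[of ?y 1] x n2 by (simp add: f_def)
        moreover have "\<And>r'. r' \<in> {p, q} - {q} \<Longrightarrow> b' {r'} = 0" using b'q by auto
        ultimately have "T (b' {q} \<bullet> (?y \<cdot> ext_gen q))" using x by (intro T_lin[OF b']) simp_all
        then have "T (\<delta> \<bullet> (?y \<cdot> ext_gen q))" unfolding b'q .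
        moreover have "\<delta> \<bullet> (?y \<cdot> ext_gen q) = x \<cdot> ext_gen q"
          using \<delta> by (simp only: ext_mult_scale_left ext_scale_simps) simp
        ultimately show ?thesis using 2 by metis
      qed
    qed
    then show "\<exists>k. (\<forall>t. k t \<in> ext_carrier n) \<and> x \<cdot> ext_gen i = (\<Sum>t\<in>{..<n}. k t \<cdot> f t)"
      unfolding T_def .
  qed
  show ?thesis by (rule koszul_quotient)
qed

lemma reducible_imp_koszul:
  assumes "reducible_quadratic_form n h"
  shows "koszul (ext_quot n h) (ext_quot_deg n h)"
proof -
  obtain a b where "a \<in> ext_deg n 1" "b \<in> ext_deg n 1" "h = a \<cdot> b"
    using assms by (auto simp: reducible_quadratic_form_def)
  then show ?thesis using koszul_product[of a n b] koszul_zero[of n, where 'k = 'a] by metis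
qed

section \<open>Linear strands over the quotient\<close>

lemma ext_mult_lin_single:
  assumes "c \<in> {1..n}"
  shows "(x \<cdot> ext_lin n \<alpha>) {c} = x {} * \<alpha> c"
proof -
  have "{t \<in> {c}. c < t} = {}" by auto
  then have "gen_sign {c} c = (1 :: 'a)" by (simp only: gen_sign_def card.empty power_0)
  then have "(x \<cdot> ext_lin n \<alpha>) {c} = (\<Sum>a\<in>{1..n}. if a = c then x {} * \<alpha> c else 0)"
    unfolding ext_mult_lin sum_fun_apply
    by (intro sum.cong) (auto simp: ext_mult_gen_apply)
  then show ?thesis using assms by simp
qed

text \<open>The alternating matrix of \<open>h\<close>; coefficients are indexed by unordered sets,
  while the identities below permute their indices.\<close>

definition quad_coeff :: "'k::field ext \<Rightarrow> nat \<Rightarrow> nat \<Rightarrow> 'k" where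
  "quad_coeff h a b = (if a < b then h {a, b} else if b < a then - h {a, b} else 0)"

lemma quadratic_form_expansion:
  assumes "h \<in> ext_deg n 2"
  shows "h = (\<Sum>b\<in>{1..n}. \<Sum>a\<in>{1..<b}. h {a, b} \<bullet> (ext_gen a \<cdot> ext_gen b))"
proof
  fix U
  show "h U = (\<Sum>b\<in>{1..n}. \<Sum>a\<in>{1..<b}. h {a, b} \<bullet> (ext_gen a \<cdot> ext_gen b)) U"
  proof (cases "\<exists>p q. U = {p, q} \<and> p < q \<and> p \<in> {1..n} \<and> q \<in> {1..n}")
    case True
    then obtain p q where pq: "U = {p, q}" "p < q" "p \<in> {1..n}" "q \<in> {1..n}" by blast
    have "(\<Sum>b\<in>{1..n}. \<Sum>a\<in>{1..<b}. h {a, b} \<bullet> (ext_gen a \<cdot> ext_gen b)) U =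
      (\<Sum>b\<in>{1..n}. \<Sum>a\<in>{1..<b}. if a = p then (if b = q then h {p, q} else 0) else 0)"
      unfolding sum_fun_apply
      by (intro sum.cong refl) (use pq in \<open>auto simp: ext_gen_mult doubleton_eq_iff\<close>)
    also have "\<dots> = (\<Sum>b\<in>{1..n}. if b = q then h {p, q} else 0)"
      using pq by (intro sum.cong refl) (auto simp: sum.delta)
    also have "\<dots> = h {p, q}" using pq by simp
    finally show ?thesis using pq by simp
  next
    case False
    have "h U = 0"
    proof (rule ccontr)
      assume nz: "h U \<noteq> 0"
      then have "card U = 2" "U \<subseteq> {1..n}"
        using assms ext_carrier_zero[of h n U] by (auto simp: ext_deg_def)
      then obtain p q where "U = {p, q}" "p \<noteq> q" by (meson card_2_iff)
      then show False using False \<open>U \<subseteq> {1..n}\<close>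
        by (metis insert_commute insert_subset linorder_neqE_nat)
    qed
    moreover have "(\<Sum>b\<in>{1..n}. \<Sum>a\<in>{1..<b}. h {a, b} \<bullet> (ext_gen a \<cdot> ext_gen b)) U = 0"
      unfolding sum_fun_apply
    proof (intro sum.neutral ballI)
      fix b a assume b: "b \<in> {1..n}" and "a \<in> {1..<b}"
      then have "a \<in> {1..n}" "a < b" by auto
      then have "U \<noteq> {a, b}" using False b by blast
      then show "(h {a, b} \<bullet> (ext_gen a \<cdot> ext_gen b)) U = 0"
        by (simp add: ext_gen_mult)
    qed
    ultimately show ?thesis by simp
  qed
qed

text \<open>Products of two generators alternate, so only the antisymmetrisation of \<open>T\<close>
  matters and the diagonal drops out.\<close>

lemma double_sum_quadratic_form:
  assumes h: "h \<in> ext_deg n 2"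
    and T: "\<And>a b. a \<in> {1..n} \<Longrightarrow> b \<in> {1..n} \<Longrightarrow> T a b - T b a = quad_coeff h a b * g"
  shows "(\<Sum>a\<in>{1..n}. \<Sum>b\<in>{1..n}. T a b \<bullet> (x \<cdot> ext_gen a \<cdot> ext_gen b)) = g \<bullet> (h \<cdot> x)"
proof -
  have "(\<Sum>a\<in>{1..n}. \<Sum>b\<in>{1..n}. T a b \<bullet> (x \<cdot> ext_gen a \<cdot> ext_gen b)) =
    (\<Sum>b\<in>{1..n}. \<Sum>a\<in>{1..<b}. T a b \<bullet> (x \<cdot> ext_gen a \<cdot> ext_gen b) + T b a \<bullet> (x \<cdot> ext_gen b \<cdot> ext_gen a))"
    unfolding double_sum_triangle by simp
  also have "\<dots> = (\<Sum>b\<in>{1..n}. \<Sum>a\<in>{1..<b}. g \<bullet> h {a, b} \<bullet> (x \<cdot> (ext_gen a \<cdot> ext_gen b)))"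
  proof (intro sum.cong refl)
    fix b a assume ab: "b \<in> {1..n}" "a \<in> {1..<b}"
    have "T a b \<bullet> (x \<cdot> ext_gen a \<cdot> ext_gen b) + T b a \<bullet> (x \<cdot> ext_gen b \<cdot> ext_gen a)
      = (T a b - T b a) \<bullet> (x \<cdot> ext_gen a \<cdot> ext_gen b)"
      by (subst ext_gen_anticomm[of x b a]) (simp only: ext_scale_simps diff_conv_add_uminus)
    also have "T a b - T b a = g * h {a, b}"
      using ab by (subst T) (auto simp: quad_coeff_def)
    finally show "T a b \<bullet> (x \<cdot> ext_gen a \<cdot> ext_gen b) + T b a \<bullet> (x \<cdot> ext_gen b \<cdot> ext_gen a)
      = g \<bullet> h {a, b} \<bullet> (x \<cdot> (ext_gen a \<cdot> ext_gen b))"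
      by (simp only: ext_scale_simps ext_mult_assoc)
  qed
  also have "\<dots> = g \<bullet> (x \<cdot> (\<Sum>b\<in>{1..n}. \<Sum>a\<in>{1..<b}. h {a, b} \<bullet> (ext_gen a \<cdot> ext_gen b)))"
    by (simp only: ext_scale_sum_right ext_mult_sum_right ext_mult_scale_right)
  also have "\<dots> = g \<bullet> (h \<cdot> x)"
    unfolding quadratic_form_expansion[OF h, symmetric] quadratic_form_central[OF h] ..
  finally show ?thesis .
qed

text \<open>The assumption on \<open>k\<close> says, coefficient by coefficient, that the product of
  \<open>h\<close> with the linear form of \<open>k\<close> is 0. A nonzero linear form with this
  property divides \<open>h\<close>.\<close>

lemma irreducible_quadratic_form:
  assumes h: "h \<in> ext_deg n 2" "\<not> reducible_quadratic_form n h"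
    and k: "\<And>a b c. a \<in> {1..n} \<Longrightarrow> b \<in> {1..n} \<Longrightarrow> c \<in> {1..n} \<Longrightarrow>
      quad_coeff h a b * k c - quad_coeff h a c * k b + quad_coeff h b c * k a = 0"
    and p: "p \<in> {1..n}"
  shows "k p = 0"
proof (rule ccontr)
  assume nz: "k p \<noteq> 0"
  \<comment> \<open>The cofactor, found by solving the relation with third index \<open>p\<close>
    for \<open>quad_coeff h a b\<close>.\<close>
  define l where "l a = quad_coeff h a p / k p" for a
  have ab: "quad_coeff h a b = l a * k b - l b * k a" if "a \<in> {1..n}" "b \<in> {1..n}" for a b
  proof -
    have "quad_coeff h a b * k p = quad_coeff h a p * k b - quad_coeff h b p * k a"
      using k[OF that p] by (simp add: algebra_simps)
    then show ?thesis using nz by (simp add: l_def field_simps)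
  qed
  have d: "ext_lin n l \<cdot> ext_lin n k \<in> ext_deg n 2"
    using ext_deg_mult[OF ext_lin_deg ext_lin_deg, of n l k] by (simp add: numeral_2_eq_2)
  have "h = ext_lin n l \<cdot> ext_lin n k"
  proof
    fix U
    show "h U = (ext_lin n l \<cdot> ext_lin n k) U"
    proof (cases "card U = 2 \<and> U \<subseteq> {1..n}")
      case True
      then obtain a b where U: "U = {a, b}" "a < b" by (metis card_2_iff doubleton_eq_iff linorder_neq_iff)
      then have in_range: "a \<in> {1..n}" "b \<in> {1..n}" using True by auto
      have "h U = quad_coeff h a b" using U by (simp add: quad_coeff_def)
      also have "\<dots> = (ext_lin n l \<cdot> ext_lin n k) U"
        unfolding U(1) linear_form_mult_apply[OF ext_lin_deg ext_lin_deg U(2)]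
        using ab[OF in_range] in_range by (simp only: ext_lin_single)
      finally show ?thesis .
    next
      case False
      then have z: "x U = 0" if "x \<in> ext_deg n 2" for x :: "'a ext"
        using that ext_carrier_zero[of x n U] by (auto simp: ext_deg_def)
      show ?thesis using z[OF h(1)] z[OF d] by simp
    qed
  qed
  then have "reducible_quadratic_form n h"
    unfolding reducible_quadratic_form_def using h(1) ext_lin_deg by auto
  then show False using h(2) by simp
qed

context form_quotient
begin

text \<open>The degree 2 part of \<open>I\<close> consists of the scalar multiples of
  \<open>h\<close> if \<open>e = 2\<close> and is zero if \<open>e \<ge> 3\<close>, where
  \<open>g = 0\<close> is taken. Comparing coefficients gives the claim.\<close>

lemma quadratic_relation:
  assumes e: "2 \<le> e" and rel: "(\<Sum>j\<in>J. ext_lin n (\<alpha> j) \<cdot> ext_lin n (\<beta> j)) \<in> I"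
  shows "\<exists>g. \<forall>a\<in>{1..n}. \<forall>b\<in>{1..n}.
    (\<Sum>j\<in>J. \<alpha> j a * \<beta> j b) - (\<Sum>j\<in>J. \<alpha> j b * \<beta> j a) = quad_coeff h a b * g"
proof -
  let ?i = "\<Sum>j\<in>J. ext_lin n (\<alpha> j) \<cdot> ext_lin n (\<beta> j)"
  obtain g where g: "\<And>a b. a < b \<Longrightarrow> ?i {a, b} = h {a, b} * g"
  proof (cases "e = 2")
    case True
    then have "quadric_quotient n h"
      using form_quotient_axioms by (simp add: quadric_quotient_def)
    then obtain w where w: "?i = h \<cdot> w" "w \<in> ext_carrier n"
      using rel unfolding quadric_quotient.I_eq[OF \<open>quadric_quotient n h\<close>] by blast
    have "?i {a, b} = h {a, b} * w {}" if "a < b" for a b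
    proof -
      have "ext_part 2 (h \<cdot> w) = h \<cdot> ext_part 0 w"
        using ext_part_mult(2)[OF w(2) form_deg, of 0] True by simp
      also have "ext_part 0 w = (\<lambda>S. if S = {} then w {} else 0)"
        by (rule ext) (auto simp: ext_part_def card_eq_0_iff dest: ext_carrier_infinite[OF w(2)])
      finally have "ext_part 2 (h \<cdot> w) {a, b} = w {} * h {a, b}"
        by (simp only: ext_one_mult'(2)[OF form_closed] ext_scale_apply)
      then show ?thesis using that unfolding w(1) by (simp add: ext_part_apply mult.commute)
    qed
    then show ?thesis using that by blast
  next
    case False
    then have "3 \<le> e" using e by simp
    then have "?i {a, b} = h {a, b} * 0" if "a < b" for a b
      using I_low[OF rel, of "{a, b}"] that by simp
    then show ?thesis using that by blast
  qed
  have lt: "(\<Sum>j\<in>J. \<alpha> j a * \<beta> j b) - (\<Sum>j\<in>J. \<alpha> j b * \<beta> j a) = h {a, b} * g"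
    if "a < b" "a \<in> {1..n}" "b \<in> {1..n}" for a b
  proof -
    have "?i {a, b} = (\<Sum>j\<in>J. \<alpha> j a * \<beta> j b - \<alpha> j b * \<beta> j a)"
      unfolding sum_fun_apply linear_form_mult_apply[OF ext_lin_deg ext_lin_deg that(1)]
      using that by (simp only: ext_lin_single)
    then show ?thesis using g[OF that(1)] by (simp add: sum_subtractf)
  qed
  have "(\<Sum>j\<in>J. \<alpha> j a * \<beta> j b) - (\<Sum>j\<in>J. \<alpha> j b * \<beta> j a) = quad_coeff h a b * g"
    if "a \<in> {1..n}" "b \<in> {1..n}" for a b
    using lt[of a b] lt[of b a] that
    by (cases a b rule: linorder_cases) (auto simp: quad_coeff_def insert_commute algebra_simps)
  then show ?thesis by blast
qed

end

text \<open>The linear resolution, lifted to the exterior algebra: \<open>ext_lin n (\<alpha> i r c)\<close> represents the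
  entry \<open>(r, c)\<close> of the matrix of \<open>F\<^bsub>i+1\<^esub> \<rightarrow> F\<^sub>i\<close>.\<close>

locale lifted_linear_resolution = form_quotient n e h for n e :: nat and h :: "'k::field ext" +
  fixes b :: "nat \<Rightarrow> nat" and \<alpha> :: "nat \<Rightarrow> nat \<Rightarrow> nat \<Rightarrow> nat \<Rightarrow> 'k"
  assumes rank_0: "b 0 = 1"
    and start: "d \<in> {1..n} \<Longrightarrow> \<exists>x. (\<forall>r. x r \<in> ext_carrier n) \<and>
      ext_gen d - (\<Sum>r<b 1. x r \<cdot> ext_lin n (\<alpha> 0 r 0)) \<in> I"
    and complex: "s < b (Suc (Suc i)) \<Longrightarrow> c < b i \<Longrightarrow>
      (\<Sum>r<b (Suc i). ext_lin n (\<alpha> (Suc i) s r) \<cdot> ext_lin n (\<alpha> i r c)) \<in> I"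
    and exact: "\<forall>r. y r \<in> ext_carrier n \<Longrightarrow>
      \<forall>c<b i. (\<Sum>r<b (Suc i). y r \<cdot> ext_lin n (\<alpha> i r c)) \<in> I \<Longrightarrow>
      \<exists>x. (\<forall>s. x s \<in> ext_carrier n) \<and>
        (\<forall>r<b (Suc i). y r - (\<Sum>s<b (Suc (Suc i)). x s \<cdot> ext_lin n (\<alpha> (Suc i) s r)) \<in> I)"

context form_quotient
begin

text \<open>All entries are classes of linear forms. Once representatives are fixed, exactness
  becomes a statement in the exterior algebra up to \<open>I\<close>, where coefficients can be
  compared.\<close>

lemma linear_resolution_lift:
  assumes "has_linear_resolution Q gr"
  shows "\<exists>b \<alpha>. lifted_linear_resolution n e h b \<alpha>"
proof -
  obtain s A where res: "graded_free_resolution Q gr s A" and lin: "\<And>i. set (s i) \<subseteq> {i}"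
    using assms unfolding has_linear_resolution_def by blast
  define b where "b i = length (s i)" for i
  define D where "D i = row_map Q (b (Suc i)) (b i) (A i)" for i
  have R: "s 0 = [0] \<and>
      (\<forall>i. \<forall>r<b (Suc i). \<forall>c<b i. if s i ! c \<le> s (Suc i) ! r
        then A i r c \<in> gr (s (Suc i) ! r - s i ! c) else A i r c = \<zero>\<^bsub>Q\<^esub>) \<and>
      D 0 ` free_mod Q (b 1) = {x \<in> free_mod Q (b 0). x 0 \<in> irrelevant_ideal Q gr} \<and>
      (\<forall>i. D (Suc i) ` free_mod Q (b (Suc (Suc i))) =
        {x \<in> free_mod Q (b (Suc i)). \<forall>c<b i. D i x c = \<zero>\<^bsub>Q\<^esub>})"
    using res unfolding graded_free_resolution_def Let_def b_def D_def One_nat_def .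
  note s0 = R[THEN conjunct1] and hom = R[THEN conjunct2, THEN conjunct1, rule_format]
    and im0 = R[THEN conjunct2, THEN conjunct2, THEN conjunct1]
    and imS = R[THEN conjunct2, THEN conjunct2, THEN conjunct2, THEN spec]
  have b0: "b 0 = 1" using s0 by (simp add: b_def)
  have si: "s i ! c = i" if "c < b i" for i c
    using lin[of i] that nth_mem[of c "s i"] unfolding b_def by blast
  define \<alpha> where "\<alpha> i r c = (SOME \<beta>. A i r c = cls (ext_lin n \<beta>))" for i r c
  have \<alpha>: "A i r c = cls (ext_lin n (\<alpha> i r c))" if "r < b (Suc i)" "c < b i" for i r c
  proof -
    \<comment> \<open>The bases of consecutive modules lie in consecutive degrees, which makes every
      entry linear.\<close>
    have "A i r c \<in> gr 1" using hom[OF that] si[OF that(1)] si[OF that(2)] by simp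
    then obtain z where "z \<in> ext_deg n 1" "A i r c = cls z" by (auto simp: gr_def)
    then have "A i r c = cls (ext_lin n (\<lambda>a. z {a}))" using ext_lin_eq[of z n] by simp
    then show ?thesis unfolding \<alpha>_def by (rule someI[of "\<lambda>\<beta>. A i r c = cls (ext_lin n \<beta>)"])
  qed
  define vec where "vec p x = (\<lambda>r\<in>{..<p}. cls (x r))" for p :: nat and x
  have vec: "vec p x \<in> free_mod Q p" if "\<And>r. r < p \<Longrightarrow> x r \<in> ext_carrier n" for p x
    using that by (auto simp: vec_def free_mod_def)
  have D_vec: "D i (vec (b (Suc i)) x) c = cls (\<Sum>r<b (Suc i). x r \<cdot> ext_lin n (\<alpha> i r c))"
    if x: "\<And>r. r < b (Suc i) \<Longrightarrow> x r \<in> ext_carrier n" and c: "c < b i" for i x c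
  proof -
    have "D i (vec (b (Suc i)) x) c = (\<Oplus>\<^bsub>Q\<^esub>r\<in>{..<b (Suc i)}. vec (b (Suc i)) x r \<otimes>\<^bsub>Q\<^esub> A i r c)"
      using c by (simp add: D_def row_map_def)
    also have "\<dots> = (\<Oplus>\<^bsub>Q\<^esub>r\<in>{..<b (Suc i)}. cls (x r \<cdot> ext_lin n (\<alpha> i r c)))"
      using x c by (intro Q.finsum_cong') (auto simp: vec_def \<alpha> cls_mult)
    also have "\<dots> = cls (\<Sum>r<b (Suc i). x r \<cdot> ext_lin n (\<alpha> i r c))"
      by (rule cls_sum[symmetric]) (simp add: x)
    finally show ?thesis .
  qed
  have rep: "\<exists>x. (\<forall>r. x r \<in> ext_carrier n) \<and> z = vec p x" if z: "z \<in> free_mod Q p" for z p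
  proof -
    have "\<exists>u. u \<in> ext_carrier n \<and> (r < p \<longrightarrow> z r = cls u)" for r
    proof (cases "r < p")
      case True
      then have "z r \<in> carrier Q" using z by (auto simp: free_mod_def)
      then show ?thesis using cls_surj by blast
    next
      case False
      then show ?thesis using ext_carrier_closed(1) by blast
    qed
    then obtain x where x: "\<And>r. x r \<in> ext_carrier n" "\<And>r. r < p \<Longrightarrow> z r = cls (x r)" by metis
    have "z = vec p x"
    proof
      fix r show "z r = vec p x r"
        using z x(2) by (cases "r < p") (auto simp: vec_def free_mod_def PiE_def extensional_def)
    qed
    then show ?thesis using x(1) by blast
  qed
  have sumc: "(\<Sum>r<b (Suc i). x r \<cdot> ext_lin n (\<alpha> i r c)) \<in> ext_carrier n"
    if "\<And>r. r < b (Suc i) \<Longrightarrow> x r \<in> ext_carrier n" for i x c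
    using that by (intro ext_carrier_sum ext_carrier_closed ext_lin_closed) auto
  have start: "\<exists>x. (\<forall>r. x r \<in> ext_carrier n) \<and> ext_gen d - (\<Sum>r<b 1. x r \<cdot> ext_lin n (\<alpha> 0 r 0)) \<in> I"
    if d: "d \<in> {1..n}" for d
  proof -
    let ?v = "vec (b 0) (\<lambda>_. ext_gen d)"
    have v0: "?v 0 = cls (ext_gen d)" using b0 by (simp add: vec_def)
    have "(\<Union>d\<in>{1..}. gr d) \<subseteq> carrier Q" using ext_deg_carrier cls.hom_closed by (fastforce simp: gr_def)
    then have "(\<Union>d\<in>{1..}. gr d) \<subseteq> irrelevant_ideal Q gr"
      unfolding irrelevant_ideal_def by (rule Q.genideal_self)
    moreover have "cls (ext_gen d) \<in> gr 1" unfolding gr_def using ext_gen_deg[OF d] by blast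
    ultimately have "?v 0 \<in> irrelevant_ideal Q gr" unfolding v0 by blast
    then have "?v \<in> D 0 ` free_mod Q (b 1)" unfolding im0 using vec d by simp
    then obtain z where z: "?v = D 0 z" "z \<in> free_mod Q (b 1)" by blast
    obtain x where x: "\<forall>r. x r \<in> ext_carrier n" "z = vec (b 1) x" using rep[OF z(2)] by blast
    have "cls (ext_gen d) = cls (\<Sum>r<b 1. x r \<cdot> ext_lin n (\<alpha> 0 r 0))"
      using D_vec[of 0 x 0] x z(1) v0 b0 by simp
    then have "ext_gen d - (\<Sum>r<b 1. x r \<cdot> ext_lin n (\<alpha> 0 r 0)) \<in> I"
      using x(1) d sumc[of 0 x 0] by (subst (asm) cls_eq_iff) auto
    then show ?thesis using x(1) by blast
  qed
  have cplx: "(\<Sum>r<b (Suc i). ext_lin n (\<alpha> (Suc i) t r) \<cdot> ext_lin n (\<alpha> i r c)) \<in> I"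
    if t: "t < b (Suc (Suc i))" and c: "c < b i" for i t c
  proof -
    \<comment> \<open>The unit vector at \<open>t\<close>; its image is row \<open>t\<close> of the
      matrix, which is therefore a cycle.\<close>
    define u :: "nat \<Rightarrow> 'k ext" where "u t' = (if t' = t then (\<lambda>S. if S = {} then 1 else 0) else 0)" for t'
    have uc: "u t' \<in> ext_carrier n" for t' by (simp add: u_def)
    have "D (Suc i) (vec (b (Suc (Suc i))) u) r = cls (ext_lin n (\<alpha> (Suc i) t r))" if r: "r < b (Suc i)" for r
    proof -
      have "(\<Sum>t'<b (Suc (Suc i)). u t' \<cdot> ext_lin n (\<alpha> (Suc i) t' r)) =
        (\<Sum>t'<b (Suc (Suc i)). if t' = t then ext_lin n (\<alpha> (Suc i) t r) else 0)"
        by (intro sum.cong) (simp_all add: u_def ext_one_mult(1)[OF ext_lin_closed])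
      also have "\<dots> = ext_lin n (\<alpha> (Suc i) t r)" using t by (subst sum.delta) auto
      finally show ?thesis using D_vec[of "Suc i" u r] uc r by simp
    qed
    then have "D (Suc i) (vec (b (Suc (Suc i))) u) r =
        vec (b (Suc i)) (\<lambda>r. ext_lin n (\<alpha> (Suc i) t r)) r" for r
      by (cases "r < b (Suc i)") (simp_all add: vec_def D_def row_map_def)
    then have "D (Suc i) (vec (b (Suc (Suc i))) u) = vec (b (Suc i)) (\<lambda>r. ext_lin n (\<alpha> (Suc i) t r))"
      by (rule ext)
    moreover have "D (Suc i) (vec (b (Suc (Suc i))) u) \<in> D (Suc i) ` free_mod Q (b (Suc (Suc i)))"
      using vec uc by blast
    ultimately have "D i (vec (b (Suc i)) (\<lambda>r. ext_lin n (\<alpha> (Suc i) t r))) c = \<zero>\<^bsub>Q\<^esub>"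
      unfolding imS using c by simp
    then show ?thesis
      using D_vec[of i "\<lambda>r. ext_lin n (\<alpha> (Suc i) t r)" c] c
        sumc[of i "\<lambda>r. ext_lin n (\<alpha> (Suc i) t r)" c] by (simp add: cls_eq_0_iff)
  qed
  have exact: "\<exists>x. (\<forall>s. x s \<in> ext_carrier n) \<and>
        (\<forall>r<b (Suc i). y r - (\<Sum>s<b (Suc (Suc i)). x s \<cdot> ext_lin n (\<alpha> (Suc i) s r)) \<in> I)"
    if y: "\<forall>r. y r \<in> ext_carrier n" and ker: "\<forall>c<b i. (\<Sum>r<b (Suc i). y r \<cdot> ext_lin n (\<alpha> i r c)) \<in> I" for i y
  proof -
    have "D i (vec (b (Suc i)) y) c = \<zero>\<^bsub>Q\<^esub>" if "c < b i" for c
      using D_vec[of i y c] y ker that sumc[of i y c] by (simp add: cls_eq_0_iff)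
    then have "vec (b (Suc i)) y \<in> D (Suc i) ` free_mod Q (b (Suc (Suc i)))"
      unfolding imS using vec y by simp
    then obtain z where z: "vec (b (Suc i)) y = D (Suc i) z" "z \<in> free_mod Q (b (Suc (Suc i)))" by blast
    obtain x where x: "\<forall>r. x r \<in> ext_carrier n" "z = vec (b (Suc (Suc i))) x" using rep[OF z(2)] by blast
    have "y r - (\<Sum>s<b (Suc (Suc i)). x s \<cdot> ext_lin n (\<alpha> (Suc i) s r)) \<in> I" if r: "r < b (Suc i)" for r
    proof -
      have "cls (y r) = vec (b (Suc i)) y r" using r by (simp add: vec_def)
      also have "\<dots> = cls (\<Sum>s<b (Suc (Suc i)). x s \<cdot> ext_lin n (\<alpha> (Suc i) s r))"
        unfolding z(1) x(2) using x(1) r by (intro D_vec) auto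
      finally show ?thesis using y sumc[of "Suc i" x r] x(1) by (subst (asm) cls_eq_iff) auto
    qed
    then show ?thesis using x(1) by blast
  qed
  have "lifted_linear_resolution n e h b \<alpha>"
    by (intro lifted_linear_resolution.intro lifted_linear_resolution_axioms.intro
        form_quotient_axioms b0 start cplx exact)
  then show ?thesis by blast
qed

end

section \<open>The first three differentials in scalar coordinates\<close>

context lifted_linear_resolution
begin

abbreviation "\<xi> r \<equiv> \<alpha> 0 r 0"
abbreviation "\<mu> q r \<equiv> \<alpha> 1 q r"

abbreviation "\<nu> p q \<equiv> \<alpha> 2 p q"

lemma exact_start:
  assumes "\<forall>r. y r \<in> ext_carrier n" "(\<Sum>r<b 1. y r \<cdot> ext_lin n (\<xi> r)) \<in> I"
  shows "\<exists>x. (\<forall>q. x q \<in> ext_carrier n) \<and> (\<forall>r<b 1. y r - (\<Sum>q<b 2. x q \<cdot> ext_lin n (\<mu> q r)) \<in> I)"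
  using exact[of y 0, unfolded rank_0] assms by (simp add: numeral_2_eq_2)

lemma exact_next:
  assumes "\<forall>q. y q \<in> ext_carrier n" "\<forall>r<b 1. (\<Sum>q<b 2. y q \<cdot> ext_lin n (\<mu> q r)) \<in> I"
  shows "\<exists>x. (\<forall>p. x p \<in> ext_carrier n) \<and> (\<forall>q<b 2. y q - (\<Sum>p<b 3. x p \<cdot> ext_lin n (\<nu> p q)) \<in> I)"
  using exact[of y 1] assms by (simp add: numeral_2_eq_2 numeral_3_eq_3)

text \<open>The forms given by \<open>\<xi>\<close> generate each e_d modulo \<open>I\<close>, and
  \<open>I\<close> has no part in degree 1. The scalars are the constant terms of the
  coefficients.\<close>

lemma start_left_inverse:
  assumes e: "2 \<le> e"
  obtains \<kappa> :: "nat \<Rightarrow> nat \<Rightarrow> 'k"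
  where "\<And>d c. d \<in> {1..n} \<Longrightarrow> c \<in> {1..n} \<Longrightarrow> (\<Sum>r<b 1. \<kappa> d r * \<xi> r c) = (if d = c then 1 else 0)"
proof -
  have "\<forall>d\<in>{1..n}. \<exists>x. ext_gen d - (\<Sum>r<b 1. x r \<cdot> ext_lin n (\<xi> r)) \<in> I"
    using start by blast
  from bchoice[OF this] obtain x
    where x: "\<forall>d\<in>{1..n}. ext_gen d - (\<Sum>r<b 1. x d r \<cdot> ext_lin n (\<xi> r)) \<in> I" ..
  have "(\<Sum>r<b 1. x d r {} * \<xi> r c) = (if d = c then 1 else 0)" if d: "d \<in> {1..n}" and c: "c \<in> {1..n}" for d c
  proof -
    have "(ext_gen d - (\<Sum>r<b 1. x d r \<cdot> ext_lin n (\<xi> r))) {c} = 0"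
      by (rule I_low[OF bspec[OF x d]]) (use e in simp)
    then have "(\<Sum>r<b 1. x d r \<cdot> ext_lin n (\<xi> r)) {c} = ext_gen d {c}" by simp
    then show ?thesis
      unfolding sum_fun_apply using c by (simp add: ext_mult_lin_single ext_gen_def)
  qed
  then show ?thesis using that[of "\<lambda>d r. x d r {}"] by blast
qed

text \<open>A change of coordinates: tuples indexed by the generators e_c are carried by
  \<open>\<kappa>\<close> to the basis of F_1 and recovered by \<open>\<xi>\<close>.\<close>

lemma start_inverse_apply:
  assumes \<kappa>: "\<And>d c. d \<in> {1..n} \<Longrightarrow> c \<in> {1..n} \<Longrightarrow> (\<Sum>r<b 1. \<kappa> d r * \<xi> r c) = (if d = c then 1 else 0)"
    and c: "c \<in> {1..n}"
  shows "(\<Sum>r<b 1. \<xi> r c \<bullet> (\<Sum>d\<in>{1..n}. \<kappa> d r \<bullet> w d)) = w c"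
proof -
  have "(\<Sum>r<b 1. \<xi> r c \<bullet> (\<Sum>d\<in>{1..n}. \<kappa> d r \<bullet> w d)) = (\<Sum>r<b 1. \<Sum>d\<in>{1..n}. (\<kappa> d r * \<xi> r c) \<bullet> w d)"
    by (simp only: ext_scale_sum_right ext_scale_simps(5) mult.commute)
  also have "\<dots> = (\<Sum>d\<in>{1..n}. (\<Sum>r<b 1. \<kappa> d r * \<xi> r c) \<bullet> w d)"
    by (subst sum.swap) (simp only: ext_scale_sum_left)
  also have "\<dots> = (\<Sum>d\<in>{1..n}. if d = c then w c else 0)"
    by (intro sum.cong refl) (simp only: \<kappa>[OF _ c] if_distrib[of "\<lambda>k. k \<bullet> _"] ext_scale_0 ext_scale_1 cong: if_cong)
  also have "\<dots> = w c" using c by (subst sum.delta) auto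
  finally show ?thesis .
qed

text \<open>For \<open>e \<ge> 3\<close> there are no quadratic forms in \<open>I\<close>, so the
  linear syzygies have symmetric coefficient matrices in the e_c and contribute 0 to the expansion
  of \<open>h\<close>. What remains lies in \<open>I\<close> times linear forms and starts in degree
  at least \<open>e + 1\<close>.\<close>

lemma form_degree_eq_2:
  assumes e: "2 \<le> e" and h: "h \<noteq> 0"
  shows "e = 2"
proof (rule ccontr)
  assume "e \<noteq> 2"
  then have e: "3 \<le> e" "2 \<le> e" using e by auto
  obtain \<kappa> where \<kappa>: "\<And>d c. d \<in> {1..n} \<Longrightarrow> c \<in> {1..n} \<Longrightarrow>
      (\<Sum>r<b 1. \<kappa> d r * \<xi> r c) = (if d = c then 1 else 0)"
    by (rule start_left_inverse[OF e(2)]) blast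
  have "h {} = 0" using form_deg e(1) by (auto simp: ext_deg_def)
  then obtain w where w: "\<And>c. w c \<in> ext_carrier n" "h = (\<Sum>c\<in>{1..n}. w c \<cdot> ext_gen c)"
    using lin_combination_of_gens[OF form_closed] by blast
  \<comment> \<open>The coefficients of \<open>h\<close>, transferred to the basis of F_1.\<close>
  define y where "y r = (\<Sum>d\<in>{1..n}. \<kappa> d r \<bullet> w d)" for r
  have yc: "y r \<in> ext_carrier n" for r unfolding y_def using w(1) by (intro ext_carrier_sum) simp
  have inv: "(\<Sum>r<b 1. \<xi> r c \<bullet> y r) = w c" if "c \<in> {1..n}" for c
    unfolding y_def by (rule start_inverse_apply[OF \<kappa> that])
  have "(\<Sum>r<b 1. y r \<cdot> ext_lin n (\<xi> r)) = (\<Sum>r<b 1. \<Sum>c\<in>{1..n}. (\<xi> r c \<bullet> y r) \<cdot> ext_gen c)"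
    by (simp only: ext_mult_lin ext_mult_scale_left)
  also have "\<dots> = (\<Sum>c\<in>{1..n}. (\<Sum>r<b 1. \<xi> r c \<bullet> y r) \<cdot> ext_gen c)"
    by (subst sum.swap) (simp only: ext_mult_sum_left)
  also have "\<dots> = (\<Sum>c\<in>{1..n}. w c \<cdot> ext_gen c)"
    by (intro sum.cong refl) (simp only: inv)
  finally have "(\<Sum>r<b 1. y r \<cdot> ext_lin n (\<xi> r)) \<in> I"
    using w(2) form_in_I by simp
  then obtain x where x: "\<forall>s. x s \<in> ext_carrier n"
    "\<forall>r<b 1. y r - (\<Sum>q<b 2. x q \<cdot> ext_lin n (\<mu> q r)) \<in> I"
    using exact_start[of y] yc by blast
  define t where "t q a c = (\<Sum>r<b 1. \<mu> q r a * \<xi> r c)" for q a c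
  have t_sym: "t q a c = t q c a" if "q < b 2" "a \<in> {1..n}" "c \<in> {1..n}" for q a c
  proof -
    have "(\<Sum>r<b 1. ext_lin n (\<mu> q r) \<cdot> ext_lin n (\<xi> r)) \<in> I"
      using complex[of q 0 0] that(1) rank_0 by (simp add: numeral_2_eq_2)
    from quadratic_relation[OF e(2) this] obtain g where "\<forall>a\<in>{1..n}. \<forall>c\<in>{1..n}.
        (\<Sum>r<b 1. \<mu> q r a * \<xi> r c) - (\<Sum>r<b 1. \<mu> q r c * \<xi> r a) = quad_coeff h a c * g"
      by blast
    then have "t q a c - t q c a = quad_coeff h a c * g" unfolding t_def using that(2,3) by blast
    moreover have "quad_coeff h a c = 0"
      using form_deg e(1) by (auto simp: quad_coeff_def ext_deg_def)
    ultimately show ?thesis by simp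
  qed
  \<comment> \<open>The part of the syzygy not generated by linear ones; \<open>j\<close> is the
    same remainder in the coordinates of the e_c.\<close>
  define i where "i r = y r - (\<Sum>q<b 2. x q \<cdot> ext_lin n (\<mu> q r))" for r
  define j where "j c = (\<Sum>r<b 1. \<xi> r c \<bullet> i r)" for c
  define u where "u a c = (\<Sum>q<b 2. t q a c \<bullet> x q)" for a c
  have wc: "w c = j c + (\<Sum>a\<in>{1..n}. u a c \<cdot> ext_gen a)" if c: "c \<in> {1..n}" for c
  proof -
    have "(\<Sum>r<b 1. \<xi> r c \<bullet> (\<Sum>q<b 2. x q \<cdot> ext_lin n (\<mu> q r))) =
      (\<Sum>r<b 1. \<Sum>q<b 2. \<Sum>a\<in>{1..n}. (\<mu> q r a * \<xi> r c) \<bullet> (x q \<cdot> ext_gen a))"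
      by (simp only: ext_mult_lin ext_scale_sum_right ext_scale_simps(5) mult.commute)
    also have "\<dots> = (\<Sum>q<b 2. \<Sum>r<b 1. \<Sum>a\<in>{1..n}. (\<mu> q r a * \<xi> r c) \<bullet> (x q \<cdot> ext_gen a))"
      by (rule sum.swap)
    also have "\<dots> = (\<Sum>q<b 2. \<Sum>a\<in>{1..n}. \<Sum>r<b 1. (\<mu> q r a * \<xi> r c) \<bullet> (x q \<cdot> ext_gen a))"
      by (rule sum.cong[OF refl]) (rule sum.swap)
    also have "\<dots> = (\<Sum>a\<in>{1..n}. \<Sum>q<b 2. \<Sum>r<b 1. (\<mu> q r a * \<xi> r c) \<bullet> (x q \<cdot> ext_gen a))"
      by (rule sum.swap)
    also have "\<dots> = (\<Sum>a\<in>{1..n}. u a c \<cdot> ext_gen a)"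
      unfolding u_def t_def by (simp only: ext_mult_sum_left ext_mult_scale_left ext_scale_sum_left)
    finally have *: "(\<Sum>r<b 1. \<xi> r c \<bullet> (\<Sum>q<b 2. x q \<cdot> ext_lin n (\<mu> q r))) = (\<Sum>a\<in>{1..n}. u a c \<cdot> ext_gen a)" .
    have "j c = w c - (\<Sum>a\<in>{1..n}. u a c \<cdot> ext_gen a)"
      unfolding j_def i_def ext_scale_simps sum_subtractf * inv[OF c] ..
    then show ?thesis by (simp only: diff_add_cancel)
  qed
  have "(\<Sum>c\<in>{1..n}. \<Sum>a\<in>{1..n}. u a c \<cdot> ext_gen a \<cdot> ext_gen c) = 0"
  proof -
    define T where "T c a = (if a \<in> {1..n} \<and> c \<in> {1..n} then u a c \<cdot> ext_gen a \<cdot> ext_gen c else 0)" for c a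
    have us: "u a c = u c a" if "a \<in> {1..n}" "c \<in> {1..n}" for a c
      unfolding u_def by (intro sum.cong refl) (use t_sym that in simp)
    have "(\<Sum>c\<in>{1..n}. \<Sum>a\<in>{1..n}. u a c \<cdot> ext_gen a \<cdot> ext_gen c) = (\<Sum>c\<in>{1..n}. \<Sum>a\<in>{1..n}. T c a)"
      by (intro sum.cong refl) (simp only: T_def simp_thms if_True)
    also have "\<dots> = 0"
    proof (rule double_sum_antisym)
      fix a c
      show "T c a = - T a c"
      proof (cases "a \<in> {1..n} \<and> c \<in> {1..n}")
        case True
        then have "T c a = u a c \<cdot> ext_gen a \<cdot> ext_gen c" "T a c = u a c \<cdot> ext_gen c \<cdot> ext_gen a"
          using us[of a c] by (simp_all add: T_def)
        then show ?thesis using ext_gen_anticomm[of "u a c" a c] by metis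
      next
        case False
        then have "T c a = 0" "T a c = 0" by (auto simp: T_def)
        then show ?thesis by simp
      qed
      show "T a a = 0" unfolding T_def by (simp only: ext_gen_sq if_cancel)
    qed
    finally show ?thesis .
  qed
  moreover have "h = (\<Sum>c\<in>{1..n}. j c \<cdot> ext_gen c) + (\<Sum>c\<in>{1..n}. \<Sum>a\<in>{1..n}. u a c \<cdot> ext_gen a \<cdot> ext_gen c)"
  proof -
    have "h = (\<Sum>c\<in>{1..n}. (j c + (\<Sum>a\<in>{1..n}. u a c \<cdot> ext_gen a)) \<cdot> ext_gen c)"
      unfolding w(2) by (intro sum.cong refl) (simp only: wc[symmetric])
    then show ?thesis by (simp only: ext_mult_add_left ext_mult_sum_left sum.distrib)
  qed
  ultimately have hj: "h = (\<Sum>c\<in>{1..n}. j c \<cdot> ext_gen c)" by (simp only: add_0_right)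
  \<comment> \<open>The coefficients \<open>j c\<close> vanish below degree \<open>e\<close>, so
    this expression for \<open>h\<close> has nothing in degree \<open>e\<close>.\<close>
  have "h S = 0" if S: "card S = e" for S
  proof -
    have "(j c \<cdot> ext_gen c) S = 0" for c
    proof (cases "finite S \<and> c \<in> S")
      case True
      then have "card (S - {c}) < e" using S e(1) by simp
      then have "i r (S - {c}) = 0" if "r < b 1" for r
        using x(2) that I_low unfolding i_def by blast
      then have "j c (S - {c}) = 0" unfolding j_def sum_fun_apply by (intro sum.neutral) simp
      then show ?thesis by (simp add: ext_mult_gen_apply)
    next
      case False
      then show ?thesis by (auto simp: ext_mult_gen_apply)
    qed
    then show ?thesis by (subst hj) (simp only: sum_fun_apply sum.neutral_const)
  qed
  then have "h = 0" using form_deg by (auto simp: ext_deg_def fun_eq_iff)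
  then show False using h by simp
qed

text \<open>A symmetric matrix gives a linear syzygy of the generators already in the exterior
  algebra. Exactness writes it through the rows of \<open>\<mu>\<close>, and comparing linear parts
  leaves scalar coefficients.\<close>

lemma symmetric_scalars_lift:
  fixes t :: "nat \<Rightarrow> nat \<Rightarrow> 'k"
  assumes e: "2 \<le> e"
    and \<kappa>: "\<And>d c. d \<in> {1..n} \<Longrightarrow> c \<in> {1..n} \<Longrightarrow> (\<Sum>r<b 1. \<kappa> d r * \<xi> r c) = (if d = c then 1 else 0)"
    and t: "\<And>a d. t a d = t d a"
  shows "\<exists>x. \<forall>r<b 1. \<forall>a\<in>{1..n}. (\<Sum>q<b 2. \<mu> q r a * x q) = (\<Sum>d\<in>{1..n}. \<kappa> d r * t a d)"
proof -
  let ?one = "\<lambda>S. if S = {} then 1 else 0 :: 'k"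
  define y where "y r = ext_lin n (\<lambda>a. \<Sum>d\<in>{1..n}. \<kappa> d r * t a d)" for r
  have one: "?one \<cdot> ext_lin n \<beta> = ext_lin n \<beta>" for \<beta>
    by (rule ext_one_mult(1)[OF ext_lin_closed])
  have "(\<Sum>r<b 1. y r \<cdot> ext_lin n (\<xi> r)) = (\<Sum>r<b 1. ?one \<cdot> y r \<cdot> ext_lin n (\<xi> r))"
    unfolding y_def one ..
  also have "\<dots> = (\<Sum>r<b 1. \<Sum>a\<in>{1..n}. \<Sum>c\<in>{1..n}.
      ((\<Sum>d\<in>{1..n}. \<kappa> d r * t a d) * \<xi> r c) \<bullet> (?one \<cdot> ext_gen a \<cdot> ext_gen c))"
    unfolding y_def ext_mult_lin_lin ..
  also have "\<dots> = (\<Sum>a\<in>{1..n}. \<Sum>r<b 1. \<Sum>c\<in>{1..n}.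
      ((\<Sum>d\<in>{1..n}. \<kappa> d r * t a d) * \<xi> r c) \<bullet> (?one \<cdot> ext_gen a \<cdot> ext_gen c))"
    by (rule sum.swap)
  also have "\<dots> = (\<Sum>a\<in>{1..n}. \<Sum>c\<in>{1..n}. \<Sum>r<b 1.
      ((\<Sum>d\<in>{1..n}. \<kappa> d r * t a d) * \<xi> r c) \<bullet> (?one \<cdot> ext_gen a \<cdot> ext_gen c))"
    by (rule sum.cong[OF refl]) (rule sum.swap)
  also have "\<dots> = (\<Sum>a\<in>{1..n}. \<Sum>c\<in>{1..n}. t a c \<bullet> (?one \<cdot> ext_gen a \<cdot> ext_gen c))"
  proof (intro sum.cong refl)
    fix a c assume c: "c \<in> {1..n}"
    have "(\<Sum>r<b 1. (\<Sum>d\<in>{1..n}. \<kappa> d r * t a d) * \<xi> r c) = (\<Sum>r<b 1. \<Sum>d\<in>{1..n}. t a d * (\<kappa> d r * \<xi> r c))"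
      unfolding sum_distrib_right by (simp only: mult_ac)
    also have "\<dots> = (\<Sum>d\<in>{1..n}. t a d * (\<Sum>r<b 1. \<kappa> d r * \<xi> r c))"
      by (subst sum.swap) (simp only: sum_distrib_left)
    also have "\<dots> = (\<Sum>d\<in>{1..n}. if d = c then t a c else 0)"
      by (intro sum.cong refl) (simp only: \<kappa>[OF _ c] if_distrib[of "\<lambda>k. _ * k"] mult_1_right mult_zero_right cong: if_cong)
    also have "\<dots> = t a c" using c by simp
    finally show "(\<Sum>r<b 1. ((\<Sum>d\<in>{1..n}. \<kappa> d r * t a d) * \<xi> r c) \<bullet> (?one \<cdot> ext_gen a \<cdot> ext_gen c)) =
        t a c \<bullet> (?one \<cdot> ext_gen a \<cdot> ext_gen c)"
      by (simp only: ext_scale_sum_left[symmetric])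
  qed
  also have "\<dots> = 0"
  proof (rule double_sum_antisym)
    fix a c
    show "t a c \<bullet> (?one \<cdot> ext_gen a \<cdot> ext_gen c) = - (t c a \<bullet> (?one \<cdot> ext_gen c \<cdot> ext_gen a))"
      by (subst ext_gen_anticomm, subst t) (simp only: ext_scale_simps)
  qed (simp only: ext_gen_sq ext_scale_0)
  finally have "(\<Sum>r<b 1. y r \<cdot> ext_lin n (\<xi> r)) = 0" .
  moreover have "(0 :: 'k ext) \<in> I" using I.zero_closed by simp
  ultimately have "(\<Sum>r<b 1. y r \<cdot> ext_lin n (\<xi> r)) \<in> I" by (simp only:)
  moreover have "\<forall>r. y r \<in> ext_carrier n" by (simp add: y_def)
  ultimately obtain x where x: "\<forall>r<b 1. y r - (\<Sum>q<b 2. x q \<cdot> ext_lin n (\<mu> q r)) \<in> I"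
    using exact_start[of y] by blast
  have "(\<Sum>q<b 2. \<mu> q r a * x q {}) = (\<Sum>d\<in>{1..n}. \<kappa> d r * t a d)" if r: "r < b 1" and a: "a \<in> {1..n}" for r a
  proof -
    have "(y r - (\<Sum>q<b 2. x q \<cdot> ext_lin n (\<mu> q r))) {a} = 0"
      by (rule I_low[OF x[rule_format, OF r]]) (use e in simp)
    then have "y r {a} = (\<Sum>q<b 2. x q \<cdot> ext_lin n (\<mu> q r)) {a}"
      unfolding minus_apply by (rule eq_iff_diff_eq_0[THEN iffD2])
    also have "\<dots> = (\<Sum>q<b 2. \<mu> q r a * x q {})"
      unfolding sum_fun_apply ext_mult_lin_single[OF a] by (simp only: mult.commute)
    finally show ?thesis unfolding y_def ext_lin_single[OF a] by (rule sym)
  qed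
  then show ?thesis by (intro exI[of _ "\<lambda>q. x q {}"] allI impI ballI)
qed

lemma symmetric_lift:
  fixes u :: "nat \<Rightarrow> nat \<Rightarrow> 'k ext"
  assumes e: "2 \<le> e"
    and \<kappa>: "\<And>d c. d \<in> {1..n} \<Longrightarrow> c \<in> {1..n} \<Longrightarrow> (\<Sum>r<b 1. \<kappa> d r * \<xi> r c) = (if d = c then 1 else 0)"
    and u: "\<And>a d. u a d = u d a" "\<And>a d. u a d \<in> ext_carrier n"
  obtains x where "\<And>q. x q \<in> ext_carrier n"
    "\<And>r a. r < b 1 \<Longrightarrow> a \<in> {1..n} \<Longrightarrow> (\<Sum>q<b 2. \<mu> q r a \<bullet> x q) = (\<Sum>d\<in>{1..n}. \<kappa> d r \<bullet> u a d)"
proof -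
  have "\<forall>S. \<exists>x. \<forall>r<b 1. \<forall>a\<in>{1..n}. (\<Sum>q<b 2. \<mu> q r a * x q) = (\<Sum>d\<in>{1..n}. \<kappa> d r * u a d S)"
  proof
    fix S
    have "u a d S = u d a S" for a d by (rule arg_cong[OF u(1)])
    with e \<kappa> show "\<exists>x. \<forall>r<b 1. \<forall>a\<in>{1..n}. (\<Sum>q<b 2. \<mu> q r a * x q) = (\<Sum>d\<in>{1..n}. \<kappa> d r * u a d S)"
      by (rule symmetric_scalars_lift)
  qed
  from choice[OF this] obtain X
    where X: "\<forall>S. \<forall>r<b 1. \<forall>a\<in>{1..n}. (\<Sum>q<b 2. \<mu> q r a * X S q) = (\<Sum>d\<in>{1..n}. \<kappa> d r * u a d S)" ..
  \<comment> \<open>The scalar lift is used for each monomial separately; coefficients outside the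
    basis monomials are set to 0 so that \<open>x q\<close> lies in the algebra.\<close>
  define x where "x q S = (if S \<subseteq> {1..n} then X S q else 0)" for q S
  have "x q \<in> ext_carrier n" for q by (simp add: x_def ext_carrier_iff)
  moreover have "(\<Sum>q<b 2. \<mu> q r a \<bullet> x q) = (\<Sum>d\<in>{1..n}. \<kappa> d r \<bullet> u a d)"
    if ra: "r < b 1" "a \<in> {1..n}" for r a
  proof
    fix S
    show "(\<Sum>q<b 2. \<mu> q r a \<bullet> x q) S = (\<Sum>d\<in>{1..n}. \<kappa> d r \<bullet> u a d) S"
    proof (cases "S \<subseteq> {1..n}")
      case True
      then show ?thesis unfolding sum_fun_apply ext_scale_apply x_def
        using X ra by simp
    next
      case False
      then show ?thesis unfolding sum_fun_apply ext_scale_apply x_def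
        using ext_carrier_zero[OF u(2) False] by simp
    qed
  qed
  ultimately show ?thesis using that by blast
qed

end

text \<open>The top monomial is killed by every form of positive degree, so a least degree exists.
  \<open>c\<close> is not claimed to be homogeneous; \<open>S\<close> marks a nonzero coefficient in
  the least degree.\<close>

lemma annihilator_minimal_degree:
  fixes h :: "'k::field ext"
  assumes "1 \<le> e" and h: "h \<in> ext_deg n e"
  obtains c S where "c \<in> ext_carrier n" "h \<cdot> c = 0" "c S \<noteq> 0"
    "\<And>c' S'. c' \<in> ext_carrier n \<Longrightarrow> h \<cdot> c' = 0 \<Longrightarrow> card S' < card S \<Longrightarrow> c' S' = 0"
proof -
  define P where "P m \<longleftrightarrow> (\<exists>c\<in>ext_carrier n. h \<cdot> c = 0 \<and> (\<exists>S. card S = m \<and> c S \<noteq> 0))" for m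
  have "P n"
  proof -
    let ?top = "\<lambda>S. if S = {1..n} then 1 else 0 :: 'k"
    have top: "?top \<in> ext_deg n n" by (auto simp: ext_deg_def ext_carrier_iff)
    have ht: "h \<cdot> ?top \<in> ext_deg n (e + n)" by (rule ext_deg_mult[OF h top])
    have "(h \<cdot> ?top) U = 0" for U
    proof (rule ccontr)
      assume "(h \<cdot> ?top) U \<noteq> 0"
      then have "card U = e + n" "U \<subseteq> {1..n}"
        using ht ext_carrier_zero[OF ext_deg_carrier[OF ht], of U] by (auto simp: ext_deg_def)
      moreover from this have "card U \<le> n" using card_mono[of "{1..n}" U] by simp
      ultimately show False using assms(1) by simp
    qed
    then have "h \<cdot> ?top = 0" by (simp add: fun_eq_iff)
    then show ?thesis
      unfolding P_def by (intro bexI[OF _ ext_deg_carrier[OF top]] conjI exI[of _ "{1..n}"]) simp_all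
  qed
  then have L: "P (LEAST m. P m)" by (rule LeastI)
  then obtain c S where c: "c \<in> ext_carrier n" "h \<cdot> c = 0" "card S = (LEAST m. P m)" "c S \<noteq> 0"
    unfolding P_def[of "LEAST m. P m"] by blast
  have "c' S' = 0" if "c' \<in> ext_carrier n" "h \<cdot> c' = 0" "card S' < card S" for c' S'
    using not_less_Least[of "card S'" P] that unfolding c(3) P_def by blast
  then show ?thesis using that c by blast
qed

lemma sum_swap4:
  "(\<Sum>q\<in>A. \<Sum>b\<in>B. \<Sum>p\<in>C. \<Sum>a\<in>D. F q b p a) = (\<Sum>p\<in>C. \<Sum>a\<in>D. \<Sum>b\<in>B. \<Sum>q\<in>A. F q b p a)"
proof -
  have "(\<Sum>q\<in>A. \<Sum>b\<in>B. \<Sum>p\<in>C. \<Sum>a\<in>D. F q b p a) = (\<Sum>q\<in>A. \<Sum>p\<in>C. \<Sum>b\<in>B. \<Sum>a\<in>D. F q b p a)"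
    by (rule sum.cong[OF refl]) (rule sum.swap)
  also have "\<dots> = (\<Sum>p\<in>C. \<Sum>q\<in>A. \<Sum>b\<in>B. \<Sum>a\<in>D. F q b p a)" by (rule sum.swap)
  also have "\<dots> = (\<Sum>p\<in>C. \<Sum>q\<in>A. \<Sum>a\<in>D. \<Sum>b\<in>B. F q b p a)"
    by (intro sum.cong[OF refl]) (rule sum.swap)
  also have "\<dots> = (\<Sum>p\<in>C. \<Sum>a\<in>D. \<Sum>q\<in>A. \<Sum>b\<in>B. F q b p a)"
    by (rule sum.cong[OF refl]) (rule sum.swap)
  also have "\<dots> = (\<Sum>p\<in>C. \<Sum>a\<in>D. \<Sum>b\<in>B. \<Sum>q\<in>A. F q b p a)"
    by (intro sum.cong[OF refl]) (rule sum.swap)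
  finally show ?thesis .
qed

section \<open>Irreducible quadratic forms\<close>

context lifted_linear_resolution
begin

text \<open>The component of degree \<open>e\<close> of the product is the constant term of
  \<open>c\<close> times \<open>h\<close>.\<close>

lemma constant_term_nonzero_not_annihilator:
  assumes h: "h \<noteq> 0" and c: "c \<in> ext_carrier n" "h \<cdot> c = 0"
  shows "c {} = 0"
proof -
  have "ext_part (e + 0) (h \<cdot> c) = h \<cdot> ext_part 0 c"
    by (rule ext_part_mult(2)[OF c(1) form_deg])
  also have "ext_part 0 c = (\<lambda>S. if S = {} then c {} else 0)"
    by (rule ext) (auto simp: ext_part_def card_eq_0_iff dest: ext_carrier_infinite[OF c(1)])
  also have "h \<cdot> \<dots> = c {} \<bullet> h"
    by (rule ext_one_mult'(2)[OF form_closed])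
  finally have eq: "c {} \<bullet> h = 0" unfolding c(2) ext_part_linear(3) by (rule sym)
  obtain S where "h S \<noteq> 0" using h by (auto simp: fun_eq_iff)
  moreover have "c {} * h S = 0" using arg_cong[OF eq, of "\<lambda>x. x S"] by simp
  ultimately show ?thesis by simp
qed

text \<open>The lifted matrices need not compose to 0 in the exterior algebra; \<open>g\<close>
  records the multiples of \<open>h\<close> that appear.\<close>

lemma second_syzygy_relation:
  assumes e: "2 \<le> e"
  shows "\<exists>g. \<forall>q<b 2. \<forall>a\<in>{1..n}. \<forall>c\<in>{1..n}.
    (\<Sum>r<b 1. \<mu> q r a * \<xi> r c) - (\<Sum>r<b 1. \<mu> q r c * \<xi> r a) = quad_coeff h a c * g q"
proof -
  have "\<forall>q\<in>{..<b 2}. \<exists>g. \<forall>a\<in>{1..n}. \<forall>c\<in>{1..n}.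
    (\<Sum>r<b 1. \<mu> q r a * \<xi> r c) - (\<Sum>r<b 1. \<mu> q r c * \<xi> r a) = quad_coeff h a c * g"
  proof
    fix q assume "q \<in> {..<b 2}"
    then have "(\<Sum>r<b 1. ext_lin n (\<mu> q r) \<cdot> ext_lin n (\<xi> r)) \<in> I"
      using complex[of q 0 0] rank_0 by (simp add: numeral_2_eq_2)
    from quadratic_relation[OF e this] show "\<exists>g. \<forall>a\<in>{1..n}. \<forall>c\<in>{1..n}.
      (\<Sum>r<b 1. \<mu> q r a * \<xi> r c) - (\<Sum>r<b 1. \<mu> q r c * \<xi> r a) = quad_coeff h a c * g" .
  qed
  from bchoice[OF this] show ?thesis by (simp only: Ball_def lessThan_iff)
qed

lemma third_syzygy_relation:
  assumes e: "2 \<le> e"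
  shows "\<exists>g. \<forall>p<b 3. \<forall>r<b 1. \<forall>a\<in>{1..n}. \<forall>c\<in>{1..n}.
    (\<Sum>q<b 2. \<nu> p q a * \<mu> q r c) - (\<Sum>q<b 2. \<nu> p q c * \<mu> q r a) = quad_coeff h a c * g p r"
proof -
  have "\<forall>pr\<in>{..<b 3} \<times> {..<b 1}. \<exists>g. \<forall>a\<in>{1..n}. \<forall>c\<in>{1..n}.
    (\<Sum>q<b 2. \<nu> (fst pr) q a * \<mu> q (snd pr) c) - (\<Sum>q<b 2. \<nu> (fst pr) q c * \<mu> q (snd pr) a) = quad_coeff h a c * g"
  proof
    fix pr assume "pr \<in> {..<b 3} \<times> {..<b 1}"
    then have "(\<Sum>q<b 2. ext_lin n (\<nu> (fst pr) q) \<cdot> ext_lin n (\<mu> q (snd pr))) \<in> I"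
      using complex[of "fst pr" 1 "snd pr"] by (auto simp: numeral_2_eq_2 numeral_3_eq_3)
    from quadratic_relation[OF e this] show "\<exists>g. \<forall>a\<in>{1..n}. \<forall>c\<in>{1..n}.
      (\<Sum>q<b 2. \<nu> (fst pr) q a * \<mu> q (snd pr) c) - (\<Sum>q<b 2. \<nu> (fst pr) q c * \<mu> q (snd pr) a) = quad_coeff h a c * g" .
  qed
  from bchoice[OF this] obtain g where g: "\<forall>pr\<in>{..<b 3} \<times> {..<b 1}. \<forall>a\<in>{1..n}. \<forall>c\<in>{1..n}.
    (\<Sum>q<b 2. \<nu> (fst pr) q a * \<mu> q (snd pr) c) - (\<Sum>q<b 2. \<nu> (fst pr) q c * \<mu> q (snd pr) a)
      = quad_coeff h a c * g pr" ..
  show ?thesis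
  proof (intro exI[of _ "\<lambda>p r. g (p, r)"] allI impI)
    fix p r assume "p < b 3" "r < b 1"
    then show "\<forall>a\<in>{1..n}. \<forall>c\<in>{1..n}. (\<Sum>q<b 2. \<nu> p q a * \<mu> q r c) - (\<Sum>q<b 2. \<nu> p q c * \<mu> q r a)
      = quad_coeff h a c * g (p, r)"
      using bspec[OF g, of "(p, r)"] by simp
  qed
qed

text \<open>Let \<open>z\<close> annihilate \<open>h\<close> and have a component of the lowest possible degree. Write
  \<open>z = \<Sum> v\<^sub>b e\<^sub>b\<close>. Then \<open>(h v\<^sub>b)\<^sub>b\<close> is a syzygy of the generators over the exterior algebra, hence of the
  form \<open>(\<Sum> u\<^bsub>ab\<^esub> e\<^sub>a)\<^sub>b\<close> with \<open>u\<close> symmetric, and \<open>u\<close> is a cycle in \<open>F\<^sub>2\<close>. Lifting it to \<open>F\<^sub>3\<close> produces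
  elements \<open>Z\<^sub>b\<close> of the annihilator with \<open>z = \<Sum> Z\<^sub>b e\<^sub>b\<close>, which contradicts the minimality. The lift
  has two structure functions \<open>\<gamma>\<close> and \<open>\<gamma>'\<close>; expanding \<open>\<theta> a b c - \<theta> c b a\<close> along the two reduced
  expressions of the longest permutation shows that \<open>h\<close> is divisible by the linear form \<open>\<gamma> - \<gamma>'\<close>.\<close>

lemma quadric_reducible:
  assumes e: "e = 2" and h: "h \<noteq> 0"
  shows "reducible_quadratic_form n h"
proof (rule ccontr)
  assume irr: "\<not> reducible_quadratic_form n h"
  let ?V = "{1..n}"
  have e2: "2 \<le> e" and h2: "h \<in> ext_deg n 2" using e form_deg by auto
  have "quadric_quotient n h"
    using form_quotient_axioms e by (simp add: quadric_quotient_def)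
  then have I_eq: "I = (\<lambda>x. h \<cdot> x) ` ext_carrier n" by (rule quadric_quotient.I_eq)
  have central: "x \<cdot> h = h \<cdot> x" for x using quadratic_form_central[OF h2] by simp
  obtain \<kappa> where \<kappa>: "\<And>d c. d \<in> ?V \<Longrightarrow> c \<in> ?V \<Longrightarrow> (\<Sum>r<b 1. \<kappa> d r * \<xi> r c) = (if d = c then 1 else 0)"
    by (rule start_left_inverse[OF e2]) blast
  obtain z S where z: "z \<in> ext_carrier n" "h \<cdot> z = 0" "z S \<noteq> 0"
    and minimal: "\<And>c' S'. c' \<in> ext_carrier n \<Longrightarrow> h \<cdot> c' = 0 \<Longrightarrow> card S' < card S \<Longrightarrow> c' S' = 0"
    by (rule annihilator_minimal_degree[OF _ h2]) (simp, blast)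
  obtain v where v: "\<And>c. v c \<in> ext_carrier n" "z = (\<Sum>c\<in>?V. v c \<cdot> ext_gen c)"
    by (rule lin_combination_of_gens[OF z(1) constant_term_nonzero_not_annihilator[OF h z(1,2)]]) blast
  have "(\<Sum>c\<in>?V. (h \<cdot> v c) \<cdot> ext_gen c) = h \<cdot> z"
    unfolding v(2) by (simp only: ext_mult_sum_right ext_mult_assoc)
  then have rel: "(\<Sum>c\<in>?V. (h \<cdot> v c) \<cdot> ext_gen c) = 0" using z(2) by simp
  have hv: "h \<cdot> v c \<in> ext_carrier n" for c using v(1) by simp
  obtain u where u: "\<And>a c. u a c \<in> ext_carrier n" "\<And>a c. u a c = u c a"
    "\<And>c. c \<in> ?V \<Longrightarrow> h \<cdot> v c = (\<Sum>a\<in>?V. u a c \<cdot> ext_gen a)"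
    by (rule linear_syzygy_gens[OF hv rel]) blast
  \<comment> \<open>The symmetric matrix \<open>u\<close>, written in the basis of F_2.\<close>
  obtain x where x: "\<And>q. x q \<in> ext_carrier n"
    "\<And>r a. r < b 1 \<Longrightarrow> a \<in> ?V \<Longrightarrow> (\<Sum>q<b 2. \<mu> q r a \<bullet> x q) = (\<Sum>d\<in>?V. \<kappa> d r \<bullet> u a d)"
    by (rule symmetric_lift[where u = u and \<kappa> = \<kappa>, OF e2 \<kappa> u(2,1)]) (assumption | rule that)+
  \<comment> \<open>The image of \<open>x\<close> in F_1 is \<open>h\<close> times the tuple
    \<open>v\<close> in the coordinates of F_1, so \<open>x\<close> is a cycle over the
    quotient.\<close>
  have "(\<Sum>q<b 2. x q \<cdot> ext_lin n (\<mu> q r)) \<in> I" if r: "r < b 1" for r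
  proof -
    have "(\<Sum>q<b 2. x q \<cdot> ext_lin n (\<mu> q r)) = (\<Sum>q<b 2. \<Sum>a\<in>?V. (\<mu> q r a \<bullet> x q) \<cdot> ext_gen a)"
      by (simp only: ext_mult_lin ext_mult_scale_left)
    also have "\<dots> = (\<Sum>a\<in>?V. (\<Sum>q<b 2. \<mu> q r a \<bullet> x q) \<cdot> ext_gen a)"
      by (subst sum.swap) (simp only: ext_mult_sum_left)
    also have "\<dots> = (\<Sum>a\<in>?V. \<Sum>d\<in>?V. \<kappa> d r \<bullet> (u a d \<cdot> ext_gen a))"
      by (intro sum.cong refl) (simp only: x(2)[OF r] ext_mult_sum_left ext_mult_scale_left)
    also have "\<dots> = (\<Sum>d\<in>?V. \<kappa> d r \<bullet> (\<Sum>a\<in>?V. u a d \<cdot> ext_gen a))"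
      by (subst sum.swap) (simp only: ext_scale_sum_right)
    also have "\<dots> = (\<Sum>d\<in>?V. \<kappa> d r \<bullet> (h \<cdot> v d))"
      by (intro sum.cong refl) (simp only: u(3))
    also have "\<dots> = h \<cdot> (\<Sum>d\<in>?V. \<kappa> d r \<bullet> v d)"
      by (simp only: ext_mult_sum_right ext_mult_scale_right)
    finally show ?thesis
      unfolding I_eq using v(1) by (intro image_eqI) (assumption, intro ext_carrier_sum ext_carrier_closed)
  qed
  then obtain x' where x': "\<forall>p. x' p \<in> ext_carrier n"
    "\<forall>q<b 2. x q - (\<Sum>p<b 3. x' p \<cdot> ext_lin n (\<nu> p q)) \<in> I"
    using exact_next[of x] x(1) by blast
  have "\<forall>q\<in>{..<b 2}. \<exists>\<eta>. \<eta> \<in> ext_carrier n \<and> x q = (\<Sum>p<b 3. x' p \<cdot> ext_lin n (\<nu> p q)) + h \<cdot> \<eta>"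
  proof
    fix q assume "q \<in> {..<b 2}"
    then have "x q - (\<Sum>p<b 3. x' p \<cdot> ext_lin n (\<nu> p q)) \<in> I" using x'(2) by blast
    then obtain \<eta> where "x q - (\<Sum>p<b 3. x' p \<cdot> ext_lin n (\<nu> p q)) = h \<cdot> \<eta>" "\<eta> \<in> ext_carrier n"
      unfolding I_eq by blast
    then show "\<exists>\<eta>. \<eta> \<in> ext_carrier n \<and> x q = (\<Sum>p<b 3. x' p \<cdot> ext_lin n (\<nu> p q)) + h \<cdot> \<eta>"
      by (intro exI[of _ \<eta>] conjI) (simp_all only: diff_eq_eq add.commute)
  qed
  from bchoice[OF this] obtain \<eta> where \<eta>: "\<forall>q\<in>{..<b 2}. \<eta> q \<in> ext_carrier n \<and>
      x q = (\<Sum>p<b 3. x' p \<cdot> ext_lin n (\<nu> p q)) + h \<cdot> \<eta> q" ..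
  have x_eq: "x q = (\<Sum>p<b 3. \<Sum>a\<in>?V. \<nu> p q a \<bullet> (x' p \<cdot> ext_gen a)) + h \<cdot> \<eta> q" if "q < b 2" for q
    using \<eta> that by (simp only: ext_mult_lin lessThan_iff)
  have \<eta>c: "\<eta> q \<in> ext_carrier n" if "q < b 2" for q using \<eta> that by blast

  obtain g where "\<forall>q<b 2. \<forall>a\<in>?V. \<forall>c\<in>?V.
    (\<Sum>r<b 1. \<mu> q r a * \<xi> r c) - (\<Sum>r<b 1. \<mu> q r c * \<xi> r a) = quad_coeff h a c * g q"
    using second_syzygy_relation[OF e2] ..
  moreover define t where "t q a c = (\<Sum>r<b 1. \<mu> q r a * \<xi> r c)" for q a c
  ultimately have t: "t q a c - t q c a = quad_coeff h a c * g q" if "q < b 2" "a \<in> ?V" "c \<in> ?V" for q a c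
    using that by simp
  obtain g' where g': "\<forall>p<b 3. \<forall>r<b 1. \<forall>a\<in>?V. \<forall>c\<in>?V.
    (\<Sum>q<b 2. \<nu> p q a * \<mu> q r c) - (\<Sum>q<b 2. \<nu> p q c * \<mu> q r a) = quad_coeff h a c * g' p r"
    using third_syzygy_relation[OF e2] ..
  \<comment> \<open>The scalar coefficients of the composite from F_3 to F_0. Exchanging the first
    two indices produces \<open>\<gamma>\<close>, exchanging the last two produces
    \<open>\<gamma>'\<close>.\<close>
  define \<theta> where "\<theta> p a b' c = (\<Sum>q<b 2. \<nu> p q a * t q b' c)" for p a b' c
  define \<gamma> where "\<gamma> p c = (\<Sum>r<b 1. g' p r * \<xi> r c)" for p c
  define \<gamma>' where "\<gamma>' p a = (\<Sum>q<b 2. \<nu> p q a * g q)" for p a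
  have \<theta>1: "\<theta> p a b' c - \<theta> p b' a c = quad_coeff h a b' * \<gamma> p c"
    if p: "p < b 3" and "a \<in> ?V" "b' \<in> ?V" for p a b' c
  proof -
    have \<theta>_eq: "\<theta> p a b' c = (\<Sum>r<b 1. (\<Sum>q<b 2. \<nu> p q a * \<mu> q r b') * \<xi> r c)" for a b'
      unfolding \<theta>_def t_def sum_distrib_left sum_distrib_right by (subst sum.swap) (simp only: mult.assoc)
    have "\<theta> p a b' c - \<theta> p b' a c =
      (\<Sum>r<b 1. ((\<Sum>q<b 2. \<nu> p q a * \<mu> q r b') - (\<Sum>q<b 2. \<nu> p q b' * \<mu> q r a)) * \<xi> r c)"
      unfolding \<theta>_eq by (simp only: sum_subtractf left_diff_distrib)
    also have "\<dots> = (\<Sum>r<b 1. quad_coeff h a b' * (g' p r * \<xi> r c))"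
      by (rule sum.cong[OF refl]) (use g' that in \<open>simp add: mult.assoc\<close>)
    finally show ?thesis unfolding \<gamma>_def sum_distrib_left .
  qed
  have \<theta>2: "\<theta> p a b' c - \<theta> p a c b' = quad_coeff h b' c * \<gamma>' p a"
    if "b' \<in> ?V" "c \<in> ?V" for p a b' c
  proof -
    have "\<theta> p a b' c - \<theta> p a c b' = (\<Sum>q<b 2. \<nu> p q a * (t q b' c - t q c b'))"
      unfolding \<theta>_def by (simp only: sum_subtractf right_diff_distrib)
    also have "\<dots> = (\<Sum>q<b 2. quad_coeff h b' c * (\<nu> p q a * g q))"
      by (rule sum.cong[OF refl]) (use t that in \<open>simp add: mult_ac\<close>)
    finally show ?thesis unfolding \<gamma>'_def sum_distrib_left .
  qed
  have \<gamma>\<gamma>': "\<gamma> p c = \<gamma>' p c" if p: "p < b 3" and c: "c \<in> ?V" for p c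
  proof -
    have "\<gamma> p c - \<gamma>' p c = 0"
    proof (rule irreducible_quadratic_form[OF h2 irr _ c, of "\<lambda>c. \<gamma> p c - \<gamma>' p c"])
      fix a b' c assume abc: "a \<in> ?V" "b' \<in> ?V" "c \<in> ?V"
      \<comment> \<open>The two routes from abc to cba pass through bac, bca and through acb,
        cab.\<close>
      have "\<theta> p a b' c - \<theta> p c b' a = quad_coeff h a b' * \<gamma> p c + quad_coeff h a c * \<gamma>' p b' + quad_coeff h b' c * \<gamma> p a"
        using \<theta>1[OF p abc(1,2), of c] \<theta>2[OF abc(1,3), of p b'] \<theta>1[OF p abc(2,3), of a] by (simp add: algebra_simps)
      moreover have "\<theta> p a b' c - \<theta> p c b' a = quad_coeff h b' c * \<gamma>' p a + quad_coeff h a c * \<gamma> p b' + quad_coeff h a b' * \<gamma>' p c"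
        using \<theta>2[OF abc(2,3), of p a] \<theta>1[OF p abc(1,3), of b'] \<theta>2[OF abc(1,2), of p c] by (simp add: algebra_simps)
      ultimately show "quad_coeff h a b' * (\<gamma> p c - \<gamma>' p c) - quad_coeff h a c * (\<gamma> p b' - \<gamma>' p b') +
          quad_coeff h b' c * (\<gamma> p a - \<gamma>' p a) = 0"
        by (simp add: algebra_simps)
    qed
    then show ?thesis by simp
  qed

  have u_eq: "u b' c = (\<Sum>q<b 2. t q b' c \<bullet> x q)" if b': "b' \<in> ?V" and c: "c \<in> ?V" for b' c
  proof -
    have "(\<Sum>q<b 2. t q b' c \<bullet> x q) = (\<Sum>q<b 2. \<Sum>r<b 1. \<xi> r c \<bullet> \<mu> q r b' \<bullet> x q)"
      unfolding t_def by (simp only: ext_scale_sum_left ext_scale_simps(5) mult.commute)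
    also have "\<dots> = (\<Sum>r<b 1. \<xi> r c \<bullet> (\<Sum>q<b 2. \<mu> q r b' \<bullet> x q))"
      by (subst sum.swap) (simp only: ext_scale_sum_right)
    also have "\<dots> = (\<Sum>r<b 1. \<xi> r c \<bullet> (\<Sum>d\<in>?V. \<kappa> d r \<bullet> u b' d))"
      by (rule sum.cong[OF refl]) (simp only: x(2)[OF _ b'] lessThan_iff)
    also have "\<dots> = u b' c" by (rule start_inverse_apply[OF \<kappa> c])
    finally show ?thesis by (rule sym)
  qed
  \<comment> \<open>The antisymmetric part of \<open>u\<close> is the matrix of \<open>h\<close>
    times this sum. It vanishes by symmetry, and some coefficient of \<open>h\<close> is
    invertible.\<close>
  have gx: "(\<Sum>q<b 2. g q \<bullet> x q) = 0"
  proof -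
    obtain U where U: "h U \<noteq> 0" using h by (auto simp: fun_eq_iff)
    then have "card U = 2" "U \<subseteq> ?V"
      using h2 ext_carrier_zero[of h n U] by (auto simp: ext_deg_def)
    then obtain a c where ac: "U = {a, c}" "a < c" by (metis card_2_iff doubleton_eq_iff linorder_neq_iff)
    then have V: "a \<in> ?V" "c \<in> ?V" using \<open>U \<subseteq> ?V\<close> by auto
    have nz: "quad_coeff h a c \<noteq> 0" using U ac by (simp add: quad_coeff_def)
    have "quad_coeff h a c \<bullet> (\<Sum>q<b 2. g q \<bullet> x q) = (\<Sum>q<b 2. (t q a c - t q c a) \<bullet> x q)"
      unfolding ext_scale_sum_right ext_scale_simps(5) by (rule sum.cong[OF refl]) (simp only: t[OF _ V] lessThan_iff)
    also have "\<dots> = u a c - u c a"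
      unfolding u_eq[OF V] u_eq[OF V(2,1)] ext_scale_simps sum_subtractf ..
    also have "\<dots> = 0" using u(2)[of a c] by simp
    finally have "inverse (quad_coeff h a c) \<bullet> quad_coeff h a c \<bullet> (\<Sum>q<b 2. g q \<bullet> x q) = 0"
      by (simp only: ext_scale_0)
    then show ?thesis by (simp only: ext_scale_simps(5) left_inverse[OF nz] ext_scale_1)
  qed

  define Y where "Y b' c = (\<Sum>q<b 2. t q b' c \<bullet> \<eta> q)" for b' c
  define G where "G c = (\<Sum>p<b 3. \<gamma> p c \<bullet> x' p)" for c
  \<comment> \<open>\<open>G\<close> collects the contribution of the antisymmetric part of
    \<open>\<theta>\<close>, and \<open>Y\<close> that of the multiples of \<open>h\<close> left
    over by the lift to F_3. Subtracting both from \<open>v\<close> cancels everything in the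
    product with \<open>h\<close>.\<close>
  define Z where "Z c = v c - G c - (\<Sum>b'\<in>?V. Y b' c \<cdot> ext_gen b')" for c
  have Zc: "Z c \<in> ext_carrier n" for c
    unfolding Z_def G_def Y_def using v(1) x'(1) \<eta>c
    by (intro ext_carrier_closed ext_carrier_sum ext_gen_closed) auto
  have hZ: "h \<cdot> Z c = 0" if c: "c \<in> ?V" for c
  proof -
    have "h \<cdot> v c = (\<Sum>b'\<in>?V. u b' c \<cdot> ext_gen b')" by (rule u(3)[OF c])
    also have "\<dots> = (\<Sum>b'\<in>?V. \<Sum>q<b 2. t q b' c \<bullet> (x q \<cdot> ext_gen b'))"
      by (rule sum.cong[OF refl]) (simp only: u_eq[OF _ c] ext_mult_sum_left ext_mult_scale_left)
    also have "\<dots> = (\<Sum>q<b 2. \<Sum>b'\<in>?V. t q b' c \<bullet> (x q \<cdot> ext_gen b'))" by (rule sum.swap)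
    also have "\<dots> = (\<Sum>q<b 2. \<Sum>b'\<in>?V.
        (\<Sum>p<b 3. \<Sum>a\<in>?V. (\<nu> p q a * t q b' c) \<bullet> (x' p \<cdot> ext_gen a \<cdot> ext_gen b')) +
        h \<cdot> ((t q b' c \<bullet> \<eta> q) \<cdot> ext_gen b'))"
    proof (intro sum.cong refl)
      fix q b' assume "q \<in> {..<b 2}"
      then have "x q \<cdot> ext_gen b' = (\<Sum>p<b 3. \<Sum>a\<in>?V. \<nu> p q a \<bullet> (x' p \<cdot> ext_gen a \<cdot> ext_gen b')) + h \<cdot> \<eta> q \<cdot> ext_gen b'"
        by (simp only: x_eq lessThan_iff ext_mult_add_left ext_mult_sum_left ext_mult_scale_left)
      then show "t q b' c \<bullet> (x q \<cdot> ext_gen b') =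
        (\<Sum>p<b 3. \<Sum>a\<in>?V. (\<nu> p q a * t q b' c) \<bullet> (x' p \<cdot> ext_gen a \<cdot> ext_gen b')) +
        h \<cdot> ((t q b' c \<bullet> \<eta> q) \<cdot> ext_gen b')"
        by (simp only: ext_scale_simps ext_scale_sum_right ext_mult_scale_left ext_mult_scale_right
            ext_mult_assoc mult.commute)
    qed
    also have "\<dots> = (\<Sum>q<b 2. \<Sum>b'\<in>?V. \<Sum>p<b 3. \<Sum>a\<in>?V. (\<nu> p q a * t q b' c) \<bullet> (x' p \<cdot> ext_gen a \<cdot> ext_gen b'))
        + (\<Sum>q<b 2. \<Sum>b'\<in>?V. h \<cdot> ((t q b' c \<bullet> \<eta> q) \<cdot> ext_gen b'))"
      by (simp only: sum.distrib)
    also have "(\<Sum>q<b 2. \<Sum>b'\<in>?V. h \<cdot> ((t q b' c \<bullet> \<eta> q) \<cdot> ext_gen b')) = h \<cdot> (\<Sum>b'\<in>?V. Y b' c \<cdot> ext_gen b')"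
      unfolding Y_def by (subst sum.swap) (simp only: ext_mult_sum_right ext_mult_sum_left)
    also have "(\<Sum>q<b 2. \<Sum>b'\<in>?V. \<Sum>p<b 3. \<Sum>a\<in>?V. (\<nu> p q a * t q b' c) \<bullet> (x' p \<cdot> ext_gen a \<cdot> ext_gen b'))
        = (\<Sum>p<b 3. \<Sum>a\<in>?V. \<Sum>b'\<in>?V. \<theta> p a b' c \<bullet> (x' p \<cdot> ext_gen a \<cdot> ext_gen b'))"
      unfolding \<theta>_def ext_scale_sum_left by (rule sum_swap4)
    \<comment> \<open>Only the exchange of the first two indices of \<open>\<theta>\<close> matters
      here, and \<open>\<theta>1\<close> turns it into a multiple of \<open>h\<close>.\<close>
    also have "\<dots> = (\<Sum>p<b 3. \<gamma> p c \<bullet> (h \<cdot> x' p))"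
      by (rule sum.cong[OF refl], rule double_sum_quadratic_form[OF h2]) (use \<theta>1 in blast)
    also have "\<dots> = h \<cdot> G c"
      unfolding G_def by (simp only: ext_mult_sum_right ext_mult_scale_right)
    finally show ?thesis
      unfolding Z_def ext_mult_diff_right by (simp only: add_diff_cancel_left' diff_self)
  qed
  have sumZ: "(\<Sum>c\<in>?V. Z c \<cdot> ext_gen c) = z"
  proof -
    define G2 where "G2 = (\<Sum>q<b 2. g q \<bullet> \<eta> q)"
    have "(\<Sum>c\<in>?V. \<Sum>b'\<in>?V. Y b' c \<cdot> ext_gen b' \<cdot> ext_gen c) =
        (\<Sum>b'\<in>?V. \<Sum>c\<in>?V. \<Sum>q<b 2. t q b' c \<bullet> (\<eta> q \<cdot> ext_gen b' \<cdot> ext_gen c))"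
      unfolding Y_def by (subst sum.swap) (simp only: ext_mult_sum_left ext_mult_scale_left)
    also have "\<dots> = (\<Sum>b'\<in>?V. \<Sum>q<b 2. \<Sum>c\<in>?V. t q b' c \<bullet> (\<eta> q \<cdot> ext_gen b' \<cdot> ext_gen c))"
      by (rule sum.cong[OF refl]) (rule sum.swap)
    also have "\<dots> = (\<Sum>q<b 2. \<Sum>b'\<in>?V. \<Sum>c\<in>?V. t q b' c \<bullet> (\<eta> q \<cdot> ext_gen b' \<cdot> ext_gen c))"
      by (rule sum.swap)
    also have "\<dots> = (\<Sum>q<b 2. g q \<bullet> (h \<cdot> \<eta> q))"
      by (rule sum.cong[OF refl], rule double_sum_quadratic_form[OF h2]) (use t in blast)
    finally have YG: "(\<Sum>c\<in>?V. \<Sum>b'\<in>?V. Y b' c \<cdot> ext_gen b' \<cdot> ext_gen c) = h \<cdot> G2"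
      unfolding G2_def by (simp only: ext_mult_sum_right ext_mult_scale_right)
    have "(\<Sum>c\<in>?V. G c \<cdot> ext_gen c) = (\<Sum>c\<in>?V. \<Sum>p<b 3. \<gamma> p c \<bullet> (x' p \<cdot> ext_gen c))"
      unfolding G_def by (simp only: ext_mult_sum_left ext_mult_scale_left)
    \<comment> \<open>Irreducibility enters here: replacing \<open>\<gamma>\<close> by
      \<open>\<gamma>'\<close> lets the sum over \<open>p\<close> and \<open>c\<close> be folded
      back into \<open>x q\<close>.\<close>
    also have "\<dots> = (\<Sum>c\<in>?V. \<Sum>p<b 3. \<Sum>q<b 2. (\<nu> p q c * g q) \<bullet> (x' p \<cdot> ext_gen c))"
      by (intro sum.cong refl) (simp only: \<gamma>\<gamma>' lessThan_iff \<gamma>'_def ext_scale_sum_left)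
    also have "\<dots> = (\<Sum>c\<in>?V. \<Sum>q<b 2. \<Sum>p<b 3. (\<nu> p q c * g q) \<bullet> (x' p \<cdot> ext_gen c))"
      by (rule sum.cong[OF refl]) (rule sum.swap)
    also have "\<dots> = (\<Sum>q<b 2. \<Sum>c\<in>?V. \<Sum>p<b 3. (\<nu> p q c * g q) \<bullet> (x' p \<cdot> ext_gen c))"
      by (rule sum.swap)
    also have "\<dots> = (\<Sum>q<b 2. \<Sum>p<b 3. \<Sum>c\<in>?V. (\<nu> p q c * g q) \<bullet> (x' p \<cdot> ext_gen c))"
      by (rule sum.cong[OF refl]) (rule sum.swap)
    also have "\<dots> = (\<Sum>q<b 2. g q \<bullet> (\<Sum>p<b 3. \<Sum>c\<in>?V. \<nu> p q c \<bullet> (x' p \<cdot> ext_gen c)))"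
      by (simp only: ext_scale_sum_right ext_scale_simps(5) mult.commute)
    also have "\<dots> = (\<Sum>q<b 2. g q \<bullet> (x q - h \<cdot> \<eta> q))"
      by (rule sum.cong[OF refl]) (simp only: x_eq lessThan_iff add_diff_cancel_right')
    \<comment> \<open>By \<open>gx\<close> only the correction terms survive, and they cancel
      against \<open>YG\<close>.\<close>
    also have "\<dots> = 0 - h \<cdot> G2"
      unfolding G2_def ext_scale_simps sum_subtractf gx by (simp only: ext_mult_sum_right ext_mult_scale_right)
    finally have GG: "(\<Sum>c\<in>?V. G c \<cdot> ext_gen c) = 0 - h \<cdot> G2" .
    have "(\<Sum>c\<in>?V. Z c \<cdot> ext_gen c) = z - (\<Sum>c\<in>?V. G c \<cdot> ext_gen c) -
        (\<Sum>c\<in>?V. \<Sum>b'\<in>?V. Y b' c \<cdot> ext_gen b' \<cdot> ext_gen c)"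
      unfolding Z_def v(2) by (simp only: ext_mult_diff_left ext_mult_sum_left sum_subtractf)
    also have "\<dots> = z" unfolding YG GG by simp
    finally show ?thesis .
  qed
  \<comment> \<open>The coefficient of \<open>z\<close> at \<open>S\<close> involves only
    coefficients of annihilating elements in one degree less, which vanish by minimality.\<close>
  have "(Z c \<cdot> ext_gen c) S = 0" if c: "c \<in> ?V" for c
  proof (cases "finite S \<and> c \<in> S")
    case True
    then have "card (S - {c}) < card S" by (intro psubset_card_mono) auto
    then have "Z c (S - {c}) = 0" by (rule minimal[OF Zc hZ[OF c]])
    then show ?thesis by (simp add: ext_mult_gen_apply)
  next
    case False
    then show ?thesis by (auto simp: ext_mult_gen_apply)
  qed
  then have "(\<Sum>c\<in>?V. Z c \<cdot> ext_gen c) S = 0" unfolding sum_fun_apply by (intro sum.neutral) blast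
  then show False using z(3) unfolding sumZ by simp
qed

end

lemma koszul_imp_reducible:
  fixes h :: "'k::field ext"
  assumes h: "h \<in> ext_deg n d" and d: "d \<noteq> 1" and K: "koszul (ext_quot n h) (ext_quot_deg n h)"
  shows "reducible_quadratic_form n h"
proof (cases "h = 0")
  case True
  \<comment> \<open>Zero is the product of the linear forms 0 and 0.\<close>
  then show ?thesis
    unfolding reducible_quadratic_form_def by (intro conjI bexI[of _ 0]) simp_all
next
  case nz: False
  interpret form_quotient n d h by unfold_locales (rule h)
  have "2 \<le> d"
  proof (rule ccontr)
    assume "\<not> 2 \<le> d"
    then have "d = 0" using d by simp
    have h0: "h S = 0" if "S \<noteq> {}" for S
    proof (cases "finite S")
      case True
      then show ?thesis using h that \<open>d = 0\<close> by (auto simp: ext_deg_def)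
    next
      case False
      then show ?thesis by (rule ext_carrier_infinite[OF form_closed])
    qed
    have k: "h {} \<noteq> 0"
    proof
      assume "h {} = 0"
      then have "h S = 0" for S using h0 by (cases "S = {}") simp_all
      then show False using nz by (simp add: fun_eq_iff)
    qed
    \<comment> \<open>In degree 0 a nonzero \<open>h\<close> is a unit, so the quotient is the zero
      ring, contradicting that its component of degree 0 is a field.\<close>
    let ?one = "\<lambda>S. if S = {} then 1 else 0 :: 'k"
    have "(\<lambda>S. if S = {} then inverse (h {}) else 0) \<cdot> h = ?one"
      unfolding ext_one_mult'(1)[OF form_closed]
    proof
      fix S show "(inverse (h {}) \<bullet> h) S = ?one S"
        using k h0 by simp
    qed
    then have "?one \<in> I"
      using I.I_l_closed[OF form_in_I, of "\<lambda>S. if S = {} then inverse (h {}) else 0"] by simp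
    then have "cls ?one = \<zero>\<^bsub>Q\<^esub>" by (subst cls_eq_0_iff) simp_all
    moreover have "cls ?one = \<one>\<^bsub>Q\<^esub>" using cls.hom_one by simp
    moreover have "\<one>\<^bsub>Q\<^esub> \<noteq> \<zero>\<^bsub>Q\<^esub>"
    proof -
      have "field (Q\<lparr>carrier := gr 0\<rparr>)"
        using K unfolding koszul_def by (intro standard_graded.gr_0_field) (rule conjunct1)
      from domain.one_not_zero[OF field.axioms(1)[OF this]] show ?thesis by simp
    qed
    ultimately show False by simp
  qed
  moreover obtain b \<alpha> where "lifted_linear_resolution n d h b \<alpha>"
    using linear_resolution_lift K unfolding koszul_def by blast
  ultimately show ?thesis
    using lifted_linear_resolution.form_degree_eq_2[of n d h b \<alpha>]
      lifted_linear_resolution.quadric_reducible[of n d h b \<alpha>] nz by simp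
qed

theorem theorem1p1:
  fixes n d :: nat and h :: "'k::field ext"
  assumes "n \<ge> 1"
    and "h \<in> ext_deg n d"
    and "d \<noteq> 1"
  shows "koszul (ext_quot n h) (ext_quot_deg n h) \<longleftrightarrow> reducible_quadratic_form n h"
  using koszul_imp_reducible[OF assms(2,3)] reducible_imp_koszul by blast

end
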